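(* Let $\widetilde\Omega$ be a bounded domain in $\mathbb{C}^n$, $n\geq 2$, and let $K\subset\widetilde\Omega$ be a non-empty compact set such that $\Omega=\widetilde\Omega\setminus K$ is connected. Suppose that: (1) $H^{0,1}_{L^2}(\widetilde\Omega)$ is Hausdorff. (2) $K=\bigcap_{j=1}^N K_j$, where for $1\leq j\leq N$, $K_j\subset\widetilde\Omega$ is a compact set such that $\widetilde\Omega\setminus K_j$ is connected and $H^{0,1}_{L^2}(\widetilde\Omega\setminus K_j)$ is Hausdorff. (3) For each pair of indices $1\leq i,j\leq N$, the set $\widetilde\Omega\setminus(K_i\cup K_j)$ is connected. Suppose further that for each $j$ we have $H^{0,1}_{L^2}(\widetilde\Omega\setminus K_j)=0$. Then $H^{0,1}_{L^2}(\Omega)=0$.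
   Context: For an open set $U\subset\mathbb{C}^n$, $L^2_{p,q}(U)$ is the space of $(p,q)$-forms on $U$ with $L^2$ coefficients and $\overline\partial$ acts in the sense of distributions. The $L^2$-Dolbeault cohomology is $$H^{p,q}_{L^2}(U)=\frac{\{f\in L^2_{p,q}(U):\overline\partial f=0\}}{\{\overline\partial g: g\in L^2_{p,q-1}(U),\ \overline\partial g\in L^2_{p,q}(U)\}},$$ with the quotient topology; it is Hausdorff if and only if $\overline\partial$ from $L^2_{p,q-1}(U)$ to $L^2_{p,q}(U)$ (with its maximal domain) has closed range. *)

theory Defs
  imports "HOL-Analysis.Analysis"
begin

section \<open>Quotient topologies\<close>

definition quotient_topology :: "'a topology \<Rightarrow> ('a \<times> 'a) set \<Rightarrow> 'a set topology" where
  "quotient_topology X r =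
     topology (\<lambda>W. W \<subseteq> topspace X // r \<and> openin X (\<Union>W))"

lemma openin_quotient_topology:
  assumes r: "equiv (topspace X) r"
  shows "openin (quotient_topology X r) W \<longleftrightarrow> W \<subseteq> topspace X // r \<and> openin X (\<Union>W)"
proof -
  have Int: "\<Union>(S \<inter> T) = \<Union>S \<inter> \<Union>T"
    if "S \<subseteq> topspace X // r" "T \<subseteq> topspace X // r" for S T
  proof
    show "\<Union>S \<inter> \<Union>T \<subseteq> \<Union>(S \<inter> T)"
    proof
      fix x assume "x \<in> \<Union>S \<inter> \<Union>T"
      then obtain A B where AB: "A \<in> S" "B \<in> T" "x \<in> A" "x \<in> B" by blast
      moreover have "A \<in> topspace X // r" "B \<in> topspace X // r" using AB that by blast+
      ultimately have "A = B" using quotient_disj[OF r, of A B] by blast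
      with AB show "x \<in> \<Union>(S \<inter> T)" by blast
    qed
  qed blast
  have "istopology (\<lambda>W. W \<subseteq> topspace X // r \<and> openin X (\<Union>W))"
    unfolding istopology_def
  proof (intro conjI allI impI)
    fix S T assume S: "S \<subseteq> topspace X // r \<and> openin X (\<Union>S)"
      and T: "T \<subseteq> topspace X // r \<and> openin X (\<Union>T)"
    show "S \<inter> T \<subseteq> topspace X // r" using S by blast
    show "openin X (\<Union>(S \<inter> T))" using S T by (simp add: Int openin_Int)
  next
    fix \<K> assume K: "\<forall>S\<in>\<K>. S \<subseteq> topspace X // r \<and> openin X (\<Union>S)"
    show "\<Union>\<K> \<subseteq> topspace X // r" using K by blast
    have "\<Union>(\<Union>\<K>) = \<Union>(Union ` \<K>)" by blast
    moreover have "openin X (\<Union>(Union ` \<K>))" using K by (intro openin_Union) blast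
    ultimately show "openin X (\<Union>(\<Union>\<K>))" by simp
  qed
  then show ?thesis
    unfolding quotient_topology_def by (subst topology_inverse') simp_all
qed

lemma topspace_quotient_topology:
  assumes "equiv (topspace X) r"
  shows "topspace (quotient_topology X r) = topspace X // r"
proof
  show "topspace (quotient_topology X r) \<subseteq> topspace X // r"
    using openin_topspace[of "quotient_topology X r"]
    unfolding openin_quotient_topology[OF assms] by (rule conjunct1)
  have "openin (quotient_topology X r) (topspace X // r)"
    by (simp add: openin_quotient_topology[OF assms] Union_quotient[OF assms])
  then show "topspace X // r \<subseteq> topspace (quotient_topology X r)"
    by (rule openin_subset)
qed

lemma quotient_map_quotient_topology:
  assumes r: "equiv (topspace X) r"
  shows "quotient_map X (quotient_topology X r) (\<lambda>x. r `` {x})"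
proof -
  have "{x \<in> topspace X. r `` {x} \<in> W} = \<Union>W" if W: "W \<subseteq> topspace X // r" for W
  proof (intro equalityI subsetI)
    fix x assume "x \<in> {x \<in> topspace X. r `` {x} \<in> W}"
    then show "x \<in> \<Union>W" using equiv_class_self[OF r, of x] by blast
  next
    fix x assume "x \<in> \<Union>W"
    then obtain A where A: "A \<in> W" "x \<in> A" by blast
    with W have "A \<in> topspace X // r" by blast
    then obtain y where y: "y \<in> topspace X" "A = r `` {y}" by (rule quotientE)
    with A(2) have "(y, x) \<in> r" by simp
    then have "r `` {x} = A" "x \<in> topspace X"
      using equiv_class_eq[OF r, of y x] y(2) equiv_type[OF r] by auto
    with A show "x \<in> {x \<in> topspace X. r `` {x} \<in> W}" by simp
  qed
  then have "openin X {x \<in> topspace X. r `` {x} \<in> W} \<longleftrightarrow> openin (quotient_topology X r) W"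
    if "W \<subseteq> topspace X // r" for W
    using that by (simp only: openin_quotient_topology[OF r]) simp
  moreover have "(\<lambda>x. r `` {x}) ` topspace X = topspace X // r"
    by (auto simp only: quotient_def)
  ultimately show ?thesis
    unfolding quotient_map_def topspace_quotient_topology[OF r] by simp
qed


section \<open>The spaces \<open>L\<^sup>2\<close>\<close>

text \<open>
  Elements of \<open>L\<^sup>2(U)\<close> are represented by functions on the whole space whose values outside \<open>U\<close>
  are irrelevant. Functions that agree almost everywhere on \<open>U\<close> are not identified here; they are
  identified by the relation that defines the cohomology below, where their difference is
  \<open>\<partial>\<^bold>-(0)\<close>. The topology is that of the \<open>L\<^sup>2\<close> (semi)norm.
\<close>

definition L2 :: "'a::euclidean_space set \<Rightarrow> ('a \<Rightarrow> 'b::euclidean_space) set" where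
  "L2 U = {f. f \<in> borel_measurable (lebesgue_on U) \<and>
              integrable (lebesgue_on U) (\<lambda>x. (norm (f x))\<^sup>2)}"

definition L2_norm_on :: "'a::euclidean_space set \<Rightarrow> ('a \<Rightarrow> 'b::euclidean_space) \<Rightarrow> real" where
  "L2_norm_on U f = sqrt (\<integral>x. (norm (f x))\<^sup>2 \<partial>lebesgue_on U)"

definition L2_topology :: "'a::euclidean_space set \<Rightarrow> ('a \<Rightarrow> 'b::euclidean_space) topology" where
  "L2_topology U = topology (\<lambda>V. V \<subseteq> L2 U \<and>
     (\<forall>f\<in>V. \<exists>e>0. \<forall>g\<in>L2 U. L2_norm_on U (\<lambda>x. g x - f x) < e \<longrightarrow> g \<in> V))"

lemma openin_L2_topology:
  "openin (L2_topology U) V \<longleftrightarrow> V \<subseteq> L2 U \<and>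
     (\<forall>f\<in>V. \<exists>e>0. \<forall>g\<in>L2 U. L2_norm_on U (\<lambda>x. g x - f x) < e \<longrightarrow> g \<in> V)"
proof -
  have "istopology (\<lambda>V. V \<subseteq> L2 U \<and>
     (\<forall>f\<in>V. \<exists>e>0. \<forall>g\<in>L2 U. L2_norm_on U (\<lambda>x. g x - f x) < e \<longrightarrow> g \<in> V))"
    (is "istopology ?P")
    unfolding istopology_def
  proof (intro conjI allI impI)
    fix S T assume S: "?P S" and T: "?P T"
    show "S \<inter> T \<subseteq> L2 U" using S by blast
    show "\<forall>f\<in>S \<inter> T. \<exists>e>0. \<forall>g\<in>L2 U. L2_norm_on U (\<lambda>x. g x - f x) < e \<longrightarrow> g \<in> S \<inter> T"
    proof
      fix f assume "f \<in> S \<inter> T"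
      then have f: "f \<in> S" "f \<in> T" by simp_all
      from S f obtain d where
        "d > 0" "\<forall>g\<in>L2 U. L2_norm_on U (\<lambda>x. g x - f x) < d \<longrightarrow> g \<in> S"
        by meson
      moreover from T f obtain e where
        "e > 0" "\<forall>g\<in>L2 U. L2_norm_on U (\<lambda>x. g x - f x) < e \<longrightarrow> g \<in> T"
        by meson
      ultimately show "\<exists>e>0. \<forall>g\<in>L2 U. L2_norm_on U (\<lambda>x. g x - f x) < e \<longrightarrow> g \<in> S \<inter> T"
        by (intro exI[of _ "min d e"]) auto
    qed
  next
    fix \<K> assume K: "\<forall>S\<in>\<K>. ?P S"
    show "\<Union>\<K> \<subseteq> L2 U" using K by blast
    show "\<forall>f\<in>\<Union>\<K>. \<exists>e>0. \<forall>g\<in>L2 U. L2_norm_on U (\<lambda>x. g x - f x) < e \<longrightarrow> g \<in> \<Union>\<K>"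
      using K by (meson Union_iff)
  qed
  then show ?thesis unfolding L2_topology_def by (subst topology_inverse') simp_all
qed

lemma topspace_L2_topology: "topspace (L2_topology U) = L2 U"
proof
  show "topspace (L2_topology U) \<subseteq> L2 U"
    using openin_topspace[of "L2_topology U"] unfolding openin_L2_topology by (rule conjunct1)
  have "openin (L2_topology U) (L2 U)"
    unfolding openin_L2_topology by (auto intro: exI[of _ 1])
  then show "L2 U \<subseteq> topspace (L2_topology U)"
    by (rule openin_subset)
qed


section \<open>The distributional \<open>\<partial>\<^bold>-\<close>-operator in degrees 0 and 1\<close>

primrec C_k :: "nat \<Rightarrow> ('a::real_normed_vector \<Rightarrow> 'b::real_normed_vector) \<Rightarrow> bool" where
  "C_k 0 f \<longleftrightarrow> continuous_on UNIV f"
| "C_k (Suc k) f \<longleftrightarrow> (\<forall>x. f differentiable (at x)) \<and>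
     (\<forall>v. C_k k (\<lambda>x. frechet_derivative f (at x) v))"

definition test_functions :: "'a::euclidean_space set \<Rightarrow> ('a \<Rightarrow> complex) set" where
  "test_functions U = {\<phi>. (\<forall>k. C_k k \<phi>) \<and>
     compact (closure {x. \<phi> x \<noteq> 0}) \<and> closure {x. \<phi> x \<noteq> 0} \<subseteq> U}"

text \<open>
  The Wirtinger derivative \<open>\<partial>\<phi>/\<partial>z\<^bold>-\<^sub>j = (\<partial>\<phi>/\<partial>x\<^sub>j + i \<partial>\<phi>/\<partial>y\<^sub>j) / 2\<close>, the real
  coordinate directions of \<open>z\<^sub>j = x\<^sub>j + i y\<^sub>j\<close> being \<open>axis j 1\<close> and \<open>axis j \<i>\<close>.
\<close>

definition wirtinger_bar :: "'n \<Rightarrow> (complex^'n \<Rightarrow> complex) \<Rightarrow> complex^'n \<Rightarrow> complex" where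
  "wirtinger_bar j \<phi> z =
     (frechet_derivative \<phi> (at z) (axis j 1) + \<i> * frechet_derivative \<phi> (at z) (axis j \<i>)) / 2"

text \<open>The distribution \<open>\<partial>g/\<partial>z\<^bold>-\<^sub>j\<close> on \<open>U\<close>, evaluated at a test function.\<close>

definition distr_wirtinger_bar ::
    "(complex^'n) set \<Rightarrow> 'n \<Rightarrow> (complex^'n \<Rightarrow> complex) \<Rightarrow> (complex^'n \<Rightarrow> complex) \<Rightarrow> complex" where
  "distr_wirtinger_bar U j g \<phi> = - (\<integral>z. g z * wirtinger_bar j \<phi> z \<partial>lebesgue_on U)"

text \<open>
  A \<open>(0,1)\<close>-form \<open>\<Sum>\<^sub>j f\<^sub>j dz\<^bold>-\<^sub>j\<close> is represented by the vector-valued function of its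
  coefficients, so that \<open>L\<^sup>2\<^sub>0\<^sub>,\<^sub>1(U)\<close> is \<open>L2 U\<close> at type \<open>complex^'n \<Rightarrow> complex^'n\<close>.
\<close>

definition dbar_eq ::
    "(complex^'n) set \<Rightarrow> (complex^'n \<Rightarrow> complex) \<Rightarrow> (complex^'n \<Rightarrow> complex^'n) \<Rightarrow> bool" where
  "dbar_eq U g f \<longleftrightarrow> (\<forall>j. \<forall>\<phi>\<in>test_functions U.
     distr_wirtinger_bar U j g \<phi> = (\<integral>z. f z $ j * \<phi> z \<partial>lebesgue_on U))"

text \<open>
  The coefficient of \<open>dz\<^bold>-\<^sub>j \<and> dz\<^bold>-\<^sub>k\<close> (\<open>j < k\<close>) in \<open>\<partial>\<^bold>-f\<close> is
  \<open>\<partial>f\<^sub>k/\<partial>z\<^bold>-\<^sub>j - \<partial>f\<^sub>j/\<partial>z\<^bold>-\<^sub>k\<close>; it is antisymmetric in \<open>j\<close> and \<open>k\<close>, so that for the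
  vanishing of \<open>\<partial>\<^bold>-f\<close> no order on the index type is needed.
\<close>

definition dbar_closed :: "(complex^'n) set \<Rightarrow> (complex^'n \<Rightarrow> complex^'n) \<Rightarrow> bool" where
  "dbar_closed U f \<longleftrightarrow> (\<forall>j k. \<forall>\<phi>\<in>test_functions U.
     distr_wirtinger_bar U j (\<lambda>z. f z $ k) \<phi> - distr_wirtinger_bar U k (\<lambda>z. f z $ j) \<phi> = 0)"


section \<open>The \<open>L\<^sup>2\<close>-Dolbeault cohomology in bidegree \<open>(0,1)\<close>\<close>

definition L2_cocycles :: "(complex^'n) set \<Rightarrow> (complex^'n \<Rightarrow> complex^'n) set" where
  "L2_cocycles U = {f \<in> L2 U. dbar_closed U f}"

definition L2_coboundaries :: "(complex^'n) set \<Rightarrow> (complex^'n \<Rightarrow> complex^'n) set" where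
  "L2_coboundaries U = {f \<in> L2 U. \<exists>g\<in>L2 U. dbar_eq U g f}"

definition cohomologous ::
    "(complex^'n) set \<Rightarrow> ((complex^'n \<Rightarrow> complex^'n) \<times> (complex^'n \<Rightarrow> complex^'n)) set" where
  "cohomologous U = {(f, f'). f \<in> L2_cocycles U \<and> f' \<in> L2_cocycles U \<and>
     (\<lambda>z. f z - f' z) \<in> L2_coboundaries U}"

definition H01_L2 :: "(complex^'n) set \<Rightarrow> (complex^'n \<Rightarrow> complex^'n) set set" where
  "H01_L2 U = L2_cocycles U // cohomologous U"

definition H01_L2_zero :: "(complex^'n) set \<Rightarrow> (complex^'n \<Rightarrow> complex^'n) set" where
  "H01_L2_zero U = cohomologous U `` {\<lambda>_. 0}"

definition H01_L2_topology :: "(complex^'n) set \<Rightarrow> (complex^'n \<Rightarrow> complex^'n) set topology" where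
  "H01_L2_topology U =
     quotient_topology (subtopology (L2_topology U) (L2_cocycles U)) (cohomologous U)"

text \<open>
  For open \<open>U\<close> the relation is an equivalence relation on the cocycles, so that the lemmas on
  quotient topologies apply to \<open>H01_L2_topology\<close>.
\<close>

lemma test_function_integrable:
  fixes w :: "'a::euclidean_space \<Rightarrow> complex"
  assumes cont: "continuous_on UNIV w" and S: "compact S" and supp: "\<And>x. x \<notin> S \<Longrightarrow> w x = 0"
    and U: "open U" and g: "g \<in> L2 U"
  shows "integrable (lebesgue_on U) (\<lambda>x. g x * w x)"
proof -
  have Um: "U \<in> sets lebesgue" using U by (simp add: borel_open)
  have w: "w \<in> borel_measurable borel" by (rule borel_measurable_continuous_onI[OF cont])
  then have "w \<in> borel_measurable lborel" by simp
  then have wm: "w \<in> borel_measurable (lebesgue_on U)"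
    by (intro measurable_restrict_space1 measurable_completion)
  have gm: "g \<in> borel_measurable (lebesgue_on U)"
    and gi: "integrable (lebesgue_on U) (\<lambda>x. (norm (g x))\<^sup>2)"
    using g by (auto simp: L2_def)
  have "bounded (w ` S)"
    using S cont by (meson compact_continuous_image compact_imp_bounded continuous_on_subset top_greatest)
  then obtain M where M: "\<And>x. x \<in> S \<Longrightarrow> norm (w x) \<le> M"
    by (auto simp: bounded_iff)
  have Slm: "S \<in> lmeasurable" using S by (simp add: lmeasurable_compact)
  have "integrable lebesgue (indicator S :: 'a \<Rightarrow> real)"
    using Slm by (simp add: lmeasurable_iff_indicator_has_integral lmeasurable_iff_integrable)
  then have "integrable lebesgue (\<lambda>x. indicator U x *\<^sub>R (indicator S x :: real))"
    by (rule integrable_mult_indicator[OF Um])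
  then have "integrable (lebesgue_on U) (indicator S :: 'a \<Rightarrow> real)"
    using Um by (subst integrable_restrict_space) auto
  then have "integrable (lebesgue_on U) (\<lambda>x. M\<^sup>2 * indicator S x :: real)"
    by (rule integrable_mult_right)
  then have bd: "integrable (lebesgue_on U) (\<lambda>x. (norm (g x))\<^sup>2 + M\<^sup>2 * indicator S x)"
    using gi by simp
  have m: "(\<lambda>x. g x * w x) \<in> borel_measurable (lebesgue_on U)" using gm wm by simp
  have "norm (g x * w x) \<le> norm ((norm (g x))\<^sup>2 + M\<^sup>2 * indicator S x)" for x
  proof (cases "x \<in> S")
    case True
    have M0: "M \<ge> 0" using M[OF True] norm_ge_zero order_trans by blast
    have "norm (g x * w x) \<le> norm (g x) * M"
      by (simp add: norm_mult M True mult_left_mono)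
    also have "\<dots> \<le> (norm (g x))\<^sup>2 + M\<^sup>2"
    proof -
      have "0 \<le> norm (g x) * M" using M0 by simp
      then show ?thesis using sum_squares_bound[of "norm (g x)" M] by linarith
    qed
    finally show ?thesis using True by simp
  qed (simp add: supp)
  then have "AE x in lebesgue_on U. norm (g x * w x) \<le> norm ((norm (g x))\<^sup>2 + M\<^sup>2 * indicator S x)"
    by simp
  with bd m show ?thesis by (rule Bochner_Integration.integrable_bound)
qed

lemma L2_diff:
  assumes f: "f \<in> L2 U" and g: "g \<in> L2 U"
  shows "(\<lambda>x. f x - g x) \<in> L2 U"
proof -
  have fm: "f \<in> borel_measurable (lebesgue_on U)" and gm: "g \<in> borel_measurable (lebesgue_on U)"
    using f g by (auto simp: L2_def)
  have "integrable (lebesgue_on U) (\<lambda>x. (norm (f x - g x))\<^sup>2)"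
  proof (rule Bochner_Integration.integrable_bound)
    show "integrable (lebesgue_on U) (\<lambda>x. 2 * (norm (f x))\<^sup>2 + 2 * (norm (g x))\<^sup>2)"
      using f g by (simp add: L2_def)
    show "(\<lambda>x. (norm (f x - g x))\<^sup>2) \<in> borel_measurable (lebesgue_on U)"
      using fm gm by measurable
    have "(norm (f x - g x))\<^sup>2 \<le> 2 * (norm (f x))\<^sup>2 + 2 * (norm (g x))\<^sup>2" for x
    proof -
      have "(norm (f x - g x))\<^sup>2 \<le> (norm (f x) + norm (g x))\<^sup>2"
        by (simp add: norm_triangle_ineq4)
      also have "\<dots> \<le> 2 * (norm (f x))\<^sup>2 + 2 * (norm (g x))\<^sup>2"
        using sum_squares_bound[of "norm (f x)" "norm (g x)"] by (simp add: power2_sum)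
      finally show ?thesis .
    qed
    then show "AE x in lebesgue_on U. norm ((norm (f x - g x))\<^sup>2)
        \<le> norm (2 * (norm (f x))\<^sup>2 + 2 * (norm (g x))\<^sup>2)"
      by simp
  qed
  then show ?thesis using fm gm by (simp add: L2_def)
qed

lemma L2_zero: "(\<lambda>_. 0) \<in> L2 U"
  by (simp add: L2_def)

lemma L2_component:
  fixes f :: "'a::euclidean_space \<Rightarrow> complex^'n"
  assumes "f \<in> L2 U"
  shows "(\<lambda>z. f z $ j) \<in> L2 U"
proof -
  have fm: "f \<in> borel_measurable (lebesgue_on U)" using assms by (simp add: L2_def)
  have m: "(\<lambda>z. f z $ j) \<in> borel_measurable (lebesgue_on U)"
    by (rule measurable_compose[OF fm])
       (intro borel_measurable_continuous_onI continuous_intros)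
  moreover have "integrable (lebesgue_on U) (\<lambda>z. (norm (f z $ j))\<^sup>2)"
  proof (rule Bochner_Integration.integrable_bound)
    show "integrable (lebesgue_on U) (\<lambda>x. (norm (f x))\<^sup>2)" using assms by (simp add: L2_def)
    show "(\<lambda>z. (norm (f z $ j))\<^sup>2) \<in> borel_measurable (lebesgue_on U)"
      using m by measurable
    show "AE z in lebesgue_on U. norm ((norm (f z $ j))\<^sup>2) \<le> norm ((norm (f z))\<^sup>2)"
    proof (rule AE_I2)
      fix z
      have "norm (f z $ j) \<le> norm (f z)" by (rule Finite_Cartesian_Product.norm_nth_le)
      then have "(norm (f z $ j))\<^sup>2 \<le> (norm (f z))\<^sup>2" by (rule power_mono) simp
      then show "norm ((norm (f z $ j))\<^sup>2) \<le> norm ((norm (f z))\<^sup>2)" by simp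
    qed
  qed
  ultimately show ?thesis by (simp add: L2_def)
qed

lemma test_functionsD:
  assumes "\<phi> \<in> test_functions U"
  shows "continuous_on UNIV \<phi>" "compact (closure {x. \<phi> x \<noteq> 0})"
    "x \<notin> closure {x. \<phi> x \<noteq> 0} \<Longrightarrow> \<phi> x = 0"
proof -
  have "\<forall>k. C_k k \<phi>" using assms unfolding test_functions_def mem_Collect_eq by (rule conjunct1)
  then have "C_k 0 \<phi>" by (rule spec)
  then show "continuous_on UNIV \<phi>" by simp
  show "compact (closure {x. \<phi> x \<noteq> 0})" using assms by (simp add: test_functions_def)
  show "x \<notin> closure {x. \<phi> x \<noteq> 0} \<Longrightarrow> \<phi> x = 0"
    using closure_subset[of "{x. \<phi> x \<noteq> 0}"] by blast
qed

lemma wirtinger_bar_test_function: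
  assumes "\<phi> \<in> test_functions U"
  shows "continuous_on UNIV (wirtinger_bar j \<phi>)"
    "x \<notin> closure {x. \<phi> x \<noteq> 0} \<Longrightarrow> wirtinger_bar j \<phi> x = 0"
proof -
  have "\<forall>k. C_k k \<phi>" using assms unfolding test_functions_def mem_Collect_eq by (rule conjunct1)
  then have "C_k (Suc 0) \<phi>" by (rule spec)
  then have "continuous_on UNIV (\<lambda>x. frechet_derivative \<phi> (at x) v)" for v
    by (simp only: C_k.simps)
  then have "continuous_on UNIV (\<lambda>z. (frechet_derivative \<phi> (at z) (axis j 1) +
      \<i> * frechet_derivative \<phi> (at z) (axis j \<i>)) / 2)"
    by (intro continuous_on_divide continuous_on_add continuous_on_mult continuous_on_const) auto
  then show "continuous_on UNIV (wirtinger_bar j \<phi>)"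
    by (simp only: wirtinger_bar_def[abs_def])
  assume x: "x \<notin> closure {x. \<phi> x \<noteq> 0}"
  have "((\<lambda>_. 0 :: complex) has_derivative (\<lambda>_. 0)) (at x)" by simp
  then have "(\<phi> has_derivative (\<lambda>_. 0)) (at x)"
  proof (rule has_derivative_transform_within_open)
    show "open (- closure {x. \<phi> x \<noteq> 0})" by (rule open_Compl[OF closed_closure])
    show "x \<in> - closure {x. \<phi> x \<noteq> 0}" using x by (rule Compl_iff[THEN iffD2])
    show "0 = \<phi> y" if "y \<in> - closure {x. \<phi> x \<noteq> 0}" for y
      by (rule test_functionsD(3)[OF assms ComplD[OF that], symmetric])
  qed
  then have "frechet_derivative \<phi> (at x) = (\<lambda>_. 0)"
    by (rule frechet_derivative_at[symmetric])
  then show "wirtinger_bar j \<phi> x = 0"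
    by (simp add: wirtinger_bar_def)
qed

lemma distr_wirtinger_bar_diff:
  assumes "open U" "f \<in> L2 U" "g \<in> L2 U" "\<phi> \<in> test_functions U"
  shows "distr_wirtinger_bar U j (\<lambda>z. f z - g z) \<phi> =
    distr_wirtinger_bar U j f \<phi> - distr_wirtinger_bar U j g \<phi>"
proof -
  have int: "integrable (lebesgue_on U) (\<lambda>z. h z * wirtinger_bar j \<phi> z)" if "h \<in> L2 U" for h
    by (rule test_function_integrable[OF wirtinger_bar_test_function(1)[OF assms(4)]
          test_functionsD(2)[OF assms(4)] wirtinger_bar_test_function(2)[OF assms(4)] assms(1) that])
  have "(\<integral>z. (f z - g z) * wirtinger_bar j \<phi> z \<partial>lebesgue_on U) =
      (\<integral>z. f z * wirtinger_bar j \<phi> z \<partial>lebesgue_on U) -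
      (\<integral>z. g z * wirtinger_bar j \<phi> z \<partial>lebesgue_on U)"
    unfolding left_diff_distrib
    by (rule Bochner_Integration.integral_diff[OF int[OF assms(2)] int[OF assms(3)]])
  then show ?thesis
    unfolding distr_wirtinger_bar_def by (simp only: minus_diff_eq minus_diff_minus)
qed

lemma L2_coboundaries_diff:
  assumes U: "open U" and f: "f \<in> L2_coboundaries U" and f': "f' \<in> L2_coboundaries U"
  shows "(\<lambda>z. f z - f' z) \<in> L2_coboundaries U"
proof -
  obtain g g' where g: "g \<in> L2 U" "dbar_eq U g f" and g': "g' \<in> L2 U" "dbar_eq U g' f'"
    and L: "f \<in> L2 U" "f' \<in> L2 U"
    using f f' by (auto simp: L2_coboundaries_def)
  have "dbar_eq U (\<lambda>z. g z - g' z) (\<lambda>z. f z - f' z)"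
    unfolding dbar_eq_def
  proof (intro allI ballI)
    fix j \<phi> assume \<phi>: "\<phi> \<in> test_functions U"
    have int: "integrable (lebesgue_on U) (\<lambda>z. h z $ j * \<phi> z)" if "h \<in> L2 U" for h :: "complex^'a \<Rightarrow> complex^'a"
      by (rule test_function_integrable[OF test_functionsD[OF \<phi>] U L2_component[OF that]])
    have "(\<integral>z. (f z - f' z) $ j * \<phi> z \<partial>lebesgue_on U) =
        (\<integral>z. f z $ j * \<phi> z \<partial>lebesgue_on U) - (\<integral>z. f' z $ j * \<phi> z \<partial>lebesgue_on U)"
      unfolding vector_minus_component left_diff_distrib
      by (rule Bochner_Integration.integral_diff[OF int[OF L(1)] int[OF L(2)]])
    then show "distr_wirtinger_bar U j (\<lambda>z. g z - g' z) \<phi> =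
        (\<integral>z. (f z - f' z) $ j * \<phi> z \<partial>lebesgue_on U)"
      using distr_wirtinger_bar_diff[OF U g(1) g'(1) \<phi>] g(2) g'(2) \<phi> by (simp add: dbar_eq_def)
  qed
  then show ?thesis using L2_diff[OF g(1) g'(1)] L2_diff[OF L] by (auto simp: L2_coboundaries_def)
qed

lemma equiv_cohomologous:
  assumes U: "open U"
  shows "equiv (topspace (subtopology (L2_topology U) (L2_cocycles U))) (cohomologous U)"
proof -
  have top: "topspace (subtopology (L2_topology U) (L2_cocycles U)) = L2_cocycles U"
    by (auto simp: topspace_L2_topology L2_cocycles_def)
  have zero: "(\<lambda>_. 0) \<in> L2_coboundaries U"
    unfolding L2_coboundaries_def
    by (intro CollectI conjI bexI[of _ "\<lambda>_. 0"] L2_zero)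
       (simp add: dbar_eq_def distr_wirtinger_bar_def)
  have neg: "(\<lambda>z. - f z) \<in> L2_coboundaries U" if "f \<in> L2_coboundaries U" for f
    using L2_coboundaries_diff[OF U zero that] by simp
  have "sym (cohomologous U)"
  proof (rule symI)
    fix f f' assume "(f, f') \<in> cohomologous U"
    then show "(f', f) \<in> cohomologous U"
      using neg[of "\<lambda>z. f z - f' z"] by (simp add: cohomologous_def)
  qed
  moreover have "trans (cohomologous U)"
  proof (rule transI)
    fix f f' f'' assume *: "(f, f') \<in> cohomologous U" "(f', f'') \<in> cohomologous U"
    then have "(\<lambda>z. (f z - f' z) - - (f' z - f'' z)) \<in> L2_coboundaries U"
      using L2_coboundaries_diff[OF U _ neg, of "\<lambda>z. f z - f' z" "\<lambda>z. f' z - f'' z"]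
      by (simp add: cohomologous_def)
    then show "(f, f'') \<in> cohomologous U" using * by (simp add: cohomologous_def)
  qed
  moreover have "refl_on (L2_cocycles U) (cohomologous U)"
    using zero by (simp add: refl_on_def cohomologous_def)
  moreover have "cohomologous U \<subseteq> L2_cocycles U \<times> L2_cocycles U"
    by (auto simp: cohomologous_def)
  ultimately show ?thesis
    unfolding top by (simp add: equiv_def)
qed

end

theory Submission
  imports Defs "HOL-Complex_Analysis.Complex_Analysis"
begin

text \<open>
  Write \<open>U\<^sub>j = \<Omega>' - K\<^sub>j\<close>, so that \<open>\<Omega> = \<Union>\<^sub>j U\<^sub>j\<close>. A \<open>\<partial>\<^bold>-\<close>-closed form \<open>f\<close> on \<open>\<Omega>\<close> has, by
  the vanishing of the cohomology of \<open>U\<^sub>j\<close>, an \<open>L\<^sup>2\<close> primitive \<open>g\<^sub>j\<close> on each \<open>U\<^sub>j\<close>. The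
  difference \<open>g\<^sub>j - g\<^sub>1\<close> is annihilated by \<open>\<partial>\<^bold>-\<close> on \<open>U\<^sub>j \<inter> U\<^sub>1 = \<Omega>' - (K\<^sub>j \<union> K\<^sub>1)\<close>, hence it is
  a holomorphic function (\<open>weyl_lemma\<close>) on the connected complement of a compact set, and for
  \<open>n \<ge> 2\<close> it extends holomorphically to all of \<open>\<Omega>'\<close> (\<open>hartogs_extension\<close>). The extension is in
  \<open>L\<^sup>2(\<Omega>')\<close>, being bounded near the compact set. Subtracting it from \<open>g\<^sub>j\<close> gives a new primitive
  \<open>g'\<^sub>j\<close> of \<open>f\<close> on \<open>U\<^sub>j\<close> which agrees almost everywhere with \<open>g\<^sub>1\<close> on \<open>U\<^sub>j \<inter> U\<^sub>1\<close>.

  Two of the new primitives differ on \<open>U\<^sub>i \<inter> U\<^sub>j\<close> by a holomorphic function that vanishes on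
  \<open>U\<^sub>i \<inter> U\<^sub>j \<inter> U\<^sub>1\<close>. The latter is not empty, since otherwise \<open>\<Omega>'\<close> would be compact, and
  \<open>U\<^sub>i \<inter> U\<^sub>j\<close> is connected; so the difference is zero by the identity theorem
  (\<open>weakly_holo_identity\<close>). Hence the \<open>g'\<^sub>j\<close> patch to one function on \<open>\<Omega>\<close>. As there are finitely
  many pieces it is in \<open>L\<^sup>2(\<Omega>)\<close>, and because \<open>\<partial>\<^bold>- g = f\<close> is a local condition
  (\<open>dbar_eq_finite_union\<close>, by splitting test functions) it is a primitive of \<open>f\<close>.

  The regularity of weakly holomorphic functions rests on mollification with a radial kernel, whose
  result does not depend on the radius. The extension theorem rests on the equation
  \<open>\<partial>\<^bold>- u = \<alpha>\<close> for a closed form \<open>\<alpha>\<close> with compact support, which is solved by the Cauchy transform in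
  one variable; written in polar coordinates, this integral has no singular kernel.
\<close>

section \<open>Smooth cutoff functions\<close>

abbreviation fderiv where
  "fderiv f x \<equiv> frechet_derivative f (at x)"

lemma C_k_SucI:
  assumes "\<And>x. (f has_derivative f' x) (at x)" "\<And>v. C_k k (\<lambda>x. f' x v)"
  shows "C_k (Suc k) f"
proof -
  have "fderiv f x = f' x" for x
    using frechet_derivative_at[OF assms(1)] by metis
  then show ?thesis using assms by (auto simp: differentiable_def)
qed

lemma C_k_has_derivative:
  assumes "C_k (Suc k) f"
  shows "(f has_derivative fderiv f x) (at x)"
  using assms frechet_derivative_works by auto

lemma C_k_decrease: "C_k (Suc k) f \<Longrightarrow> C_k k f"
proof (induction k arbitrary: f)
  case 0
  then show ?case
    using differentiable_imp_continuous_within by (auto simp: continuous_on_eq_continuous_within)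
next
  case (Suc k)
  show ?case
    by (rule C_k_SucI[OF C_k_has_derivative[OF Suc.prems]])
       (rule Suc.IH, use Suc.prems in simp)
qed

lemma C_k_const: "C_k k (\<lambda>_. c)"
proof (induction k arbitrary: c)
  case (Suc k)
  then show ?case by (intro C_k_SucI[where f'="\<lambda>_ _. 0"]) auto
qed simp

lemma C_k_linear: "bounded_linear f \<Longrightarrow> C_k k f"
proof (cases k)
  case (Suc m)
  assume "bounded_linear f"
  then show ?thesis unfolding Suc
    by (intro C_k_SucI[where f'="\<lambda>_. f"] bounded_linear_imp_has_derivative C_k_const)
qed (simp add: linear_continuous_on)

lemma C_k_linear_compose:
  "bounded_linear L \<Longrightarrow> C_k k f \<Longrightarrow> C_k k (\<lambda>x. L (f x))"
proof (induction k arbitrary: f)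
  case 0
  then show ?case by (auto intro: bounded_linear.continuous_on)
next
  case (Suc k)
  show ?case
    by (rule C_k_SucI[OF bounded_linear.has_derivative[OF Suc.prems(1) C_k_has_derivative[OF Suc.prems(2)]]])
       (rule Suc.IH[OF Suc.prems(1)], use Suc.prems(2) in simp)
qed

lemma C_k_add: "C_k k f \<Longrightarrow> C_k k g \<Longrightarrow> C_k k (\<lambda>x. f x + g x)"
proof (induction k arbitrary: f g)
  case 0
  then show ?case by (auto intro: continuous_intros)
next
  case (Suc k)
  show ?case
    by (rule C_k_SucI[OF has_derivative_add[OF C_k_has_derivative[OF Suc.prems(1)] C_k_has_derivative[OF Suc.prems(2)]]])
       (rule Suc.IH, use Suc.prems in simp_all)
qed

lemma C_k_mult:
  fixes f g :: "'a::real_normed_vector \<Rightarrow> 'b::real_normed_algebra"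
  shows "C_k k f \<Longrightarrow> C_k k g \<Longrightarrow> C_k k (\<lambda>x. f x * g x)"
proof (induction k arbitrary: f g)
  case 0
  then show ?case by (auto intro: continuous_intros)
next
  case (Suc k)
  show ?case
    by (rule C_k_SucI[OF has_derivative_mult[OF C_k_has_derivative[OF Suc.prems(1)] C_k_has_derivative[OF Suc.prems(2)]]])
       (intro C_k_add Suc.IH C_k_decrease[OF Suc.prems(1)] C_k_decrease[OF Suc.prems(2)]; use Suc.prems in simp)
qed

text \<open>
  Translations and dilations of a bump serve as test functions.
\<close>

lemma C_k_affine: "C_k k f \<Longrightarrow> C_k k (\<lambda>x. f (a + s *\<^sub>R x))"
proof (induction k arbitrary: f)
  case 0
  then show ?case by (auto intro!: continuous_on_compose2[of UNIV f] continuous_intros)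
next
  case (Suc k)
  have "((\<lambda>x. f (a + s *\<^sub>R x)) has_derivative (\<lambda>v. fderiv f (a + s *\<^sub>R x) (s *\<^sub>R v))) (at x)" for x
    by (rule has_derivative_compose[where g=f, OF _ C_k_has_derivative[OF Suc.prems]])
       (auto intro!: derivative_eq_intros)
  then show ?case
    by (rule C_k_SucI) (rule Suc.IH, use Suc.prems in simp)
qed

lemma C_k_inverse:
  fixes f :: "'a::real_normed_vector \<Rightarrow> real"
  shows "(\<And>x. f x \<noteq> 0) \<Longrightarrow> C_k k f \<Longrightarrow> C_k k (\<lambda>x. inverse (f x))"
proof (induction k)
  case 0
  then show ?case by (auto intro: continuous_intros)
next
  case (Suc k)
  have D: "((\<lambda>x. inverse (f x)) has_derivative
      (\<lambda>v. - (inverse (f x) * fderiv f x v * inverse (f x)))) (at x)" for x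
    by (rule Deriv.has_derivative_inverse[OF Suc.prems(1) C_k_has_derivative[OF Suc.prems(2)]])
  have "C_k k (\<lambda>x. (-1) * (inverse (f x) * fderiv f x v * inverse (f x)))" for v
    using Suc C_k_decrease[OF Suc.prems(2)] by (intro C_k_mult C_k_const) auto
  then show ?case by (intro C_k_SucI[OF D]) simp
qed

lemma C_k_compose_real:
  fixes f :: "'a::real_normed_vector \<Rightarrow> real" and F :: "real \<Rightarrow> real"
  shows "C_k k F \<Longrightarrow> C_k k f \<Longrightarrow> C_k k (\<lambda>x. F (f x))"
proof (induction k arbitrary: F)
  case 0
  then show ?case by (auto intro!: continuous_on_compose2[of UNIV F])
next
  case (Suc k)
  have D: "((\<lambda>x. F (f x)) has_derivative
      (\<lambda>v. fderiv f x v * fderiv F (f x) 1)) (at x)" for x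
  proof -
    have "((\<lambda>x. F (f x)) has_derivative
      (\<lambda>v. fderiv F (f x) (fderiv f x v))) (at x)"
      by (rule has_derivative_compose[OF C_k_has_derivative[OF Suc.prems(2)] C_k_has_derivative[OF Suc.prems(1)]])
    moreover have "(\<lambda>v. fderiv F (f x) (fderiv f x v)) =
        (\<lambda>v. fderiv f x v * fderiv F (f x) 1)"
    proof
      fix v
      show "fderiv F (f x) (fderiv f x v) =
          fderiv f x v * fderiv F (f x) 1"
        using linear_scale[OF has_derivative_linear[OF C_k_has_derivative[OF Suc.prems(1)]],
          of "f x" "fderiv f x v" 1] by (simp only: real_scaleR_def mult_1_right)
    qed
    ultimately show ?thesis by (rule back_subst)
  qed
  show ?case
    by (rule C_k_SucI[OF D], rule C_k_mult)
       (use Suc C_k_decrease[OF Suc.prems(2)] in auto)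
qed

lemma C_k_inner_self: "C_k k (\<lambda>x::'a::euclidean_space. x \<bullet> x)"
proof (cases k)
  case (Suc m)
  have "((\<lambda>x::'a. x \<bullet> x) has_derivative (\<lambda>v. 2 * (v \<bullet> x))) (at x)" for x
    by (auto intro!: derivative_eq_intros simp: inner_commute)
  then show ?thesis unfolding Suc
    by (rule C_k_SucI) (intro C_k_mult C_k_const C_k_linear bounded_linear_inner_right)
qed (auto intro: continuous_intros)

lemma C_k_prod:
  fixes f :: "'i \<Rightarrow> 'a::real_normed_vector \<Rightarrow> real"
  assumes "finite I" "\<And>i. i \<in> I \<Longrightarrow> C_k k (f i)"
  shows "C_k k (\<lambda>x. \<Prod>i\<in>I. f i x)"
  using assms by (induction I) (auto intro: C_k_mult C_k_const)

text \<open>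
  The derivatives of \<open>exp (-1/t)\<close> on the positive half-line, continued by zero, are all of the form
  \<open>P (1/t) exp (-1/t)\<close> with a polynomial \<open>P\<close>. Carrying \<open>P\<close> as a parameter makes the family closed
  under differentiation, so that one induction proves smoothness.
\<close>

definition flat :: "real poly \<Rightarrow> real \<Rightarrow> real" where
  "flat P t = (if t > 0 then poly P (1 / t) * exp (- (1 / t)) else 0)"

lemma poly_exp_tendsto_0: "((\<lambda>x::real. poly P x * exp (- x)) \<longlongrightarrow> 0) at_top"
proof -
  have "((\<lambda>x::real. coeff P i * (x ^ i / exp x)) \<longlongrightarrow> coeff P i * 0) at_top" for i
    by (intro tendsto_intros tendsto_power_div_exp_0)
  then have "((\<lambda>x::real. \<Sum>i\<le>degree P. coeff P i * (x ^ i / exp x)) \<longlongrightarrow> (\<Sum>i\<le>degree P. 0)) at_top"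
    by (intro tendsto_sum) simp
  then show ?thesis by (simp add: poly_altdef sum_distrib_right exp_minus divide_inverse mult.assoc)
qed

lemma flat_tendsto_0: "((\<lambda>t. flat P t) \<longlongrightarrow> 0) (at 0)"
proof -
  have "((\<lambda>t::real. poly P (inverse t) * exp (- inverse t)) \<longlongrightarrow> 0) (at_right 0)"
    by (rule filterlim_compose[OF poly_exp_tendsto_0 filterlim_inverse_at_top_right])
  then have R: "((\<lambda>t. flat P t) \<longlongrightarrow> 0) (at_right 0)"
    by (rule Lim_transform_eventually) (auto simp: flat_def eventually_at_filter inverse_eq_divide)
  have L: "((\<lambda>t. flat P t) \<longlongrightarrow> 0) (at_left 0)"
    by (rule Lim_transform_eventually[OF tendsto_const]) (auto simp: flat_def eventually_at_filter)
  show ?thesis using L R by (simp add: filterlim_at_split)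
qed

text \<open>
  For \<open>t > 0\<close> the derivative is \<open>(P (1/t) - P' (1/t)) t\<^sup>-\<^sup>2 exp (-1/t)\<close>, and two applications of
  \<open>pCons 0\<close> produce the factor \<open>t\<^sup>-\<^sup>2\<close>. At \<open>0\<close> the difference quotient is again a member of the
  family, so it tends to \<open>0\<close>.
\<close>

lemma flat_has_derivative:
  "(flat P has_real_derivative flat (pCons 0 (pCons 0 (P - pderiv P))) t) (at t)"
proof -
  consider "t > 0" | "t < 0" | "t = 0" by linarith
  then show ?thesis
  proof cases
    case 1
    have "((\<lambda>t. poly P (1 / t) * exp (- (1 / t))) has_real_derivative
        flat (pCons 0 (pCons 0 (P - pderiv P))) t) (at t)"
      using 1 by (auto intro!: derivative_eq_intros simp: flat_def field_simps power2_eq_square)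
    then show ?thesis
      by (rule has_field_derivative_transform_within[OF _ 1]) (auto simp: flat_def dist_real_def)
  next
    case 2
    have "((\<lambda>t. 0::real) has_real_derivative flat (pCons 0 (pCons 0 (P - pderiv P))) t) (at t)"
      using 2 by (simp add: flat_def)
    then show ?thesis
      by (rule has_field_derivative_transform_within[of _ _ _ _ "- t"]) (use 2 in \<open>auto simp: flat_def dist_real_def\<close>)
  next
    case 3
    have "((\<lambda>t. flat (pCons 0 P) t) \<longlongrightarrow> 0) (at 0)" by (rule flat_tendsto_0)
    then have "((\<lambda>t. (flat P t - flat P 0) / (t - 0)) \<longlongrightarrow> 0) (at 0)"
      by (rule Lim_transform_eventually) (auto simp: flat_def eventually_at_filter)
    then show ?thesis by (simp add: 3 has_field_derivative_iff flat_def)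
  qed
qed

lemma C_k_flat: "C_k k (flat P)"
proof (induction k arbitrary: P)
  case 0
  have "isCont (flat P) t" for t by (rule DERIV_isCont[OF flat_has_derivative])
  then show ?case by (simp add: continuous_on_eq_continuous_at)
next
  case (Suc k)
  show ?case
    by (rule C_k_SucI[OF flat_has_derivative[unfolded has_field_derivative_def]])
       (intro C_k_mult C_k_const Suc.IH)
qed

definition smooth_step :: "real \<Rightarrow> real" where
  "smooth_step t = flat 1 t / (flat 1 t + flat 1 (1 - t))"

lemma flat_1: "flat 1 t \<ge> 0" "t \<le> 0 \<Longrightarrow> flat 1 t = 0" "t > 0 \<Longrightarrow> flat 1 t > 0"
  by (auto simp: flat_def)

lemma smooth_step_denominator: "flat 1 t + flat 1 (1 - t) > 0"
  using flat_1(1)[of t] flat_1(1)[of "1 - t"] flat_1(3)[of t] flat_1(3)[of "1 - t"]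
  by (cases "t > 0") (auto intro: add_pos_nonneg add_nonneg_pos)

lemma smooth_step: "t \<le> 0 \<Longrightarrow> smooth_step t = 0" "t \<ge> 1 \<Longrightarrow> smooth_step t = 1" "0 \<le> smooth_step t" "smooth_step t \<le> 1"
  using smooth_step_denominator[of t] flat_1[of t] flat_1[of "1 - t"] by (auto simp: smooth_step_def)

lemma C_k_smooth_step: "C_k k smooth_step"
proof -
  have "C_k k (\<lambda>t. flat 1 (1 + (-1) *\<^sub>R t))" by (rule C_k_affine[OF C_k_flat])
  then have "C_k k (\<lambda>t. flat 1 t * inverse (flat 1 t + flat 1 (1 - t)))"
    using smooth_step_denominator
    by (intro C_k_mult C_k_inverse C_k_add C_k_flat) (auto simp: less_imp_neq[symmetric])
  then show ?thesis by (simp add: smooth_step_def[abs_def] divide_inverse)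
qed

text \<open>
  As a function of \<open>norm (z - x)\<^sup>2\<close> it is smooth at the centre as well. It is \<open>1\<close> up to distance \<open>r\<close>
  and \<open>0\<close> from distance \<open>sqrt 2 * r\<close> on.
\<close>

definition ball_cutoff :: "'a::euclidean_space \<Rightarrow> real \<Rightarrow> 'a \<Rightarrow> real" where
  "ball_cutoff x r z = smooth_step (2 - (norm (z - x) / r)\<^sup>2)"

lemma C_k_ball_cutoff: "C_k k (ball_cutoff x r)"
proof -
  have "C_k k (\<lambda>z. (- x + 1 *\<^sub>R z) \<bullet> (- x + 1 *\<^sub>R z))"
    by (rule C_k_affine[OF C_k_inner_self])
  then have "C_k k (\<lambda>z. 2 + (- inverse (r\<^sup>2)) * ((- x + 1 *\<^sub>R z) \<bullet> (- x + 1 *\<^sub>R z)))"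
    by (intro C_k_add C_k_mult C_k_const)
  then have "C_k k (\<lambda>z. smooth_step (2 + (- inverse (r\<^sup>2)) * ((- x + 1 *\<^sub>R z) \<bullet> (- x + 1 *\<^sub>R z))))"
    by (rule C_k_compose_real[OF C_k_smooth_step])
  also have "(\<lambda>z. smooth_step (2 + (- inverse (r\<^sup>2)) * ((- x + 1 *\<^sub>R z) \<bullet> (- x + 1 *\<^sub>R z)))) = ball_cutoff x r"
  proof
    fix z
    have "(norm (z - x) / r)\<^sup>2 = inverse (r\<^sup>2) * ((z - x) \<bullet> (z - x))"
      by (simp add: power_divide power2_norm_eq_inner[symmetric] divide_inverse[of _ "r\<^sup>2"] del: inverse_eq_divide divide_inverse)
    then show "smooth_step (2 + (- inverse (r\<^sup>2)) * ((- x + 1 *\<^sub>R z) \<bullet> (- x + 1 *\<^sub>R z))) = ball_cutoff x r z"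
      by (simp add: ball_cutoff_def)
  qed
  finally show ?thesis .
qed

lemma ball_cutoff:
  assumes "r > 0"
  shows "norm (z - x) \<le> r \<Longrightarrow> ball_cutoff x r z = 1"
    and "2 * r \<le> norm (z - x) \<Longrightarrow> ball_cutoff x r z = 0"
    and "0 \<le> ball_cutoff x r z" "ball_cutoff x r z \<le> 1"
proof -
  assume "norm (z - x) \<le> r"
  then have "(norm (z - x) / r)\<^sup>2 \<le> 1\<^sup>2" using assms by (intro power_mono) auto
  then show "ball_cutoff x r z = 1" by (simp add: ball_cutoff_def smooth_step(2))
next
  assume "2 * r \<le> norm (z - x)"
  then have "2\<^sup>2 \<le> (norm (z - x) / r)\<^sup>2" using assms by (intro power_mono) (auto simp: field_simps)
  then show "ball_cutoff x r z = 0" by (simp add: ball_cutoff_def smooth_step(1))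
qed (simp_all add: ball_cutoff_def smooth_step)

text \<open>
  Cover \<open>C\<close> by finitely many small balls. With one cutoff \<open>b\<^sub>x\<close> for each of them,
  \<open>1 - \<Prod>\<^sub>x (1 - b\<^sub>x)\<close> is \<open>1\<close> wherever some \<open>b\<^sub>x\<close> is, and vanishes where all of them do.
\<close>

lemma smooth_urysohn:
  fixes C U :: "'a::euclidean_space set"
  assumes C: "compact C" and U: "open U" and CU: "C \<subseteq> U"
  obtains \<eta> :: "'a \<Rightarrow> real" and W where
    "\<And>k. C_k k \<eta>" "\<And>x. 0 \<le> \<eta> x" "\<And>x. \<eta> x \<le> 1"
    "compact (closure {x. \<eta> x \<noteq> 0})" "closure {x. \<eta> x \<noteq> 0} \<subseteq> U"
    "open W" "C \<subseteq> W" "\<And>x. x \<in> W \<Longrightarrow> \<eta> x = 1"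
proof -
  have "\<exists>r>0. cball x (2 * r) \<subseteq> U" if "x \<in> C" for x
  proof -
    obtain e where "e > 0" "cball x e \<subseteq> U" using U CU \<open>x \<in> C\<close> open_contains_cball by blast
    then show ?thesis by (intro exI[of _ "e/2"]) auto
  qed
  then obtain r where r: "\<And>x. x \<in> C \<Longrightarrow> r x > 0 \<and> cball x (2 * r x) \<subseteq> U" by metis
  have "C \<subseteq> (\<Union>x\<in>C. ball x (r x))" using r by force
  then obtain F where F: "F \<subseteq> C" "finite F" "C \<subseteq> (\<Union>x\<in>F. ball x (r x))"
    using compactE_image[OF C, of C "\<lambda>x. ball x (r x)"] open_ball by metis
  define \<eta> where "\<eta> z = 1 - (\<Prod>x\<in>F. 1 - ball_cutoff x (r x) z)" for z
  have supp: "{z. \<eta> z \<noteq> 0} \<subseteq> (\<Union>x\<in>F. cball x (2 * r x))" (is "_ \<subseteq> ?S")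
  proof
    fix z assume z: "z \<in> {z. \<eta> z \<noteq> 0}"
    have "\<exists>x\<in>F. ball_cutoff x (r x) z \<noteq> 0"
    proof (rule ccontr)
      assume "\<not> ?thesis"
      then have "\<eta> z = 0" by (simp add: \<eta>_def)
      with z show False by simp
    qed
    then obtain x where x: "x \<in> F" "ball_cutoff x (r x) z \<noteq> 0" by blast
    then have "norm (z - x) < 2 * r x" using ball_cutoff(2)[of "r x" z x] r[OF subsetD[OF F(1) x(1)]] by linarith
    then show "z \<in> ?S" using x(1) by (intro UN_I[OF x(1)]) (simp add: dist_norm norm_minus_commute)
  qed
  have S: "compact ?S" using F(2) by (intro compact_UN) auto
  have cl: "closure {z. \<eta> z \<noteq> 0} \<subseteq> ?S"
    by (rule closure_minimal[OF supp compact_imp_closed[OF S]])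
  have b: "0 \<le> 1 - ball_cutoff x (r x) z" "1 - ball_cutoff x (r x) z \<le> 1" if "x \<in> F" for x z
    using ball_cutoff(3,4)[of "r x" x z] r[OF subsetD[OF F(1) that]] by auto
  show ?thesis
  proof (rule that[of \<eta> "\<Union>x\<in>F. ball x (r x)"])
    show "C_k k \<eta>" for k
    proof -
      have "C_k k (\<lambda>z. 1 + (-1) * (\<Prod>x\<in>F. 1 + (-1) * ball_cutoff x (r x) z))"
        by (intro C_k_add C_k_mult C_k_const C_k_prod C_k_ball_cutoff F(2))
      then show ?thesis by (simp add: \<eta>_def[abs_def])
    qed
    have "(\<Prod>x\<in>F. 1 - ball_cutoff x (r x) z) \<le> 1" for z
      by (rule prod_le_1) (use b in blast)
    then show "0 \<le> \<eta> x" for x by (simp add: \<eta>_def)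
    have "(\<Prod>x\<in>F. 1 - ball_cutoff x (r x) z) \<ge> 0" for z
      by (rule prod_nonneg) (use b in blast)
    then show "\<eta> x \<le> 1" for x by (simp add: \<eta>_def)
    show "compact (closure {x. \<eta> x \<noteq> 0})"
      using bounded_subset[OF compact_imp_bounded[OF S] supp] by simp
    show "closure {x. \<eta> x \<noteq> 0} \<subseteq> U" using cl r F(1) by blast
    show "open (\<Union>x\<in>F. ball x (r x))" by blast
    show "C \<subseteq> (\<Union>x\<in>F. ball x (r x))" by (rule F(3))
    show "\<eta> z = 1" if z: "z \<in> (\<Union>x\<in>F. ball x (r x))" for z
    proof -
      obtain x where x: "x \<in> F" "z \<in> ball x (r x)" using z by blast
      then have "ball_cutoff x (r x) z = 1"
        using r[OF subsetD[OF F(1) x(1)]] by (intro ball_cutoff(1)) (auto simp: dist_norm norm_minus_commute)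
      then have "(\<Prod>x\<in>F. 1 - ball_cutoff x (r x) z) = 0"
        using x(1) by (intro prod_zero[OF F(2)] bexI[of _ x]) auto
      then show ?thesis by (simp add: \<eta>_def)
    qed
  qed
qed

section \<open>Differentiation under the integral sign and integration by parts\<close>

text \<open>
  The Lipschitz bound on the integrand dominates the difference quotients, and passes to the
  derivative; dominated convergence along sequences then gives the claim.
\<close>

lemma has_derivative_integral_dominated:
  fixes f :: "'a::real_normed_vector \<Rightarrow> 'b \<Rightarrow> 'c::{banach, second_countable_topology}"
  assumes e: "e > 0"
    and int: "\<And>z. z \<in> ball z0 e \<Longrightarrow> integrable M (f z)"
    and der: "\<And>x. x \<in> space M \<Longrightarrow> ((\<lambda>z. f z x) has_derivative D x) (at z0)"
    and meas: "\<And>v. (\<lambda>x. D x v) \<in> borel_measurable M"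
    and lip: "\<And>z x. z \<in> ball z0 e \<Longrightarrow> x \<in> space M \<Longrightarrow> norm (f z x - f z0 x) \<le> B x * norm (z - z0)"
    and B: "integrable M B"
  shows "((\<lambda>z. \<integral>x. f z x \<partial>M) has_derivative (\<lambda>v. \<integral>x. D x v \<partial>M)) (at z0)"
proof -
  have bound: "norm (D x v) \<le> B x * norm v" if x: "x \<in> space M" for x v
  proof (cases "v = 0")
    case True
    then show ?thesis using has_derivative_linear[OF der[OF x]] by (simp add: linear_0)
  next
    case False
    show ?thesis
    proof (rule field_le_epsilon)
      fix \<epsilon> :: real assume "\<epsilon> > 0"
      then have eps: "\<epsilon> / norm v > 0" using False by simp
      obtain d where d: "d > 0" "\<And>y. norm (y - z0) < d \<Longrightarrow>
          norm (f y x - f z0 x - D x (y - z0)) \<le> \<epsilon> / norm v * norm (y - z0)"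
        using der[OF x] eps unfolding has_derivative_within_alt by blast
      \<comment> \<open>small enough for both the differentiability and the Lipschitz estimate at \<open>z0 + t *\<^sub>R v\<close>\<close>
      define t where "t = min d e / (2 * norm v)"
      have t: "t > 0" "t * norm v < d" "t * norm v < e"
        using d(1) e False by (auto simp: t_def min_def field_simps)
      have "t * norm (D x v) = norm (D x (t *\<^sub>R v))"
        using t(1) by (simp add: linear_scale[OF has_derivative_linear[OF der[OF x]]])
      also have "\<dots> \<le> norm (f (z0 + t *\<^sub>R v) x - f z0 x) +
          norm (f (z0 + t *\<^sub>R v) x - f z0 x - D x (t *\<^sub>R v))"
        using norm_triangle_sub[of "D x (t *\<^sub>R v)" "f (z0 + t *\<^sub>R v) x - f z0 x"]
        by (simp only: norm_minus_commute)
      also have "\<dots> \<le> B x * norm (t *\<^sub>R v) + \<epsilon> / norm v * norm (t *\<^sub>R v)"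
        using lip[OF _ x, of "z0 + t *\<^sub>R v"] d(2)[of "z0 + t *\<^sub>R v"] t by (intro add_mono) (auto simp: dist_norm)
      also have "\<dots> = t * (B x * norm v + \<epsilon>)" using t(1) False by (simp add: field_simps)
      finally show "norm (D x v) \<le> B x * norm v + \<epsilon>" using t(1) by (simp add: mult_le_cancel_left)
    qed
  qed
  have iD: "integrable M (\<lambda>x. D x v)" for v
  proof (rule Bochner_Integration.integrable_bound)
    show "integrable M (\<lambda>x. B x * norm v)" using B by simp
    show "AE x in M. norm (D x v) \<le> norm (B x * norm v)"
      by (rule AE_I2, rule order_trans[OF bound]) auto
  qed (rule meas)
  have lin: "linear (D x)" if "x \<in> space M" for x by (rule has_derivative_linear[OF der[OF that]])
  have bl: "bounded_linear (\<lambda>v. \<integral>x. D x v \<partial>M)"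
  proof (rule bounded_linear_intro[where K="\<integral>x. \<bar>B x\<bar> \<partial>M"])
    fix v w
    have "(\<integral>x. D x (v + w) \<partial>M) = (\<integral>x. D x v + D x w \<partial>M)"
      by (rule Bochner_Integration.integral_cong) (auto simp: linear_add lin)
    then show "(\<integral>x. D x (v + w) \<partial>M) = (\<integral>x. D x v \<partial>M) + (\<integral>x. D x w \<partial>M)"
      using iD by simp
  next
    fix r v
    have "(\<integral>x. D x (r *\<^sub>R v) \<partial>M) = (\<integral>x. r *\<^sub>R D x v \<partial>M)"
      by (rule Bochner_Integration.integral_cong) (auto simp: linear_scale lin)
    then show "(\<integral>x. D x (r *\<^sub>R v) \<partial>M) = r *\<^sub>R (\<integral>x. D x v \<partial>M)" by simp
  next
    fix v
    have "norm (\<integral>x. D x v \<partial>M) \<le> (\<integral>x. \<bar>B x\<bar> * norm v \<partial>M)"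
      using iD B by (intro Bochner_Integration.integral_norm_bound[THEN order_trans] integral_mono)
        (auto intro!: order_trans[OF bound] mult_right_mono)
    then show "norm (\<integral>x. D x v \<partial>M) \<le> norm v * (\<integral>x. \<bar>B x\<bar> \<partial>M)" by (simp add: mult.commute)
  qed
  show ?thesis
    unfolding has_derivative_at_within
  proof (intro conjI bl)
    show "((\<lambda>y. (integral\<^sup>L M (f y) - integral\<^sup>L M (f z0) - (\<integral>x. D x (y - z0) \<partial>M)) /\<^sub>R norm (y - z0)) \<longlongrightarrow> 0) (at z0)"
      unfolding tendsto_at_iff_sequentially comp_def
    proof (intro allI impI)
      fix X :: "nat \<Rightarrow> 'a" assume X: "\<forall>i. X i \<in> UNIV - {z0}" "X \<longlonglongrightarrow> z0"
      have "\<forall>\<^sub>F n in sequentially. X n \<in> ball z0 e"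
        using X(2) e by (intro topological_tendstoD) auto
      then obtain N where N: "\<And>n. n \<ge> N \<Longrightarrow> X n \<in> ball z0 e"
        by (auto simp: eventually_sequentially)
      define Y where "Y n = X (n + N)" for n
      have Y: "Y n \<in> ball z0 e" "Y n \<noteq> z0" for n using X(1) N by (auto simp: Y_def)
      have Yl: "Y \<longlonglongrightarrow> z0" unfolding Y_def by (rule LIMSEQ_ignore_initial_segment[OF X(2)])
      define S where "S n x = (f (Y n) x - f z0 x - D x (Y n - z0)) /\<^sub>R norm (Y n - z0)" for n x
      have z0: "z0 \<in> ball z0 e" using e by simp
      have iS: "integrable M (S n)" for n
        unfolding S_def by (intro Bochner_Integration.integrable_scaleR_right Bochner_Integration.integrable_diff
          int iD Y z0)
      have "(\<lambda>n. integral\<^sup>L M (S n)) \<longlonglongrightarrow> integral\<^sup>L M (\<lambda>_. 0)"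
      proof (rule integral_dominated_convergence)
        show "integrable M (\<lambda>x. 2 * B x)" using B by simp
        show "AE x in M. (\<lambda>n. S n x) \<longlonglongrightarrow> 0"
        proof (rule AE_I2)
          fix x assume "x \<in> space M"
          from der[OF this, unfolded has_derivative_at_within tendsto_at_iff_sequentially comp_def, THEN conjunct2,
              rule_format, of Y]
          show "(\<lambda>n. S n x) \<longlonglongrightarrow> 0" using Y(2) Yl by (simp add: S_def)
        qed
        show "AE x in M. norm (S n x) \<le> 2 * B x" for n
        proof (rule AE_I2)
          fix x assume x: "x \<in> space M"
          have "norm (f (Y n) x - f z0 x - D x (Y n - z0)) \<le> norm (f (Y n) x - f z0 x) + norm (D x (Y n - z0))"
            by (rule norm_triangle_ineq4)
          also have "\<dots> \<le> B x * norm (Y n - z0) + B x * norm (Y n - z0)"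
            by (intro add_mono lip bound x Y)
          finally show "norm (S n x) \<le> 2 * B x" using Y(2)[of n]
            by (simp only: S_def norm_scaleR) (simp add: field_simps)
        qed
      qed (use iS in auto)
      moreover have "integral\<^sup>L M (S n) = (integral\<^sup>L M (f (Y n)) - integral\<^sup>L M (f z0) - (\<integral>x. D x (Y n - z0) \<partial>M)) /\<^sub>R norm (Y n - z0)" for n
        unfolding S_def using int[OF Y(1)] int[OF z0] iD by simp
      ultimately have "(\<lambda>n. (integral\<^sup>L M (f (Y n)) - integral\<^sup>L M (f z0) - (\<integral>x. D x (Y n - z0) \<partial>M)) /\<^sub>R norm (Y n - z0)) \<longlonglongrightarrow> 0"
        by simp
      then show "(\<lambda>n. (integral\<^sup>L M (f (X n)) - integral\<^sup>L M (f z0) - (\<integral>x. D x (X n - z0) \<partial>M)) /\<^sub>R norm (X n - z0)) \<longlonglongrightarrow> 0"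
        unfolding Y_def by (rule LIMSEQ_offset)
    qed
  qed
qed

lemma zero_outside_has_derivative:
  assumes D: "(f has_derivative D) (at x)" and S: "closed S" and z: "\<And>x. x \<notin> S \<Longrightarrow> f x = 0" and x: "x \<notin> S"
  shows "D = (\<lambda>_. 0)"
proof -
  have "((\<lambda>_. 0) has_derivative (\<lambda>_. 0)) (at x)" by simp
  then have "(f has_derivative (\<lambda>_. 0)) (at x)"
    by (rule has_derivative_transform_within_open[of _ _ _ _ "- S"]) (use S x z in auto)
  then show ?thesis by (rule has_derivative_unique[OF D])
qed

lemma C1_support_lipschitz:
  fixes f :: "'a::euclidean_space \<Rightarrow> 'b::real_normed_vector"
  assumes D: "\<And>x. (f has_derivative f' x) (at x)" and C: "\<And>v. continuous_on UNIV (\<lambda>x. f' x v)"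
    and S: "compact S" and z: "\<And>x. x \<notin> S \<Longrightarrow> f x = 0"
  obtains L where "L \<ge> 0" "\<And>x v. norm (f' x v) \<le> L * norm v" "\<And>x y. norm (f x - f y) \<le> L * norm (x - y)"
proof -
  have "\<exists>M\<ge>0. \<forall>x. norm (f' x b) \<le> M" for b
  proof -
    have "bounded ((\<lambda>x. f' x b) ` S)"
      using compact_continuous_image[OF continuous_on_subset[OF C] S] compact_imp_bounded by blast
    then obtain M where M: "M > 0" "\<And>x. x \<in> S \<Longrightarrow> norm (f' x b) \<le> M" by (auto simp: bounded_pos)
    have "norm (f' x b) \<le> M" for x
      using M zero_outside_has_derivative[OF D[of x] compact_imp_closed[OF S] z] by (cases "x \<in> S") auto
    then show ?thesis using M(1) by (intro exI[of _ M]) auto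
  qed
  then obtain M where M: "\<And>b. M b \<ge> 0" "\<And>b x. norm (f' x b) \<le> M b" by metis
  define L where "L = (\<Sum>b\<in>Basis. M b)"
  have L0: "L \<ge> 0" unfolding L_def by (rule sum_nonneg) (rule M(1))
  have L: "norm (f' x v) \<le> L * norm v" for x v
  proof -
    have "f' x v = f' x (\<Sum>b\<in>Basis. (v \<bullet> b) *\<^sub>R b)" by (simp add: euclidean_representation)
    also have "\<dots> = (\<Sum>b\<in>Basis. (v \<bullet> b) *\<^sub>R f' x b)"
      using has_derivative_linear[OF D] by (simp add: linear_sum linear_scale)
    also have "norm \<dots> \<le> (\<Sum>b\<in>Basis. norm v * M b)"
      by (rule sum_norm_le) (auto intro!: mult_mono M Basis_le_norm)
    also have "\<dots> = L * norm v" by (simp add: L_def sum_distrib_left mult.commute)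
    finally show ?thesis .
  qed
  show ?thesis
  proof (rule that[OF L0 L])
    show "norm (f x - f y) \<le> L * norm (x - y)" for x y
      by (rule differentiable_bound[of UNIV f f'])
         (use D onorm_bound[OF L0 L] in auto)
  qed
qed

lemma lborel_integral_translation:
  fixes f :: "'a::euclidean_space \<Rightarrow> 'b::{banach, second_countable_topology}"
  assumes [measurable]: "f \<in> borel_measurable borel"
  shows "(\<integral>x. f (x + a) \<partial>lborel) = (\<integral>x. f x \<partial>lborel)"
proof -
  have "(\<integral>x. f x \<partial>lborel) = (\<integral>x. f x \<partial>distr lborel borel ((+) a))"
    by (simp only: lborel_distr_plus)
  also have "\<dots> = (\<integral>x. f (a + x) \<partial>lborel)" by (rule integral_distr) auto
  finally show ?thesis by (simp add: add.commute)
qed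

lemma continuous_compact_support_integrable:
  fixes f :: "'a::euclidean_space \<Rightarrow> 'b::euclidean_space"
  assumes C: "continuous_on UNIV f" and S: "compact S" and z: "\<And>x. x \<notin> S \<Longrightarrow> f x = 0"
  shows "integrable lborel f"
proof -
  have "integrable lborel (\<lambda>x. indicator S x *\<^sub>R f x)"
    by (rule borel_integrable_compact[OF S continuous_on_subset[OF C]]) simp
  also have "(\<lambda>x. indicator S x *\<^sub>R f x) = f" using z by (auto simp: indicator_def)
  finally show ?thesis .
qed

text \<open>
  The integral of \<open>f (x + y)\<close> over \<open>x\<close> does not depend on \<open>y\<close>, and its derivative at \<open>y = 0\<close> is the
  integral in question.
\<close>

lemma integral_derivative_compact_support:
  fixes f :: "'a::euclidean_space \<Rightarrow> 'b::euclidean_space"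
  assumes D: "\<And>x. (f has_derivative f' x) (at x)" and C: "\<And>v. continuous_on UNIV (\<lambda>x. f' x v)"
    and S: "compact S" and z: "\<And>x. x \<notin> S \<Longrightarrow> f x = 0"
  shows "(\<integral>x. f' x v \<partial>lborel) = 0"
proof -
  obtain L where L: "L \<ge> 0" "\<And>x y. norm (f x - f y) \<le> L * norm (x - y)"
    using C1_support_lipschitz[OF assms] by metis
  obtain R where R: "R > 0" "\<And>x. x \<in> S \<Longrightarrow> norm x \<le> R"
    using compact_imp_bounded[OF S] by (auto simp: bounded_pos)
  have cf: "continuous_on UNIV f"
    using D by (meson continuous_at_imp_continuous_on has_derivative_continuous)
  have [measurable]: "f \<in> borel_measurable borel" using cf by (rule borel_measurable_continuous_onI)
  define B where "B x = L * indicator (cball 0 (R + 1)) x" for x :: 'a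
  have "((\<lambda>y. \<integral>x. f (x + y) \<partial>lborel) has_derivative (\<lambda>v. \<integral>x. f' x v \<partial>lborel)) (at 0)"
  proof (rule has_derivative_integral_dominated[where e=1 and B=B])
    show "integrable lborel (\<lambda>x. f (x + y))" for y
      by (rule continuous_compact_support_integrable[OF _ compact_translation[OF S, of "- y"]])
         (use z in \<open>force intro!: continuous_on_compose2[OF cf] continuous_intros simp: image_iff\<close>)+
    show "((\<lambda>y. f (x + y)) has_derivative f' x) (at 0)" for x
    proof -
      have "(f has_derivative f' x) (at (x + 0))" using D by simp
      moreover have "((\<lambda>y. x + y) has_derivative (\<lambda>v. v)) (at 0)" by (auto intro!: derivative_eq_intros)
      ultimately show ?thesis using has_derivative_compose[of "\<lambda>y. x + y" "\<lambda>v. v" 0 UNIV f "f' x"] by simp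
    qed
    show "(\<lambda>x. f' x v) \<in> borel_measurable lborel" for v
      using borel_measurable_continuous_onI[OF C] by simp
    show "integrable lborel B"
      unfolding B_def using emeasure_bounded_finite[OF bounded_cball, of "0::'a" "R + 1"]
      by (intro integrable_mult_right integrable_real_indicator) (auto simp: less_top)
    show "norm (f (x + y) - f (x + 0)) \<le> B x * norm (y - 0)" if "y \<in> ball 0 1" for x y
    proof (cases "norm x \<le> R + 1")
      case True
      then show ?thesis using L(2)[of "x + y" x] by (simp add: B_def)
    next
      case False
      have "norm x \<le> norm (x + y) + norm y" using norm_triangle_ineq4[of "x + y" y] by simp
      then have "x \<notin> S" "x + y \<notin> S" using False R(2) that by fastforce+
      then show ?thesis using z L(1) by (simp add: B_def)
    qed
  qed simp
  moreover have "(\<integral>x. f (x + y) \<partial>lborel) = (\<integral>x. f x \<partial>lborel)" for y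
    by (rule lborel_integral_translation) simp
  ultimately have "((\<lambda>y. \<integral>x. f x \<partial>lborel) has_derivative (\<lambda>v. \<integral>x. f' x v \<partial>lborel)) (at (0::'a))"
    by simp
  from has_derivative_unique[OF this has_derivative_const] show ?thesis by meson
qed

section \<open>Holomorphic and weakly holomorphic functions\<close>

text \<open>
  The \<open>dz\<^bold>-\<^sub>j\<close>-coefficient of a real-linear form \<open>D\<close>. For the derivative of a function it is the
  Wirtinger derivative; it vanishes for all \<open>j\<close> if and only if \<open>D\<close> is complex-linear.
\<close>

definition dbar_part :: "'n \<Rightarrow> (complex^'n \<Rightarrow> complex) \<Rightarrow> complex" where
  "dbar_part j D = (D (axis j 1) + \<i> * D (axis j \<i>)) / 2"

text \<open>
  Holomorphy is taken to include continuity of the first derivatives, since these functions are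
  multiplied by cutoffs and then integrated by parts.
\<close>

definition holo_deriv ::
    "(complex^'n) set \<Rightarrow> (complex^'n \<Rightarrow> complex) \<Rightarrow> (complex^'n \<Rightarrow> complex^'n \<Rightarrow> complex) \<Rightarrow> bool" where
  "holo_deriv V H H' \<longleftrightarrow> (\<forall>z\<in>V. (H has_derivative H' z) (at z)) \<and>
     (\<forall>v. continuous_on V (\<lambda>z. H' z v)) \<and> (\<forall>z\<in>V. \<forall>j. dbar_part j (H' z) = 0)"

definition holo :: "(complex^'n) set \<Rightarrow> (complex^'n \<Rightarrow> complex) \<Rightarrow> bool" where
  "holo V H \<longleftrightarrow> (\<exists>H'. holo_deriv V H H')"

definition weakly_holo :: "(complex^'n) set \<Rightarrow> (complex^'n \<Rightarrow> complex) \<Rightarrow> bool" where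
  "weakly_holo V h \<longleftrightarrow> (\<forall>j. \<forall>\<phi>\<in>test_functions V. (\<integral>z. h z * wirtinger_bar j \<phi> z \<partial>lebesgue_on V) = 0)"

lemma weakly_holo_iff_dbar_eq: "weakly_holo V h \<longleftrightarrow> dbar_eq V h (\<lambda>_. 0)"
  by (simp add: weakly_holo_def dbar_eq_def distr_wirtinger_bar_def)

lemma wirtinger_bar_eq: "wirtinger_bar j \<phi> z = dbar_part j (fderiv \<phi> z)"
  by (simp add: wirtinger_bar_def dbar_part_def)

lemma holo_derivD:
  assumes "holo_deriv V H H'"
  shows "z \<in> V \<Longrightarrow> (H has_derivative H' z) (at z)" "continuous_on V (\<lambda>z. H' z v)"
    "z \<in> V \<Longrightarrow> dbar_part j (H' z) = 0"
  using assms by (simp_all add: holo_deriv_def)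

lemma holo_continuous_on: "holo V H \<Longrightarrow> continuous_on V H"
  unfolding holo_def
  by (elim exE, rule continuous_at_imp_continuous_on) (blast dest: holo_derivD(1) has_derivative_continuous)

lemma axis_expansion: "v = (\<Sum>j\<in>UNIV. Re (v $ j) *\<^sub>R axis j 1 + Im (v $ j) *\<^sub>R axis j \<i>)" for v :: "complex^'n"
proof -
  have "(Re (v $ j) *\<^sub>R axis j 1 + Im (v $ j) *\<^sub>R axis j \<i>) $ i = (if i = j then v $ i else 0)" for i j
    by (auto simp: axis_def complex_eq_iff)
  then show ?thesis by (simp add: vec_eq_iff sum_component del: vector_add_component)
qed

lemma dbar_part_0_expansion:
  assumes D: "linear D" and wb: "\<And>j. dbar_part j D = 0"
  shows "D v = (\<Sum>j\<in>UNIV. v $ j * D (axis j 1))"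
proof -
  have "D (axis j \<i>) = \<i> * D (axis j 1)" for j
  proof -
    have "\<i> * (D (axis j 1) + \<i> * D (axis j \<i>)) = 0" using wb[of j] by (simp add: dbar_part_def)
    then show ?thesis by (simp add: algebra_simps)
  qed
  then have "D (Re (v $ j) *\<^sub>R axis j 1 + Im (v $ j) *\<^sub>R axis j \<i>) = v $ j * D (axis j 1)" for j
    by (simp only: linear_add[OF D] linear_scale[OF D]) (simp add: complex_eq_iff algebra_simps)
  then show ?thesis by (subst axis_expansion) (simp only: linear_sum[OF D])
qed

lemma dbar_part_0_scale:
  assumes "linear D" and "\<And>j. dbar_part j D = 0"
  shows "D (c *s v) = c * D v"
  by (subst (1 2) dbar_part_0_expansion[OF assms]) (simp add: sum_distrib_left mult.assoc)

text \<open>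
  On the open set \<open>- S\<close> the extension is zero, on \<open>V\<close> it is \<open>F\<close>, and these two sets cover the space.
\<close>

lemma C1_extend_zero:
  fixes F :: "'a::real_normed_vector \<Rightarrow> 'b::real_normed_vector"
  assumes V: "open V" and S: "closed S" "S \<subseteq> V"
    and D: "\<And>z. z \<in> V \<Longrightarrow> (F has_derivative F' z) (at z)"
    and C: "\<And>v. continuous_on V (\<lambda>z. F' z v)"
    and z: "\<And>z. z \<in> V \<Longrightarrow> z \<notin> S \<Longrightarrow> F z = 0"
  shows "((\<lambda>z. if z \<in> V then F z else 0) has_derivative (if z \<in> V then F' z else (\<lambda>_. 0))) (at z)"
    and "continuous_on UNIV (\<lambda>z. (if z \<in> V then F' z else (\<lambda>_. 0)) v)"
proof -
  have g0: "((\<lambda>z. if z \<in> V then F z else 0) has_derivative (\<lambda>_. 0)) (at z)" if "z \<notin> S" for z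
  proof -
    have "((\<lambda>_. 0) has_derivative (\<lambda>_. 0)) (at z)" by simp
    then show ?thesis
      by (rule has_derivative_transform_within_open[of _ _ _ _ "- S"]) (use S that z in auto)
  qed
  have gV: "((\<lambda>z. if z \<in> V then F z else 0) has_derivative F' z) (at z)" if "z \<in> V" for z
    by (rule has_derivative_transform_within_open[OF D[OF that] V that]) simp
  show "((\<lambda>z. if z \<in> V then F z else 0) has_derivative (if z \<in> V then F' z else (\<lambda>_. 0))) (at z)"
    using g0[of z] gV[of z] S(2) by auto
  have F0: "F' z = (\<lambda>_. 0)" if "z \<in> V" "z \<notin> S" for z
    by (rule has_derivative_unique[OF gV[OF that(1)] g0[OF that(2)]])
  have "continuous_on (V \<union> - S) (\<lambda>z. (if z \<in> V then F' z else (\<lambda>_. 0)) v)"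
  proof (rule continuous_on_open_Un[OF V])
    show "open (- S)" using S by auto
    show "continuous_on V (\<lambda>z. (if z \<in> V then F' z else (\<lambda>_. 0)) v)"
      using C by (rule continuous_on_eq) auto
    show "continuous_on (- S) (\<lambda>z. (if z \<in> V then F' z else (\<lambda>_. 0)) v)"
      by (rule continuous_on_eq[OF continuous_on_const[of _ 0]]) (auto simp: F0)
  qed
  moreover have "V \<union> - S = UNIV" using S(2) by auto
  ultimately show "continuous_on UNIV (\<lambda>z. (if z \<in> V then F' z else (\<lambda>_. 0)) v)" by simp
qed

lemma test_functions_has_derivative:
  assumes "\<phi> \<in> test_functions U"
  shows "(\<phi> has_derivative fderiv \<phi> x) (at x)"
    "continuous_on UNIV (\<lambda>x. fderiv \<phi> x v)"
proof -
  have "C_k (Suc 0) \<phi>" using assms unfolding test_functions_def mem_Collect_eq by (elim conjE allE)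
  then show "(\<phi> has_derivative fderiv \<phi> x) (at x)" by (rule C_k_has_derivative)
  show "continuous_on UNIV (\<lambda>x. fderiv \<phi> x v)"
    using \<open>C_k (Suc 0) \<phi>\<close> by (simp only: C_k.simps)
qed

lemma test_functions_smooth: "\<phi> \<in> test_functions U \<Longrightarrow> C_k k \<phi>"
  unfolding test_functions_def mem_Collect_eq by (elim conjE allE)

lemma test_functions_support: "\<phi> \<in> test_functions U \<Longrightarrow> closure {x. \<phi> x \<noteq> 0} \<subseteq> U"
  unfolding test_functions_def mem_Collect_eq by (elim conjE)

text \<open>
  A support condition in the form in which products and translates provide it.
\<close>

lemma test_functionsI:
  assumes "\<And>k. C_k k \<phi>" "compact S" "S \<subseteq> U" "\<And>x. x \<notin> S \<Longrightarrow> \<phi> x = 0"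
  shows "\<phi> \<in> test_functions U"
proof -
  have sub: "{x. \<phi> x \<noteq> 0} \<subseteq> S" using assms(4) by blast
  then have "closure {x. \<phi> x \<noteq> 0} \<subseteq> S" by (rule closure_minimal[OF _ compact_imp_closed[OF assms(2)]])
  moreover have "bounded {x. \<phi> x \<noteq> 0}" by (rule bounded_subset[OF compact_imp_bounded[OF assms(2)] sub])
  ultimately show ?thesis
    unfolding test_functions_def mem_Collect_eq compact_closure
    by (intro conjI allI assms(1) order_trans[OF _ assms(3)])
qed

lemma integral_lebesgue_on_zero_outside:
  fixes f :: "'a::euclidean_space \<Rightarrow> 'b::euclidean_space"
  assumes V: "open V" and W: "open W" "W \<subseteq> V" and z: "\<And>x. x \<in> V \<Longrightarrow> x \<notin> W \<Longrightarrow> f x = 0"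
  shows "(\<integral>x. f x \<partial>lebesgue_on V) = (\<integral>x. f x \<partial>lebesgue_on W)"
proof -
  have "(\<integral>x. f x \<partial>lebesgue_on V) = (\<integral>x. indicator V x *\<^sub>R f x \<partial>lebesgue)"
    using V by (intro integral_restrict_space) (auto simp: borel_open)
  also have "\<dots> = (\<integral>x. indicator W x *\<^sub>R f x \<partial>lebesgue)"
    using W z by (intro Bochner_Integration.integral_cong) (auto simp: indicator_def)
  also have "\<dots> = (\<integral>x. f x \<partial>lebesgue_on W)"
    using W by (intro integral_restrict_space[symmetric]) (auto simp: borel_open)
  finally show ?thesis .
qed

text \<open>
  For a test function \<open>\<phi>\<close> the product rule gives \<open>\<partial>\<^bold>-\<^sub>j (H \<phi>) = H \<partial>\<^bold>-\<^sub>j \<phi>\<close>, and the integral of a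
  derivative of a compactly supported function vanishes.
\<close>

lemma holo_weakly_holo:
  fixes H :: "complex^'n \<Rightarrow> complex"
  assumes V: "open V" and H: "holo V H"
  shows "weakly_holo V H"
  unfolding weakly_holo_def
proof (intro allI ballI)
  fix j \<phi> assume \<phi>: "\<phi> \<in> test_functions V"
  obtain H' where "holo_deriv V H H'" using H unfolding holo_def by blast
  note H' = holo_derivD[OF this]
  define S where "S = closure {x. \<phi> x \<noteq> 0}"
  have S: "compact S" "S \<subseteq> V" "\<And>x. x \<notin> S \<Longrightarrow> \<phi> x = 0"
    unfolding S_def by (rule test_functionsD[OF \<phi>] test_functions_support[OF \<phi>])+
  define \<phi>' where "\<phi>' z = fderiv \<phi> z" for z
  have \<phi>': "\<And>z. (\<phi> has_derivative \<phi>' z) (at z)" "\<And>v. continuous_on UNIV (\<lambda>z. \<phi>' z v)"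
    using test_functions_has_derivative[OF \<phi>] by (simp_all add: \<phi>'_def)
  define F' where "F' z v = H z * \<phi>' z v + H' z v * \<phi> z" for z v
  have cH: "continuous_on V H" by (rule holo_continuous_on[OF H])
  have F: "((\<lambda>z. H z * \<phi> z) has_derivative F' z) (at z)" if "z \<in> V" for z
    unfolding F'_def by (rule has_derivative_mult[OF H'(1)[OF that] \<phi>'(1)])
  have cF: "continuous_on V (\<lambda>z. F' z v)" for v
    unfolding F'_def
    by (intro continuous_intros cH H' continuous_on_subset[OF \<phi>'(2)] continuous_on_subset[OF test_functionsD(1)[OF \<phi>]]) auto
  define G' where "G' z = (if z \<in> V then F' z else (\<lambda>_. 0))" for z
  note ext = C1_extend_zero[OF V compact_imp_closed[OF S(1)] S(2) F cF, folded G'_def]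
  have z: "z \<in> V \<Longrightarrow> z \<notin> S \<Longrightarrow> H z * \<phi> z = 0" for z using S(3) by simp
  have S0: "z \<notin> S \<Longrightarrow> (if z \<in> V then H z * \<phi> z else 0) = 0" for z using z by auto
  have int0: "(\<integral>z. G' z v \<partial>lborel) = 0" for v
    by (rule integral_derivative_compact_support[OF ext S(1) S0]) (use z in auto)
  have Gz: "G' z v = 0" if "z \<notin> S" for z v
    using fun_cong[OF zero_outside_has_derivative[OF ext(1) compact_imp_closed[OF S(1)] S0 that]] z by blast
  have iG: "integrable lborel (\<lambda>z. G' z v)" for v
    by (rule continuous_compact_support_integrable[OF ext(2) S(1) Gz]) (use z in auto)
  have "(\<integral>z. H z * wirtinger_bar j \<phi> z \<partial>lebesgue_on V) =
      (\<integral>z. indicator V z *\<^sub>R (H z * wirtinger_bar j \<phi> z) \<partial>lebesgue)"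
    using V by (intro integral_restrict_space) (auto simp: borel_open)
  also have "\<dots> = (\<integral>z. dbar_part j (G' z) \<partial>lebesgue)"
  proof (rule Bochner_Integration.integral_cong[OF refl])
    fix z
    show "indicator V z *\<^sub>R (H z * wirtinger_bar j \<phi> z) = dbar_part j (G' z)"
    proof (cases "z \<in> V")
      case True
      have "dbar_part j (F' z) = H z * dbar_part j (\<phi>' z) + dbar_part j (H' z) * \<phi> z"
        by (simp add: dbar_part_def F'_def field_simps)
      then show ?thesis using True H'(3)[OF True] by (simp add: G'_def wirtinger_bar_eq \<phi>'_def)
    qed (simp add: G'_def dbar_part_def)
  qed
  also have "\<dots> = (\<integral>z. dbar_part j (G' z) \<partial>lborel)"
    using iG unfolding dbar_part_def by (intro integral_completion) auto
  also have "\<dots> = 0"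
    unfolding dbar_part_def using iG int0 by simp
  finally show "(\<integral>z. H z * wirtinger_bar j \<phi> z \<partial>lebesgue_on V) = 0" .
qed

section \<open>Mollification of weakly holomorphic functions\<close>

definition bump :: "complex^'n \<Rightarrow> complex" where
  "bump z = complex_of_real (ball_cutoff 0 (1/2) z)"

lemma norm_bump_le_1: "norm (bump z) \<le> 1"
  using ball_cutoff(3,4)[of "1/2" 0 z] by (simp add: bump_def)

lemma bump_test_function: "bump \<in> test_functions (cball 0 1)"
proof (rule test_functionsI[where S="cball 0 1"])
  show "C_k k bump" for k
    unfolding bump_def[abs_def] by (rule C_k_linear_compose[OF bounded_linear_of_real C_k_ball_cutoff])
  show "bump x = 0" if "x \<notin> cball 0 1" for x :: "complex^'a"
    using that ball_cutoff(2)[of "1/2" x 0] by (simp add: bump_def)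
qed auto

text \<open>
  The gradient of a function of \<open>y \<bullet> y\<close> is a multiple of \<open>y\<close>.
\<close>

lemma bump_derivative_radial:
  obtains g where "\<And>y v :: complex^'n. fderiv bump y v = complex_of_real (g y * (y \<bullet> v))"
proof -
  have S: "(smooth_step has_derivative fderiv smooth_step t) (at t)" for t
    by (rule C_k_has_derivative[OF C_k_smooth_step])
  have Sl: "fderiv smooth_step t c = c * fderiv smooth_step t 1" for t c
    using linear_scale[OF has_derivative_linear[OF S], of t c 1] by (simp only: real_scaleR_def mult_1_right)
  have eq: "bump = (\<lambda>z::complex^'n. complex_of_real (smooth_step (2 - 4 * (z \<bullet> z))))"
    by (simp add: bump_def[abs_def] ball_cutoff_def power_mult_distrib power2_norm_eq_inner mult.commute)
  have "((\<lambda>z. 2 - 4 * (z \<bullet> z)) has_derivative (\<lambda>v. - 8 * (y \<bullet> v))) (at y)" for y :: "complex^'n"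
    by (auto intro!: derivative_eq_intros simp: inner_commute)
  from has_derivative_of_real[OF has_derivative_compose[OF this S]]
  have "(bump has_derivative (\<lambda>v. complex_of_real (fderiv smooth_step (2 - 4 * (y \<bullet> y)) (- 8 * (y \<bullet> v))))) (at y)"
    for y :: "complex^'n"
    unfolding eq .
  note bump_D = this
  have "fderiv bump y v =
      complex_of_real (fderiv smooth_step (2 - 4 * (y \<bullet> y)) (- 8 * (y \<bullet> v)))" for y v :: "complex^'n"
    by (rule fun_cong[OF frechet_derivative_at[OF bump_D, symmetric]])
  also have "fderiv smooth_step (2 - 4 * (y \<bullet> y)) (- 8 * (y \<bullet> v)) =
      (- 8 * fderiv smooth_step (2 - 4 * (y \<bullet> y)) 1) * (y \<bullet> v)" for y v :: "complex^'n"
    by (subst Sl) simp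
  finally show ?thesis by (rule that)
qed

text \<open>
  The left-hand side is minus the derivative with respect to the radius \<open>s\<close> of
  \<open>s\<^sup>-\<^sup>2\<^sup>n bump (y/s)\<close> at \<open>s = 1\<close>. For a radial bump it is a sum of Wirtinger derivatives of test
  functions. This is what makes the mollifications of a weakly holomorphic function independent of
  the radius.
\<close>

lemma bump_euler:
  fixes y :: "complex^'n"
  shows "of_nat (2 * CARD('n)) * bump y + fderiv bump y y =
    2 * (\<Sum>j\<in>UNIV. wirtinger_bar j (\<lambda>y. cnj (y $ j) * bump y) y)"
proof -
  obtain g where g: "\<And>y v :: complex^'n. fderiv bump y v = complex_of_real (g y * (y \<bullet> v))"
    by (rule bump_derivative_radial) blast
  have "wirtinger_bar j (\<lambda>y. cnj (y $ j) * bump y) y = bump y + of_real (g y) * (cnj (y $ j) * (y $ j)) / 2" for j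
  proof -
    have "((\<lambda>y. cnj (y $ j) * bump y) has_derivative
        (\<lambda>v. cnj (y $ j) * fderiv bump y v + cnj (v $ j) * bump y)) (at y)"
      by (rule has_derivative_mult[OF _ test_functions_has_derivative(1)[OF bump_test_function]])
        (rule bounded_linear_imp_has_derivative[OF bounded_linear_compose[OF bounded_linear_cnj bounded_linear_vec_nth]])
    then have D: "fderiv (\<lambda>y. cnj (y $ j) * bump y) y =
        (\<lambda>v. cnj (y $ j) * fderiv bump y v + cnj (v $ j) * bump y)"
      by (rule frechet_derivative_at[symmetric])
    have "complex_of_real (y \<bullet> axis j 1) + \<i> * complex_of_real (y \<bullet> axis j \<i>) = y $ j"
      by (simp add: inner_axis inner_complex_def complex_eq_iff)
    moreover have "c * (d * a) + \<i> * (c * (d * b)) = d * (c * Y)" if "a + \<i> * b = Y" for a b c d Y :: complex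
      unfolding that[symmetric] by (simp add: algebra_simps)
    ultimately have "cnj (y $ j) * of_real (g y * (y \<bullet> axis j 1)) + \<i> * (cnj (y $ j) * of_real (g y * (y \<bullet> axis j \<i>)))
        = complex_of_real (g y) * (cnj (y $ j) * (y $ j))"
      unfolding of_real_mult by blast
    with D show ?thesis
      by (simp add: wirtinger_bar_def g axis_def field_simps)
  qed
  then have "2 * (\<Sum>j\<in>UNIV. wirtinger_bar j (\<lambda>y. cnj (y $ j) * bump y) y) =
      of_nat (2 * CARD('n)) * bump y + of_real (g y) * (\<Sum>j\<in>UNIV. cnj (y $ j) * (y $ j))"
    by (simp add: sum.distrib sum_distrib_left sum_divide_distrib distrib_left)
  also have "(\<Sum>j\<in>UNIV. cnj (y $ j) * (y $ j)) = complex_of_real (y \<bullet> y)"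
    by (simp add: inner_vec_def inner_complex_def complex_eq_iff)
  finally show ?thesis by (simp add: g)
qed

lemma test_functions_derivative:
  assumes "\<phi> \<in> test_functions U"
  shows "(\<lambda>x. fderiv \<phi> x v) \<in> test_functions U"
proof (rule test_functionsI)
  have "C_k (Suc k) \<phi>" for k by (rule test_functions_smooth[OF assms])
  then show "C_k k (\<lambda>x. fderiv \<phi> x v)" for k unfolding C_k.simps by blast
  show "fderiv \<phi> x v = 0" if "x \<notin> closure {x. \<phi> x \<noteq> 0}" for x
    using zero_outside_has_derivative[OF test_functions_has_derivative(1)[OF assms] closed_closure
        test_functionsD(3)[OF assms] that] by metis
qed (rule test_functionsD(2)[OF assms] test_functions_support[OF assms])+

lemma test_functions_zero: "\<phi> \<in> test_functions U \<Longrightarrow> x \<notin> U \<Longrightarrow> \<phi> x = 0"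
  using test_functions_support[of \<phi> U] test_functionsD(3)[of \<phi> U x] by blast

lemma test_functions_lipschitz:
  assumes "\<phi> \<in> test_functions U"
  obtains L where "L \<ge> 0" "\<And>x v. norm (fderiv \<phi> x v) \<le> L * norm v"
    "\<And>x y. norm (\<phi> x - \<phi> y) \<le> L * norm (x - y)"
  by (rule C1_support_lipschitz[OF test_functions_has_derivative[OF assms] test_functionsD(2,3)[OF assms]],
      assumption) (rule that)

lemma continuous_compact_support_bounded:
  fixes f :: "'a::euclidean_space \<Rightarrow> 'b::real_normed_vector"
  assumes c: "continuous_on UNIV f" and S: "compact S" and z: "\<And>x. x \<notin> S \<Longrightarrow> f x = 0"
  obtains M where "M \<ge> 0" "\<And>x. norm (f x) \<le> M"
proof -
  have "bounded (f ` S)"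
    using compact_continuous_image[OF continuous_on_subset[OF c] S] compact_imp_bounded by blast
  then obtain M where M: "M > 0" "\<And>x. x \<in> S \<Longrightarrow> norm (f x) \<le> M" by (auto simp: bounded_pos)
  have "norm (f x) \<le> M" for x using M z[of x] by (cases "x \<in> S") auto
  with M(1) show ?thesis by (intro that[of M]) auto
qed

lemma test_functions_bounded:
  assumes "\<phi> \<in> test_functions U"
  obtains M where "M \<ge> 0" "\<And>x. norm (\<phi> x) \<le> M"
  by (rule continuous_compact_support_bounded[OF test_functionsD(1,2)[OF assms]])
     (erule test_functionsD(3)[OF assms], rule that)

lemma continuous_measurable_lebesgue_on:
  fixes f :: "'a::euclidean_space \<Rightarrow> 'b::euclidean_space"
  assumes "continuous_on UNIV f"
  shows "f \<in> borel_measurable (lebesgue_on V)"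
proof -
  have "f \<in> borel_measurable lborel" using borel_measurable_continuous_onI[OF assms] by simp
  then show ?thesis by (intro measurable_restrict_space1 measurable_completion)
qed

lemma integrable_mult_bounded:
  fixes f g :: "'a \<Rightarrow> complex"
  assumes f: "integrable M f" and g: "g \<in> borel_measurable M" "\<And>x. norm (g x) \<le> B"
  shows "integrable M (\<lambda>x. f x * g x)"
proof (rule Bochner_Integration.integrable_bound)
  show "integrable M (\<lambda>x. B * norm (f x))" using f by simp
  show "(\<lambda>x. f x * g x) \<in> borel_measurable M" using f g(1) by simp
  have "norm (f x * g x) \<le> norm (B * norm (f x))" for x
    using g(2)[of x] order_trans[OF norm_ge_zero g(2)[of x]]
    by (simp add: norm_mult abs_mult mult.commute[of B] mult_left_mono)
  then show "AE x in M. norm (f x * g x) \<le> norm (B * norm (f x))" by simp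
qed

text \<open>
  The convolution of \<open>h\<close>, continued by zero, with the dilation of \<open>\<psi>\<close> by \<open>s\<close>. The normalizing factor
  \<open>s\<^sup>-\<^sup>2\<^sup>n\<close> is left out, so that derivatives in \<open>z\<close> are again of this form.
\<close>

definition conv ::
    "(complex^'n) set \<Rightarrow> (complex^'n \<Rightarrow> complex) \<Rightarrow> (complex^'n \<Rightarrow> complex) \<Rightarrow> real \<Rightarrow> complex^'n \<Rightarrow> complex" where
  "conv V h \<psi> s z = (\<integral>w. h w * \<psi> ((1/s) *\<^sub>R (z - w)) \<partial>lebesgue_on V)"

lemma conv_integrable:
  fixes h \<psi> :: "complex^'n \<Rightarrow> complex"
  assumes h: "integrable (lebesgue_on V) h" and C: "continuous_on UNIV \<psi>" and M: "\<And>x. norm (\<psi> x) \<le> M"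
  shows "integrable (lebesgue_on V) (\<lambda>w. h w * \<psi> ((1/s) *\<^sub>R (z - w)))"
proof (rule integrable_mult_bounded[OF h _ M])
  show "(\<lambda>w. \<psi> ((1/s) *\<^sub>R (z - w))) \<in> borel_measurable (lebesgue_on V)"
    by (rule continuous_measurable_lebesgue_on) (intro continuous_on_compose2[OF C] continuous_intros subset_UNIV)
qed

lemma conv_integrable_test:
  fixes h \<psi> :: "complex^'n \<Rightarrow> complex"
  assumes h: "integrable (lebesgue_on V) h" and \<psi>: "\<psi> \<in> test_functions U"
  shows "integrable (lebesgue_on V) (\<lambda>w. h w * \<psi> ((1/s) *\<^sub>R (z - w)))"
proof -
  obtain M where "\<And>x. norm (\<psi> x) \<le> M" by (rule test_functions_bounded[OF \<psi>]) blast
  then show ?thesis by (rule conv_integrable[OF h test_functionsD(1)[OF \<psi>]])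
qed

lemma conv_has_derivative:
  assumes h: "integrable (lebesgue_on V) h" and \<psi>: "\<psi> \<in> test_functions (cball 0 1)" and s: "s > 0"
  shows "(conv V h \<psi> s has_derivative (\<lambda>v. conv V h (\<lambda>y. fderiv \<psi> y ((1/s) *\<^sub>R v)) s z)) (at z)"
proof -
  define \<psi>' where "\<psi>' y = fderiv \<psi> y" for y
  have D: "(\<psi> has_derivative \<psi>' y) (at y)" for y
    unfolding \<psi>'_def by (rule test_functions_has_derivative[OF \<psi>])
  obtain L where L: "L \<ge> 0" "\<And>x y. norm (\<psi> x - \<psi> y) \<le> L * norm (x - y)"
    by (rule test_functions_lipschitz[OF \<psi>]) blast
  have "((\<lambda>z. \<integral>w. h w * \<psi> ((1/s) *\<^sub>R (z - w)) \<partial>lebesgue_on V) has_derivative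
      (\<lambda>v. \<integral>w. h w * \<psi>' ((1/s) *\<^sub>R (z - w)) ((1/s) *\<^sub>R v) \<partial>lebesgue_on V)) (at z)"
  proof (rule has_derivative_integral_dominated[where e=1 and B="\<lambda>w. norm (h w) * (L * (1/s))"])
    show "integrable (lebesgue_on V) (\<lambda>w. h w * \<psi> ((1/s) *\<^sub>R (z - w)))" for z
      by (rule conv_integrable_test[OF h \<psi>])
    show "((\<lambda>z. h w * \<psi> ((1/s) *\<^sub>R (z - w))) has_derivative
        (\<lambda>v. h w * \<psi>' ((1/s) *\<^sub>R (z - w)) ((1/s) *\<^sub>R v))) (at z)" for w
      by (intro has_derivative_mult_right has_derivative_compose[OF _ D]) (auto intro!: derivative_eq_intros)
    show "(\<lambda>w. h w * \<psi>' ((1/s) *\<^sub>R (z - w)) ((1/s) *\<^sub>R v)) \<in> borel_measurable (lebesgue_on V)" for v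
      unfolding \<psi>'_def
      by (rule borel_measurable_integrable[OF conv_integrable_test[OF h test_functions_derivative[OF \<psi>]]])
    show "norm (h w * \<psi> ((1/s) *\<^sub>R (y - w)) - h w * \<psi> ((1/s) *\<^sub>R (z - w))) \<le> norm (h w) * (L * (1/s)) * norm (y - z)" for y w
    proof -
      have "norm (\<psi> ((1/s) *\<^sub>R (y - w)) - \<psi> ((1/s) *\<^sub>R (z - w))) \<le> L * norm ((1/s) *\<^sub>R (y - w) - (1/s) *\<^sub>R (z - w))"
        by (rule L(2))
      also have "\<dots> = L * (1/s) * norm (y - z)" using s by (simp add: flip: scaleR_diff_right)
      finally show ?thesis
        unfolding right_diff_distrib[symmetric] norm_mult mult.assoc by (intro mult_left_mono) (auto simp: mult.assoc)
    qed
    show "integrable (lebesgue_on V) (\<lambda>w. norm (h w) * (L * (1/s)))" using h by simp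
  qed simp
  then show ?thesis unfolding conv_def[abs_def] \<psi>'_def .
qed

text \<open>
  Up to a factor the integral is the pairing of \<open>\<partial>\<^bold>-\<^sub>j h\<close> with the test function
  \<open>w \<mapsto> \<psi> ((z - w)/s)\<close>, whose support lies in \<open>V\<close>.
\<close>

lemma conv_dbar_eq_0:
  assumes h: "weakly_holo V h" and \<psi>: "\<psi> \<in> test_functions (cball 0 1)" and s: "s > 0" and z: "cball z s \<subseteq> V"
  shows "conv V h (wirtinger_bar j \<psi>) s z = 0"
proof -
  define \<phi> where "\<phi> w = \<psi> ((1/s) *\<^sub>R (z - w))" for w
  have "\<phi> \<in> test_functions V"
  proof (rule test_functionsI[OF _ compact_cball z])
    have "C_k k (\<lambda>w. \<psi> ((1/s) *\<^sub>R z + (- (1/s)) *\<^sub>R w))" for k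
      by (rule C_k_affine[OF test_functions_smooth[OF \<psi>]])
    then show "C_k k \<phi>" for k by (simp add: \<phi>_def[abs_def] scaleR_diff_right)
    show "\<phi> w = 0" if "w \<notin> cball z s" for w
    proof -
      have "1 < norm ((1/s) *\<^sub>R (z - w))" using that s unfolding norm_scaleR by (simp add: dist_norm field_simps)
      then have "(1/s) *\<^sub>R (z - w) \<notin> cball 0 1" by simp
      then show ?thesis unfolding \<phi>_def by (rule test_functions_zero[OF \<psi>])
    qed
  qed
  then have "(\<integral>w. h w * wirtinger_bar j \<phi> w \<partial>lebesgue_on V) = 0"
    using h unfolding weakly_holo_def by blast
  moreover have "wirtinger_bar j \<phi> w = - of_real (1/s) * wirtinger_bar j \<psi> ((1/s) *\<^sub>R (z - w))" for w
  proof -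
    have "(\<phi> has_derivative (\<lambda>v. fderiv \<psi> ((1/s) *\<^sub>R (z - w)) ((1/s) *\<^sub>R (- v)))) (at w)"
      unfolding \<phi>_def
      by (rule has_derivative_compose[OF _ test_functions_has_derivative(1)[OF \<psi>]]) (auto intro!: derivative_eq_intros)
    then have "fderiv \<phi> w = (\<lambda>v. fderiv \<psi> ((1/s) *\<^sub>R (z - w)) ((1/s) *\<^sub>R (- v)))"
      by (rule frechet_derivative_at[symmetric])
    moreover have "fderiv \<psi> y ((1/s) *\<^sub>R (- v)) = - of_real (1/s) * fderiv \<psi> y v" for y v
    proof -
      have l: "linear (fderiv \<psi> y)"
        by (rule has_derivative_linear[OF test_functions_has_derivative(1)[OF \<psi>]])
      show ?thesis
        unfolding linear_scale[OF l] linear_neg[OF l] by (simp only: scaleR_conv_of_real mult_minus_left mult_minus_right)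
    qed
    ultimately have d: "fderiv \<phi> w =
        (\<lambda>v. - of_real (1/s) * fderiv \<psi> ((1/s) *\<^sub>R (z - w)) v)"
      by (simp only:)
    have alg: "(- k * a + \<i> * (- k * b)) / 2 = - k * ((a + \<i> * b) / 2)" for k a b :: complex
      by (simp add: field_simps)
    show ?thesis unfolding wirtinger_bar_def d by (rule alg)
  qed
  ultimately have "(\<integral>w. - of_real (1/s) * (h w * wirtinger_bar j \<psi> ((1/s) *\<^sub>R (z - w))) \<partial>lebesgue_on V) = 0"
    by (simp add: mult_ac)
  then show ?thesis using s by (simp add: conv_def)
qed

lemma conv_add:
  assumes "integrable (lebesgue_on V) (\<lambda>w. h w * f ((1/s) *\<^sub>R (z - w)))"
    "integrable (lebesgue_on V) (\<lambda>w. h w * g ((1/s) *\<^sub>R (z - w)))"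
  shows "conv V h (\<lambda>y. f y + g y) s z = conv V h f s z + conv V h g s z"
  using assms by (simp add: conv_def distrib_left)

lemma conv_mult: "conv V h (\<lambda>y. c * f y) s z = c * conv V h f s z"
proof -
  have "conv V h (\<lambda>y. c * f y) s z = (\<integral>w. c * (h w * f ((1/s) *\<^sub>R (z - w))) \<partial>lebesgue_on V)"
    unfolding conv_def by (rule Bochner_Integration.integral_cong) (auto simp: mult_ac)
  then show ?thesis by (simp add: conv_def)
qed

text \<open>
  Differentiation in \<open>z\<close> falls on \<open>\<psi>\<close>, so the Wirtinger derivatives are those that vanish by
  \<open>conv_dbar_eq_0\<close>.
\<close>

lemma conv_holo:
  assumes h: "integrable (lebesgue_on V) h" and wh: "weakly_holo V h"
    and \<psi>: "\<psi> \<in> test_functions (cball 0 1)" and s: "s > 0" and W: "\<And>z. z \<in> W \<Longrightarrow> cball z s \<subseteq> V"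
  shows "holo W (conv V h \<psi> s)"
  unfolding holo_def holo_deriv_def
proof (intro exI conjI ballI allI)
  define H' where "H' z v = conv V h (\<lambda>y. fderiv \<psi> y ((1/s) *\<^sub>R v)) s z" for z v
  show "(conv V h \<psi> s has_derivative H' z) (at z)" for z
    unfolding H'_def by (rule conv_has_derivative[OF h \<psi> s])
  show "continuous_on W (\<lambda>z. H' z v)" for v
    unfolding H'_def
    by (rule continuous_at_imp_continuous_on)
       (blast intro: has_derivative_continuous conv_has_derivative[OF h test_functions_derivative[OF \<psi>] s])
  show "dbar_part j (H' z) = 0" if "z \<in> W" for z j
  proof -
    have i: "integrable (lebesgue_on V) (\<lambda>w. h w * fderiv \<psi> ((1/s) *\<^sub>R (z - w)) v)" for v
      by (rule conv_integrable_test[OF h test_functions_derivative[OF \<psi>]])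
    have l: "fderiv \<psi> y ((1/s) *\<^sub>R v) = of_real (1/s) * fderiv \<psi> y v" for y v
      using linear_scale[OF has_derivative_linear[OF test_functions_has_derivative(1)[OF \<psi>, of y]], of "1/s" v]
      unfolding scaleR_conv_of_real .
    have "integrable (lebesgue_on V) (\<lambda>w. \<i> * (h w * fderiv \<psi> ((1/s) *\<^sub>R (z - w)) v))" for v
      using i by simp
    then have i2: "integrable (lebesgue_on V) (\<lambda>w. h w * (\<i> * fderiv \<psi> ((1/s) *\<^sub>R (z - w)) v))" for v
      by (simp only: mult.left_commute)
    have "wirtinger_bar j \<psi> = (\<lambda>y. 1/2 * (fderiv \<psi> y (axis j 1) + \<i> * fderiv \<psi> y (axis j \<i>)))"
      by (simp add: wirtinger_bar_def[abs_def])
    then have "conv V h (wirtinger_bar j \<psi>) s z = 1/2 * (conv V h (\<lambda>y. fderiv \<psi> y (axis j 1)) s z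
        + \<i> * conv V h (\<lambda>y. fderiv \<psi> y (axis j \<i>)) s z)"
      by (simp only: conv_mult conv_add[OF i i2])
    then have "dbar_part j (H' z) = of_real (1/s) * conv V h (wirtinger_bar j \<psi>) s z"
      unfolding H'_def dbar_part_def l conv_mult by (simp add: algebra_simps)
    then show ?thesis using conv_dbar_eq_0[OF wh \<psi> s W[OF that]] by simp
  qed
qed

lemma C_k_sum: "(\<And>i. i \<in> I \<Longrightarrow> C_k k (f i)) \<Longrightarrow> C_k k (\<lambda>x. \<Sum>i\<in>I. f i x)"
  by (induction I rule: infinite_finite_induct) (auto intro: C_k_add C_k_const)

lemma test_functions_wirtinger_bar:
  assumes "\<phi> \<in> test_functions U"
  shows "wirtinger_bar j \<phi> \<in> test_functions U"
proof (rule test_functionsI)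
  have "C_k k (\<lambda>z. (1/2) * (fderiv \<phi> z (axis j 1) + \<i> * fderiv \<phi> z (axis j \<i>)))" for k
    by (intro C_k_mult C_k_add C_k_const test_functions_smooth[OF test_functions_derivative[OF assms]])
  then show "C_k k (wirtinger_bar j \<phi>)" for k by (simp add: wirtinger_bar_def[abs_def])
qed (rule test_functionsD(2)[OF assms] test_functions_support[OF assms] wirtinger_bar_test_function(2)[OF assms], assumption?)+

lemma test_functions_mult:
  assumes "\<phi> \<in> test_functions U" and "\<And>k. C_k k f"
  shows "(\<lambda>x. f x * \<phi> x) \<in> test_functions U"
proof (rule test_functionsI)
  show "C_k k (\<lambda>x. f x * \<phi> x)" for k by (intro C_k_mult assms(2) test_functions_smooth[OF assms(1)])
  show "f x * \<phi> x = 0" if "x \<notin> closure {x. \<phi> x \<noteq> 0}" for x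
    using test_functionsD(3)[OF assms(1) that] by simp
qed (rule test_functionsD(2)[OF assms(1)] test_functions_support[OF assms(1)])+

lemma conv_euler_eq_0:
  fixes h :: "complex^'n \<Rightarrow> complex"
  assumes h: "integrable (lebesgue_on V) h" and wh: "weakly_holo V h" and s: "s > 0" and z: "cball z s \<subseteq> V"
  defines "E \<equiv> \<lambda>y. fderiv bump y y"
  shows "E \<in> test_functions (cball 0 1)"
    and "of_nat (2 * CARD('n)) * conv V h bump s z + conv V h E s z = 0"
proof -
  define W :: "'n \<Rightarrow> complex^'n \<Rightarrow> complex" where "W j = wirtinger_bar j (\<lambda>y. cnj (y $ j) * bump y)" for j
  have t: "(\<lambda>y. cnj (y $ j) * bump y) \<in> test_functions (cball 0 1)" for j :: 'n
    by (rule test_functions_mult[OF bump_test_function])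
       (rule C_k_linear[OF bounded_linear_compose[OF bounded_linear_cnj bounded_linear_vec_nth]])
  have W: "W j \<in> test_functions (cball 0 1)" for j
    unfolding W_def by (rule test_functions_wirtinger_bar[OF t])
  have E: "E = (\<lambda>y. 2 * (\<Sum>j\<in>UNIV. W j y) + (- of_nat (2 * CARD('n))) * bump y)"
    using bump_euler unfolding E_def W_def by (intro ext) (simp add: algebra_simps)
  show Et: "E \<in> test_functions (cball 0 1)"
  proof (rule test_functionsI[where S="cball 0 1"])
    show "C_k k E" for k
      unfolding E by (intro C_k_add C_k_mult C_k_const C_k_sum test_functions_smooth[OF W] test_functions_smooth[OF bump_test_function])
    show "E x = 0" if "x \<notin> cball 0 1" for x
      unfolding E using test_functions_zero[OF W that] test_functions_zero[OF bump_test_function that] by simp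
  qed auto
  have iW: "integrable (lebesgue_on V) (\<lambda>w. h w * W j ((1/s) *\<^sub>R (z - w)))" for j
    by (rule conv_integrable_test[OF h W])
  have "of_nat (2 * CARD('n)) * conv V h bump s z + conv V h E s z =
      (\<integral>w. of_nat (2 * CARD('n)) * (h w * bump ((1/s) *\<^sub>R (z - w))) + h w * E ((1/s) *\<^sub>R (z - w)) \<partial>lebesgue_on V)"
    using conv_integrable_test[OF h bump_test_function] conv_integrable_test[OF h Et] by (simp add: conv_def)
  also have "\<dots> = (\<integral>w. 2 * (\<Sum>j\<in>UNIV. h w * W j ((1/s) *\<^sub>R (z - w))) \<partial>lebesgue_on V)"
    by (rule Bochner_Integration.integral_cong) (auto simp: E algebra_simps sum_distrib_left)
  also have "\<dots> = 2 * (\<Sum>j\<in>UNIV. conv V h (W j) s z)"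
    using iW by (simp add: conv_def)
  also have "\<dots> = 0" unfolding W_def by (simp add: conv_dbar_eq_0[OF wh t s z])
  finally show "of_nat (2 * CARD('n)) * conv V h bump s z + conv V h E s z = 0" .
qed

lemma bump_radius_derivative:
  fixes x :: "complex^'n"
  assumes s: "s > 0"
  shows "((\<lambda>s. bump ((1/s) *\<^sub>R x)) has_derivative
    (\<lambda>t. t *\<^sub>R (- (1/s) *\<^sub>R fderiv bump ((1/s) *\<^sub>R x) ((1/s) *\<^sub>R x)))) (at s)"
proof -
  have l: "linear (fderiv bump y)" for y :: "complex^'n"
    by (rule has_derivative_linear[OF test_functions_has_derivative(1)[OF bump_test_function]])
  have "((\<lambda>s. (1/s) *\<^sub>R x) has_derivative (\<lambda>t. (- t / s\<^sup>2) *\<^sub>R x)) (at s)"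
    using s by (auto intro!: derivative_eq_intros simp: power2_eq_square divide_inverse)
  from has_derivative_compose[OF this test_functions_has_derivative(1)[OF bump_test_function]]
  have "((\<lambda>s. bump ((1/s) *\<^sub>R x)) has_derivative
    (\<lambda>t. fderiv bump ((1/s) *\<^sub>R x) ((- t / s\<^sup>2) *\<^sub>R x))) (at s)" .
  also have "(\<lambda>t. fderiv bump ((1/s) *\<^sub>R x) ((- t / s\<^sup>2) *\<^sub>R x)) =
      (\<lambda>t. t *\<^sub>R (- (1/s) *\<^sub>R fderiv bump ((1/s) *\<^sub>R x) ((1/s) *\<^sub>R x)))"
    unfolding linear_scale[OF l] scaleR_scaleR by (simp add: power2_eq_square)
  finally show ?thesis .
qed

lemma conv_radius_derivative:
  fixes h :: "complex^'n \<Rightarrow> complex"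
  assumes h: "integrable (lebesgue_on V) h" and s0: "s0 > 0"
    and Et: "(\<lambda>y. fderiv bump y y) \<in> test_functions (cball 0 (1::real) :: (complex^'n) set)"
  shows "((\<lambda>s. conv V h bump s z) has_derivative
    (\<lambda>t. t *\<^sub>R (- (1/s0) *\<^sub>R conv V h (\<lambda>y. fderiv bump y y) s0 z))) (at s0)"
proof -
  define E :: "complex^'n \<Rightarrow> complex" where "E y = fderiv bump y y" for y
  obtain M where M: "M \<ge> 0" "\<And>x. norm (E x) \<le> M"
    unfolding E_def by (rule test_functions_bounded[OF Et]) blast
  have "((\<lambda>s. \<integral>w. h w * bump ((1/s) *\<^sub>R (z - w)) \<partial>lebesgue_on V) has_derivative
    (\<lambda>t. \<integral>w. h w * (t *\<^sub>R (- (1/s0) *\<^sub>R E ((1/s0) *\<^sub>R (z - w)))) \<partial>lebesgue_on V)) (at s0)"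
  proof (rule has_derivative_integral_dominated[where e="s0/2" and B="\<lambda>w. norm (h w) * (2 * M / s0)"])
    show "integrable (lebesgue_on V) (\<lambda>w. h w * bump ((1/s) *\<^sub>R (z - w)))" for s
      by (rule conv_integrable_test[OF h bump_test_function])
    show "((\<lambda>s. h w * bump ((1/s) *\<^sub>R (z - w))) has_derivative
        (\<lambda>t. h w * (t *\<^sub>R (- (1/s0) *\<^sub>R E ((1/s0) *\<^sub>R (z - w)))))) (at s0)" for w
      unfolding E_def by (intro has_derivative_mult_right bump_radius_derivative s0)
    have "(\<lambda>w. h w * E ((1/s0) *\<^sub>R (z - w))) \<in> borel_measurable (lebesgue_on V)"
      unfolding E_def by (rule borel_measurable_integrable[OF conv_integrable_test[OF h Et]])
    then have "(\<lambda>w. t *\<^sub>R (- (1/s0) *\<^sub>R (h w * E ((1/s0) *\<^sub>R (z - w))))) \<in> borel_measurable (lebesgue_on V)" for t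
      by (intro borel_measurable_scaleR borel_measurable_const)
    then show "(\<lambda>w. h w * (t *\<^sub>R (- (1/s0) *\<^sub>R E ((1/s0) *\<^sub>R (z - w))))) \<in> borel_measurable (lebesgue_on V)" for t
      by (simp only: mult_scaleR_right)
    show "norm (h w * bump ((1/s) *\<^sub>R (z - w)) - h w * bump ((1/s0) *\<^sub>R (z - w))) \<le> norm (h w) * (2 * M / s0) * norm (s - s0)"
      if "s \<in> ball s0 (s0/2)" for s w
    proof -
      have "norm (bump ((1/s) *\<^sub>R (z - w)) - bump ((1/s0) *\<^sub>R (z - w))) \<le> (2 * M / s0) * norm (s - s0)"
      proof (rule differentiable_bound[of "ball s0 (s0/2)" _ "\<lambda>s t. t *\<^sub>R (- (1/s) *\<^sub>R E ((1/s) *\<^sub>R (z - w)))"])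
        fix s assume "s \<in> ball s0 (s0/2)"
        then have s: "s > s0/2" "s > 0" using s0 by (auto simp: dist_real_def abs_if split: if_splits)
        show "((\<lambda>s. bump ((1/s) *\<^sub>R (z - w))) has_derivative (\<lambda>t. t *\<^sub>R (- (1/s) *\<^sub>R E ((1/s) *\<^sub>R (z - w)))))
            (at s within ball s0 (s0/2))"
          unfolding E_def by (rule has_derivative_at_withinI[OF bump_radius_derivative[OF s(2)]])
        show "onorm (\<lambda>t. t *\<^sub>R (- (1/s) *\<^sub>R E ((1/s) *\<^sub>R (z - w)))) \<le> 2 * M / s0"
        proof (rule onorm_bound)
          fix t :: real
          have "(1/s) * norm (E ((1/s) *\<^sub>R (z - w))) \<le> (2/s0) * M"
            using s s0 M by (intro mult_mono) (auto simp: field_simps)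
          then have "\<bar>t\<bar> * ((1/s) * norm (E ((1/s) *\<^sub>R (z - w)))) \<le> \<bar>t\<bar> * ((2/s0) * M)"
            by (rule mult_left_mono) simp
          then show "norm (t *\<^sub>R (- (1/s) *\<^sub>R E ((1/s) *\<^sub>R (z - w)))) \<le> 2 * M / s0 * norm t"
            using s by (simp add: mult_ac)
        qed (use M s0 in simp)
      qed (use that s0 in auto)
      then have "norm (h w) * norm (bump ((1/s) *\<^sub>R (z - w)) - bump ((1/s0) *\<^sub>R (z - w))) \<le> norm (h w) * ((2 * M / s0) * norm (s - s0))"
        by (rule mult_left_mono) simp
      then show ?thesis unfolding right_diff_distrib[symmetric] norm_mult by (simp only: mult.assoc)
    qed
    show "integrable (lebesgue_on V) (\<lambda>w. norm (h w) * (2 * M / s0))" using h by simp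
  qed (use s0 in simp)
  then show ?thesis unfolding conv_def E_def by simp
qed

text \<open>
  By \<open>conv_euler_eq_0\<close> the derivative with respect to \<open>s\<close> is zero. For holomorphic functions this is
  the mean value property.
\<close>

lemma conv_bump_radius_constant:
  fixes h :: "complex^'n \<Rightarrow> complex"
  assumes h: "integrable (lebesgue_on V) h" and wh: "weakly_holo V h" and T: "ball z T \<subseteq> V"
    and s: "s \<in> {0<..<T}" and s': "s' \<in> {0<..<T}"
  shows "of_real ((1/s) ^ (2 * CARD('n))) * conv V h bump s z = of_real ((1/s') ^ (2 * CARD('n))) * conv V h bump s' z"
proof -
  define d where "d = 2 * CARD('n)"
  define F where "F s = of_real ((1/s) ^ d) * conv V h bump s z" for s
  have "(F has_derivative (\<lambda>_. 0)) (at s within {0<..<T})" if "s \<in> {0<..<T}" for s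
  proof -
    have s: "s > 0" "cball z s \<subseteq> V" using that T by (auto simp: subset_iff)
    note E = conv_euler_eq_0[OF h wh s]
    define C where "C = conv V h (\<lambda>y. fderiv bump y y) s z"
    have eq: "of_nat d * conv V h bump s z + C = 0" using E(2) by (simp add: d_def C_def)
    obtain m where m: "d = Suc m" using not0_implies_Suc[of d] by (auto simp: d_def)
    have "((\<lambda>s. inverse s ^ d) has_real_derivative of_nat d * (- (inverse s ^ Suc (Suc 0)) * inverse s ^ (d - Suc 0))) (at s)"
      using s(1) by (intro DERIV_power DERIV_inverse) simp
    also have "of_nat d * (- (inverse s ^ Suc (Suc 0)) * inverse s ^ (d - Suc 0)) = - (of_nat d * (1/s) ^ d * (1/s))"
      by (simp add: m divide_inverse mult_ac)
    finally have "((\<lambda>s. (1/s) ^ d) has_derivative (\<lambda>t. t * (- (of_nat d * (1/s) ^ d * (1/s))))) (at s)"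
      unfolding has_field_derivative_def inverse_eq_divide
      by (rule has_derivative_eq_rhs) (simp add: fun_eq_iff mult.commute)
    then have "((\<lambda>s. complex_of_real ((1/s) ^ d)) has_derivative (\<lambda>t. of_real (t * (- (of_nat d * (1/s) ^ d * (1/s)))))) (at s)"
      by (rule has_derivative_of_real)
    from has_derivative_mult[OF this conv_radius_derivative[OF h s(1) E(1)]]
    have "(F has_derivative (\<lambda>t. of_real ((1/s) ^ d) * (t *\<^sub>R (- (1/s) *\<^sub>R C)) +
        of_real (t * (- (of_nat d * (1/s) ^ d * (1/s)))) * conv V h bump s z)) (at s)"
      unfolding F_def[abs_def] C_def .
    also have "(\<lambda>t. of_real ((1/s) ^ d) * (t *\<^sub>R (- (1/s) *\<^sub>R C)) +
        of_real (t * (- (of_nat d * (1/s) ^ d * (1/s)))) * conv V h bump s z) =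
        (\<lambda>t. - of_real ((1/s) ^ d * t * (1/s)) * (of_nat d * conv V h bump s z + C))"
      by (auto simp: fun_eq_iff scaleR_conv_of_real algebra_simps add_divide_distrib)
    finally have "(F has_derivative (\<lambda>_. 0)) (at s)" by (simp add: eq)
    then show ?thesis by (rule has_derivative_at_withinI)
  qed
  then obtain c where "\<forall>s\<in>{0<..<T}. F s = c"
    using has_derivative_zero_constant[of "{0<..<T}" F] by auto
  then show ?thesis using s s' unfolding F_def d_def by metis
qed

lemma bump_integral_nonzero: "(\<integral>y. bump (y :: complex^'n) \<partial>lborel) \<noteq> 0"
proof -
  define b :: "complex^'n \<Rightarrow> real" where "b = ball_cutoff 0 (1/2)"
  have b: "continuous_on UNIV b" using C_k_ball_cutoff[of 0] unfolding b_def C_k.simps .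
  have "b x = 0" if "x \<notin> cball 0 1" for x
    using that ball_cutoff(2)[of "1/2" x 0] by (simp add: b_def)
  then have ib: "integrable lborel b"
    by (rule continuous_compact_support_integrable[OF b compact_cball])
  have "emeasure lborel (ball (0::complex^'n) (1/2)) < \<infinity>" by (rule emeasure_bounded_finite) simp
  then have ii: "integrable lborel (indicator (ball 0 (1/2)) :: complex^'n \<Rightarrow> real)"
    by (intro integrable_real_indicator) auto
  have "0 < measure lborel (ball (0::complex^'n) (1/2))" by (rule content_ball_pos) simp
  also have "\<dots> = (\<integral>y. indicator (ball (0::complex^'n) (1/2)) y \<partial>lborel)" by simp
  also have "\<dots> \<le> (\<integral>y. b y \<partial>lborel)"
    by (rule integral_mono[OF ii ib])
       (use ball_cutoff(1)[of "1/2" _ "0::complex^'n"] ball_cutoff(3)[of "1/2" "0::complex^'n"] in \<open>auto simp: b_def indicator_def\<close>)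
  finally have "(\<integral>y. b y \<partial>lborel) \<noteq> 0" by simp
  then show ?thesis by (simp add: bump_def[abs_def] b_def)
qed

lemma lborel_integral_affine:
  fixes f :: "'a::euclidean_space \<Rightarrow> complex"
  assumes f: "f \<in> borel_measurable borel" and s: "s > 0"
  shows "(\<integral>z. f z \<partial>lborel) = of_real (s ^ DIM('a)) * (\<integral>y. f (w + s *\<^sub>R y) \<partial>lborel)"
proof -
  have [measurable]: "f \<in> borel_measurable borel" by (rule f)
  have "(\<integral>z. f z \<partial>lborel) = (\<integral>z. f z \<partial>density (distr lborel borel (\<lambda>x. w + s *\<^sub>R x)) (\<lambda>_. ennreal (\<bar>s\<bar> ^ DIM('a))))"
    using s by (subst lborel_affine[of s w]) auto
  also have "\<dots> = (\<integral>z. (\<bar>s\<bar> ^ DIM('a)) *\<^sub>R f z \<partial>distr lborel borel (\<lambda>x. w + s *\<^sub>R x))"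
    by (rule integral_density) auto
  also have "\<dots> = (\<integral>y. (\<bar>s\<bar> ^ DIM('a)) *\<^sub>R f (w + s *\<^sub>R y) \<partial>lborel)"
    by (rule integral_distr) auto
  finally show ?thesis using s by (simp add: scaleR_conv_of_real)
qed

text \<open>
  The kernels are an approximate identity, up to the constant \<open>\<integral> bump\<close>. By Fubini's theorem and the
  substitution \<open>z = w + s y\<close> the integral equals \<open>\<integral> h(w) (\<integral> bump(y) \<phi>(w + s y) dy) dw\<close>, where \<open>\<phi>\<close>
  is continuous, so that dominated convergence applies twice.
\<close>

lemma conv_weak_limit:
  fixes h \<phi> :: "complex^'n \<Rightarrow> complex"
  assumes V: "open V" "bounded V" and h: "integrable (lebesgue_on V) h"
    and \<phi>: "continuous_on UNIV \<phi>" "\<And>z. norm (\<phi> z) \<le> M" "\<And>z. z \<notin> V \<Longrightarrow> \<phi> z = 0"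
    and s: "\<And>n. s n > 0" "s \<longlonglongrightarrow> 0"
  shows "(\<lambda>n. \<integral>z. of_real ((1 / s n) ^ (2 * CARD('n))) * conv V h bump (s n) z * \<phi> z \<partial>lebesgue_on V)
    \<longlonglongrightarrow> (\<integral>y. bump (y :: complex^'n) \<partial>lborel) * (\<integral>z. h z * \<phi> z \<partial>lebesgue_on V)"
proof -
  define P where "P = lebesgue_on V"
  define c where "c = (\<integral>y. bump (y :: complex^'n) \<partial>lborel)"
  define d where "d = 2 * CARD('n)"
  have d: "d = DIM(complex^'n)" by (simp add: d_def)
  have Vm: "V \<in> lmeasurable" using V by (simp add: bounded_set_imp_lmeasurable borel_open)
  interpret P: finite_measure P unfolding P_def by (rule finite_measure_lebesgue_on[OF Vm])
  interpret PP: pair_sigma_finite P P ..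
  have ib: "integrable lborel (bump :: complex^'n \<Rightarrow> complex)"
    by (rule continuous_compact_support_integrable[OF test_functionsD(1)[OF bump_test_function] compact_cball test_functions_zero[OF bump_test_function]])
  have M: "M \<ge> 0" using \<phi>(2)[of undefined] norm_ge_zero order_trans by blast
  have [measurable]: "\<phi> \<in> borel_measurable borel" "(bump :: complex^'n \<Rightarrow> complex) \<in> borel_measurable borel"
    by (rule borel_measurable_continuous_onI[OF \<phi>(1)], rule borel_measurable_continuous_onI[OF test_functionsD(1)[OF bump_test_function]])
  have idm[measurable]: "(\<lambda>x. x) \<in> borel_measurable P"
    unfolding P_def by (rule continuous_measurable_lebesgue_on) simp
  have hm[measurable]: "h \<in> borel_measurable P" using h by (simp add: P_def)
  define \<Psi> where "\<Psi> n w = (\<integral>y. bump y * \<phi> (w + s n *\<^sub>R y) \<partial>lborel)" for n w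
  define k where "k n w z = (of_real ((1 / s n) ^ d) * (h w * bump ((1 / s n) *\<^sub>R (z - w)))) * \<phi> z" for n w z
  have [measurable]: "(\<lambda>p. fst p) \<in> borel_measurable (P \<Otimes>\<^sub>M P)" "(\<lambda>p. snd p) \<in> borel_measurable (P \<Otimes>\<^sub>M P)"
    by (rule measurable_compose[OF measurable_fst idm], rule measurable_compose[OF measurable_snd idm])
  have [measurable]: "(\<lambda>p. h (fst p)) \<in> borel_measurable (P \<Otimes>\<^sub>M P)"
    by (rule measurable_compose[OF measurable_fst hm])
  have km: "(\<lambda>p. k n (fst p) (snd p)) \<in> borel_measurable (P \<Otimes>\<^sub>M P)" for n
    unfolding k_def by measurable
  have ik: "integrable (P \<Otimes>\<^sub>M P) (\<lambda>(w, z). k n w z)" for n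
  proof (rule Bochner_Integration.integrable_bound)
    have "integrable (P \<Otimes>\<^sub>M P) (\<lambda>p. norm (h (fst p)))"
    proof (rule PP.Fubini_integrable)
      show "integrable P (\<lambda>x. \<integral>y. norm (norm (h (fst (x, y)))) \<partial>P)"
        using h by (simp add: P_def)
    qed auto
    then show "integrable (P \<Otimes>\<^sub>M P) (\<lambda>p. ((1 / s n) ^ d * M) * norm (h (fst p)))" by simp
    show "(\<lambda>(w, z). k n w z) \<in> borel_measurable (P \<Otimes>\<^sub>M P)"
      using km[of n] by (simp add: case_prod_unfold)
    have "norm (k n w z) \<le> norm (((1 / s n) ^ d * M) * norm (h w))" for w z
    proof -
      have "norm (k n w z) = (1 / s n) ^ d * (norm (h w) * norm (bump ((1 / s n) *\<^sub>R (z - w)))) * norm (\<phi> z)"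
        using s(1)[of n] by (simp add: k_def norm_mult norm_power norm_divide)
      also have "\<dots> \<le> (1 / s n) ^ d * (norm (h w) * 1) * M"
        using s(1)[of n] by (intro mult_mono \<phi>(2) norm_bump_le_1) (auto simp: less_imp_le)
      finally show ?thesis using s(1)[of n] M by (simp add: mult_ac abs_mult)
    qed
    then show "AE p in P \<Otimes>\<^sub>M P. norm (case p of (w, z) \<Rightarrow> k n w z) \<le> norm (((1 / s n) ^ d * M) * norm (h (fst p)))"
      by (intro AE_I2) auto
  qed
  have k\<Psi>: "(\<integral>z. k n w z \<partial>P) = h w * \<Psi> n w" for n w
  proof -
    have "(\<integral>z. k n w z \<partial>P) = (\<integral>z. indicator V z *\<^sub>R k n w z \<partial>lebesgue)"
      unfolding P_def using V(1) by (intro integral_restrict_space) (auto simp: borel_open)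
    also have "(\<lambda>z. indicator V z *\<^sub>R k n w z) = k n w"
      using \<phi>(3) by (auto simp: k_def indicator_def)
    also have "(\<integral>z. k n w z \<partial>lebesgue) = (\<integral>z. k n w z \<partial>lborel)"
      by (rule integral_completion) (simp add: k_def)
    also have "\<dots> = of_real (s n ^ d) * (\<integral>y. k n w (w + s n *\<^sub>R y) \<partial>lborel)"
      unfolding d by (rule lborel_integral_affine) (auto simp: k_def s)
    also have "\<dots> = (\<integral>y. h w * (bump y * \<phi> (w + s n *\<^sub>R y)) \<partial>lborel)"
      unfolding integral_mult_right_zero[symmetric]
      by (rule Bochner_Integration.integral_cong) (use s(1)[of n] in \<open>auto simp: k_def power_divide\<close>)
    finally show ?thesis by (simp add: \<Psi>_def)
  qed
  have "(\<integral>z. of_real ((1 / s n) ^ d) * conv V h bump (s n) z * \<phi> z \<partial>P) = (\<integral>w. h w * \<Psi> n w \<partial>P)" for n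
  proof -
    have "(\<integral>z. of_real ((1 / s n) ^ d) * conv V h bump (s n) z * \<phi> z \<partial>P) = (\<integral>z. (\<integral>w. k n w z \<partial>P) \<partial>P)"
      by (simp add: k_def conv_def P_def)
    also have "\<dots> = (\<integral>w. (\<integral>z. k n w z \<partial>P) \<partial>P)" by (rule PP.Fubini_integral[OF ik])
    finally show ?thesis by (simp only: k\<Psi>)
  qed
  moreover have "(\<lambda>n. \<integral>w. h w * \<Psi> n w \<partial>P) \<longlonglongrightarrow> (\<integral>w. h w * (c * \<phi> w) \<partial>P)"
  proof (rule integral_dominated_convergence)
    show "integrable P (\<lambda>w. norm (h w) * (M * (\<integral>y. norm (bump (y :: complex^'n)) \<partial>lborel)))"
      using h by (simp add: P_def)
    have \<phi>P: "\<phi> \<in> borel_measurable P"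
      unfolding P_def by (rule continuous_measurable_lebesgue_on[OF \<phi>(1)])
    show "(\<lambda>w. h w * (c * \<phi> w)) \<in> borel_measurable P" using \<phi>P by measurable
    have "integrable P (\<lambda>w. \<integral>z. k n w z \<partial>P)" for n by (rule PP.integrable_fst[OF ik])
    then show "(\<lambda>w. h w * \<Psi> n w) \<in> borel_measurable P" for n unfolding k\<Psi> by simp
    show "AE w in P. (\<lambda>n. h w * \<Psi> n w) \<longlonglongrightarrow> h w * (c * \<phi> w)"
    proof (intro AE_I2 tendsto_mult_left)
      fix w
      have "(\<lambda>n. \<integral>y. bump y * \<phi> (w + s n *\<^sub>R y) \<partial>lborel) \<longlonglongrightarrow> (\<integral>y. bump (y :: complex^'n) * \<phi> w \<partial>lborel)"
      proof (rule integral_dominated_convergence)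
        show "integrable lborel (\<lambda>y. norm (bump (y :: complex^'n)) * M)" using ib by simp
        show "AE y in lborel. (\<lambda>n. bump y * \<phi> (w + s n *\<^sub>R y)) \<longlonglongrightarrow> bump y * \<phi> w"
        proof (intro AE_I2 tendsto_mult_left)
          fix y :: "complex^'n"
          have "(\<lambda>n. w + s n *\<^sub>R y) \<longlonglongrightarrow> w + 0 *\<^sub>R y" by (intro tendsto_intros s(2))
          then show "(\<lambda>n. \<phi> (w + s n *\<^sub>R y)) \<longlonglongrightarrow> \<phi> w"
            using \<phi>(1) by (intro isCont_tendsto_compose[where g=\<phi>]) (auto simp: continuous_on_eq_continuous_at)
        qed
        show "AE y in lborel. norm (bump y * \<phi> (w + s n *\<^sub>R y)) \<le> norm (bump y) * M" for n
          by (intro AE_I2) (simp add: norm_mult mult_left_mono \<phi>(2))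
      qed auto
      then show "(\<lambda>n. \<Psi> n w) \<longlonglongrightarrow> c * \<phi> w" by (simp add: \<Psi>_def c_def)
    qed
    show "AE w in P. norm (h w * \<Psi> n w) \<le> norm (h w) * (M * (\<integral>y. norm (bump (y :: complex^'n)) \<partial>lborel))" for n
    proof (intro AE_I2)
      fix w
      have "norm (\<Psi> n w) \<le> (\<integral>y. M * norm (bump (y :: complex^'n)) \<partial>lborel)"
        unfolding \<Psi>_def
      proof (rule order_trans[OF integral_norm_bound], rule integral_mono)
        show "integrable lborel (\<lambda>y. norm (bump y * \<phi> (w + s n *\<^sub>R y)))"
          by (rule Bochner_Integration.integrable_bound[of _ "\<lambda>y. M * norm (bump (y :: complex^'n))"])
             (use ib M \<phi>(2) in \<open>auto simp: norm_mult mult.commute[of M] intro!: mult_left_mono\<close>)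
        show "norm (bump y * \<phi> (w + s n *\<^sub>R y)) \<le> M * norm (bump y)" for y
          by (simp add: norm_mult mult.commute[of M] mult_left_mono \<phi>(2))
      qed (use ib in simp)
      then show "norm (h w * \<Psi> n w) \<le> norm (h w) * (M * (\<integral>y. norm (bump (y :: complex^'n)) \<partial>lborel))"
        by (simp add: norm_mult mult_left_mono)
    qed
  qed
  moreover have "(\<integral>w. h w * (c * \<phi> w) \<partial>P) = c * (\<integral>w. h w * \<phi> w \<partial>P)"
    by (simp add: mult.left_commute[of _ c])
  ultimately show ?thesis by (simp add: P_def c_def d_def)
qed

section \<open>Weyl's lemma\<close>

lemma AE_lebesgue_on_iff_negligible:
  assumes "open V"
  shows "(AE x in lebesgue_on V. P x) \<longleftrightarrow> negligible {x \<in> V. \<not> P x}"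
proof -
  have "(AE x in lebesgue_on V. P x) \<longleftrightarrow> (AE x in lebesgue. x \<in> V \<longrightarrow> P x)"
    using assms by (intro AE_restrict_space_iff) (simp add: borel_open)
  also have "\<dots> \<longleftrightarrow> negligible {x \<in> V. \<not> P x}"
  proof
    assume "AE x in lebesgue. x \<in> V \<longrightarrow> P x"
    then obtain N where N: "N \<in> null_sets lebesgue" "{x \<in> space lebesgue. \<not> (x \<in> V \<longrightarrow> P x)} \<subseteq> N"
      by (auto simp: eventually_ae_filter)
    then have "negligible N" by (simp add: negligible_iff_null_sets)
    then show "negligible {x \<in> V. \<not> P x}" by (rule negligible_subset) (use N(2) in auto)
  next
    assume "negligible {x \<in> V. \<not> P x}"
    then have "{x \<in> V. \<not> P x} \<in> null_sets lebesgue" by (simp add: negligible_iff_null_sets)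
    from AE_not_in[OF this] show "AE x in lebesgue. x \<in> V \<longrightarrow> P x" by eventually_elim auto
  qed
  finally show ?thesis .
qed

lemma indicator_compact_measurable:
  fixes C :: "'a::euclidean_space set"
  assumes "compact C"
  shows "(indicator C :: 'a \<Rightarrow> real) \<in> borel_measurable (lebesgue_on V)"
proof -
  have "indicator C \<in> borel_measurable (lborel :: 'a measure)"
    using assms by (intro borel_measurable_indicator) (simp add: borel_compact)
  then show ?thesis by (intro measurable_restrict_space1 measurable_completion)
qed

text \<open>
  The indicator function of \<open>C\<close> is the limit of continuous functions between \<open>0\<close> and \<open>1\<close> which
  vanish outside a fixed compact subset of \<open>V\<close>.
\<close>

lemma integral_compact_eq_0:
  fixes r :: "'a::euclidean_space \<Rightarrow> real"
  assumes V: "open V" and r: "integrable (lebesgue_on V) r"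
    and 0: "\<And>\<phi> S. continuous_on UNIV \<phi> \<Longrightarrow> compact S \<Longrightarrow> S \<subseteq> V \<Longrightarrow> (\<And>x. x \<notin> S \<Longrightarrow> \<phi> x = 0) \<Longrightarrow>
      (\<integral>x. r x * \<phi> x \<partial>lebesgue_on V) = 0"
    and C: "compact C" "C \<subseteq> V"
  shows "(\<integral>x. r x * indicator C x \<partial>lebesgue_on V) = 0"
proof (cases "C = {}")
  case False
  obtain \<eta> :: "'a \<Rightarrow> real" and O' where \<eta>: "\<And>k. C_k k \<eta>" "\<And>x. 0 \<le> \<eta> x" "\<And>x. \<eta> x \<le> 1"
    "compact (closure {x. \<eta> x \<noteq> 0})" "closure {x. \<eta> x \<noteq> 0} \<subseteq> V"
    "open O'" "C \<subseteq> O'" "\<And>x. x \<in> O' \<Longrightarrow> \<eta> x = 1"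
    by (rule smooth_urysohn[OF C(1) V C(2)]) (rule that)
  define \<phi> where "\<phi> k x = \<eta> x * max 0 (1 - real (Suc k) * infdist x C)" for k x
  have "continuous_on UNIV \<eta>" using \<eta>(1)[of 0] by (simp only: C_k.simps)
  then have \<phi>c: "continuous_on UNIV (\<phi> k)" for k
    unfolding \<phi>_def by (intro continuous_intros)
  have \<phi>z: "\<phi> k x = 0" if "x \<notin> closure {x. \<eta> x \<noteq> 0}" for k x
    using that closure_subset[of "{x. \<eta> x \<noteq> 0}"] by (auto simp: \<phi>_def)
  have \<phi>1: "0 \<le> \<phi> k x" "\<phi> k x \<le> 1" for k x
    using \<eta>(2,3)[of x] infdist_nonneg[of x C] by (auto simp: \<phi>_def intro!: mult_le_one)
  have i0: "(\<integral>x. r x * \<phi> k x \<partial>lebesgue_on V) = 0" for k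
    by (rule 0[OF \<phi>c \<eta>(4,5) \<phi>z])
  have rm: "r \<in> borel_measurable (lebesgue_on V)" using r by simp
  have "(\<lambda>k. \<integral>x. r x * \<phi> k x \<partial>lebesgue_on V) \<longlonglongrightarrow> (\<integral>x. r x * indicator C x \<partial>lebesgue_on V)"
  proof (rule integral_dominated_convergence)
    show "integrable (lebesgue_on V) (\<lambda>x. norm (r x))" using r by simp
    show "(\<lambda>x. r x * indicator C x) \<in> borel_measurable (lebesgue_on V)"
      by (intro borel_measurable_times rm indicator_compact_measurable C(1))
    show "(\<lambda>x. r x * \<phi> k x) \<in> borel_measurable (lebesgue_on V)" for k
      by (intro borel_measurable_times rm continuous_measurable_lebesgue_on \<phi>c)
    show "AE x in lebesgue_on V. norm (r x * \<phi> k x) \<le> norm (r x)" for k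
    proof (rule AE_I2)
      fix x
      have "norm (r x * \<phi> k x) \<le> norm (r x) * 1"
        unfolding norm_mult using \<phi>1[where k=k and x=x] by (intro mult_left_mono) auto
      then show "norm (r x * \<phi> k x) \<le> norm (r x)" by simp
    qed
    show "AE x in lebesgue_on V. (\<lambda>k. r x * \<phi> k x) \<longlonglongrightarrow> r x * indicator C x"
    proof (intro AE_I2 tendsto_mult_left)
      fix x
      show "(\<lambda>k. \<phi> k x) \<longlonglongrightarrow> indicator C x"
      proof (cases "x \<in> C")
        case True
        then show ?thesis using \<eta>(7,8) by (auto simp: \<phi>_def)
      next
        case x: False
        have "infdist x C > 0" by (rule infdist_pos_not_in_closed[OF compact_imp_closed[OF C(1)] False x])
        then obtain N where N: "1 / real (Suc N) < infdist x C" using nat_approx_posE by blast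
        have "\<phi> k x = 0" if "k \<ge> N" for k
        proof -
          have "1 / real (Suc k) \<le> 1 / real (Suc N)" using that by (simp add: field_simps)
          then have "1 / real (Suc k) < infdist x C" using N by linarith
          then have "1 < real (Suc k) * infdist x C" by (simp add: divide_less_eq mult.commute)
          then show ?thesis by (simp add: \<phi>_def)
        qed
        then have "\<forall>\<^sub>F k in sequentially. \<phi> k x = indicator C x"
          using x by (auto simp: eventually_sequentially)
        then show ?thesis by (rule tendsto_eventually)
      qed
    qed
  qed
  then show ?thesis using i0 by (simp add: LIMSEQ_const_iff)
qed simp

text \<open>
  By inner regularity the set is a countable union of compact sets up to a null set. On each of these
  the positive function \<open>r\<close> has integral zero.
\<close>

lemma negligible_positive_part:
  fixes r :: "'a::euclidean_space \<Rightarrow> real"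
  assumes V: "open V" and r: "integrable (lebesgue_on V) r" and b: "bounded V"
    and 0: "\<And>\<phi> S. continuous_on UNIV \<phi> \<Longrightarrow> compact S \<Longrightarrow> S \<subseteq> V \<Longrightarrow> (\<And>x. x \<notin> S \<Longrightarrow> \<phi> x = 0) \<Longrightarrow>
      (\<integral>x. r x * \<phi> x \<partial>lebesgue_on V) = 0"
  shows "negligible {x \<in> V. r x > 0}"
proof -
  have Vm: "V \<in> sets lebesgue" using V by (simp add: borel_open)
  have rm: "r \<in> borel_measurable (lebesgue_on V)" using r by simp
  have "{x \<in> space (lebesgue_on V). r x > 0} \<in> sets (lebesgue_on V)" using rm by measurable
  then have A: "{x \<in> V. r x > 0} \<in> sets lebesgue"
    using Vm by (simp add: sets_restrict_space_iff)
  obtain T F where T: "negligible T" and Fc: "\<And>n::nat. compact (F n)"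
    and eq: "{x \<in> V. r x > 0} = (\<Union>n. F n) \<union> T"
    by (rule lebesgue_regular_inner[OF A]) (rule that)
  have F: "F n \<subseteq> {x \<in> V. r x > 0}" for n unfolding eq by blast
  have "negligible (F n)" for n
  proof -
    have FV: "F n \<subseteq> V" using F[of n] by blast
    have i: "integrable (lebesgue_on V) (\<lambda>x. r x * indicator (F n) x)"
    proof (rule Bochner_Integration.integrable_bound[OF r])
      show "(\<lambda>x. r x * indicator (F n) x) \<in> borel_measurable (lebesgue_on V)"
        by (intro borel_measurable_times rm indicator_compact_measurable Fc)
    qed (auto simp: indicator_def)
    have nn: "AE x in lebesgue_on V. 0 \<le> r x * indicator (F n) x"
      using F[of n] by (intro AE_I2) (auto simp: indicator_def)
    have "(\<integral>x. r x * indicator (F n) x \<partial>lebesgue_on V) = 0"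
      by (rule integral_compact_eq_0[OF V r _ Fc[of n] FV]) (rule 0)
    then have "AE x in lebesgue_on V. r x * indicator (F n) x = 0"
      by (simp only: integral_nonneg_eq_0_iff_AE[OF i nn])
    then have "negligible {x \<in> V. r x * indicator (F n) x \<noteq> 0}"
      by (simp only: AE_lebesgue_on_iff_negligible[OF V])
    then show ?thesis by (rule negligible_subset) (use F[of n] in \<open>auto simp: indicator_def\<close>)
  qed
  then show ?thesis unfolding eq by (intro negligible_Un T negligible_Union_nat)
qed

lemma AE_eq_0_if_weakly_0:
  fixes q :: "'a::euclidean_space \<Rightarrow> complex"
  assumes V: "open V" "bounded V" and q: "integrable (lebesgue_on V) q"
    and 0: "\<And>\<phi> S. continuous_on UNIV \<phi> \<Longrightarrow> compact S \<Longrightarrow> S \<subseteq> V \<Longrightarrow> (\<And>x. x \<notin> S \<Longrightarrow> \<phi> x = 0) \<Longrightarrow>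
      (\<integral>x. q x * complex_of_real (\<phi> x) \<partial>lebesgue_on V) = 0"
  shows "negligible {x \<in> V. q x \<noteq> 0}"
proof -
  have i: "integrable (lebesgue_on V) (\<lambda>x. q x * complex_of_real (\<phi> x))"
    if c: "continuous_on UNIV \<phi>" and S: "compact S" and z: "\<And>x. x \<notin> S \<Longrightarrow> \<phi> x = 0" for \<phi> S
  proof -
    obtain M where M: "M \<ge> 0" "\<And>x. norm (\<phi> x) \<le> M"
      by (rule continuous_compact_support_bounded[OF c S z]) (assumption, rule that)
    show ?thesis
    proof (rule integrable_mult_bounded[OF q])
      show "(\<lambda>x. complex_of_real (\<phi> x)) \<in> borel_measurable (lebesgue_on V)"
        by (rule continuous_measurable_lebesgue_on) (intro continuous_intros c)
    qed (use M(2) in simp)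
  qed
  have L: "bounded_linear L \<Longrightarrow> (\<And>z c. L (z * complex_of_real c) = L z * c) \<Longrightarrow> negligible {x \<in> V. L (q x) > 0}"
    for L :: "complex \<Rightarrow> real"
  proof (rule negligible_positive_part[OF V(1) _ V(2)])
    assume L: "bounded_linear L" "\<And>z c. L (z * complex_of_real c) = L z * c"
    show "integrable (lebesgue_on V) (\<lambda>x. L (q x))" by (rule integrable_bounded_linear[OF L(1) q])
    fix \<phi> :: "'a \<Rightarrow> real" and S
    assume \<phi>: "continuous_on UNIV \<phi>" "compact S" "S \<subseteq> V" "\<And>x. x \<notin> S \<Longrightarrow> \<phi> x = 0"
    have "(\<integral>x. L (q x * complex_of_real (\<phi> x)) \<partial>lebesgue_on V) = L (\<integral>x. q x * complex_of_real (\<phi> x) \<partial>lebesgue_on V)"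
      by (rule integral_bounded_linear[OF L(1) i[OF \<phi>(1,2,4)]])
    then show "(\<integral>x. L (q x) * \<phi> x \<partial>lebesgue_on V) = 0"
      using 0[OF \<phi>] L(2) linear_0[OF bounded_linear.linear[OF L(1)]] by simp
  qed
  have "negligible ({x \<in> V. Re (q x) > 0} \<union> {x \<in> V. - Re (q x) > 0} \<union> {x \<in> V. Im (q x) > 0} \<union> {x \<in> V. - Im (q x) > 0})"
    by (intro negligible_Un L bounded_linear_Re bounded_linear_Im bounded_linear_minus) auto
  then show ?thesis by (rule negligible_subset) (auto simp: complex_eq_iff)
qed

lemma holo_locally:
  assumes "\<And>z0. z0 \<in> V \<Longrightarrow> \<exists>W G. open W \<and> z0 \<in> W \<and> holo W G \<and> (\<forall>z\<in>W. H z = G z)"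
  shows "holo V H"
proof -
  have "(H has_derivative fderiv H z0) (at z0) \<and>
      (\<forall>v. isCont (\<lambda>z. fderiv H z v) z0) \<and> (\<forall>j. dbar_part j (fderiv H z0) = 0)"
    if z0: "z0 \<in> V" for z0
  proof -
    obtain W G where W: "open W" "z0 \<in> W" "holo W G" "\<forall>z\<in>W. H z = G z" using assms[OF z0] by blast
    from W(3) obtain G' where "holo_deriv W G G'" unfolding holo_def by blast
    note G' = holo_derivD[OF this]
    have D: "(H has_derivative G' z) (at z)" if "z \<in> W" for z
      by (rule has_derivative_transform_within_open[OF G'(1)[OF that] W(1) that]) (use W(4) in auto)
    have eq: "fderiv H z = G' z" if "z \<in> W" for z
      by (rule frechet_derivative_at[OF D[OF that], symmetric])
    have "isCont (\<lambda>z. fderiv H z v) z0" for v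
    proof -
      have "continuous_on W (\<lambda>z. fderiv H z v)"
        using G'(2)[of v] by (rule continuous_on_eq) (simp add: eq)
      then show ?thesis using W(1,2) by (simp add: continuous_on_eq_continuous_at)
    qed
    then show ?thesis using D[OF W(2)] G'(3)[OF W(2)] eq[OF W(2)] by simp
  qed
  then have "holo_deriv V H (\<lambda>z. fderiv H z)"
    unfolding holo_deriv_def by (blast intro: continuous_at_imp_continuous_on)
  then show ?thesis unfolding holo_def by blast
qed

lemma integrable_lebesgue_on_subset:
  fixes f :: "'a::euclidean_space \<Rightarrow> 'b::euclidean_space"
  assumes V: "open V" and W: "open W" "W \<subseteq> V" and f: "integrable (lebesgue_on V) f"
  shows "integrable (lebesgue_on W) f"
proof -
  have m: "V \<in> sets lebesgue" "W \<in> sets lebesgue" using V W by (auto simp: borel_open)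
  have "integrable lebesgue (\<lambda>x. indicator V x *\<^sub>R f x)"
    using f m(1) by (subst (asm) integrable_restrict_space) auto
  then have "integrable lebesgue (\<lambda>x. indicator W x *\<^sub>R (indicator V x *\<^sub>R f x))"
    by (rule integrable_mult_indicator[OF m(2)])
  also have "(\<lambda>x. indicator W x *\<^sub>R (indicator V x *\<^sub>R f x)) = (\<lambda>x. indicator W x *\<^sub>R f x)"
    using W(2) by (intro ext) (auto split: split_indicator)
  finally show ?thesis using m(2) by (subst integrable_restrict_space) auto
qed

lemma L2_integrable:
  fixes h :: "'a::euclidean_space \<Rightarrow> 'b::euclidean_space"
  assumes V: "open V" "bounded V" and h: "h \<in> L2 V"
  shows "integrable (lebesgue_on V) h"
proof -
  have Vm: "V \<in> lmeasurable" using V by (simp add: bounded_set_imp_lmeasurable borel_open)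
  interpret finite_measure "lebesgue_on V" by (rule finite_measure_lebesgue_on[OF Vm])
  show ?thesis
  proof (rule Bochner_Integration.integrable_bound)
    show "integrable (lebesgue_on V) (\<lambda>x. 1 + (norm (h x))\<^sup>2)" using h by (simp add: L2_def)
    show "h \<in> borel_measurable (lebesgue_on V)" using h by (simp add: L2_def)
    have "norm (h x) \<le> norm (1 + (norm (h x))\<^sup>2)" for x
    proof -
      have "2 * norm (h x) \<le> 1 + (norm (h x))\<^sup>2" using sum_squares_bound[of 1 "norm (h x)"] by simp
      then have "norm (h x) \<le> 1 + (norm (h x))\<^sup>2" using norm_ge_zero[of "h x"] by linarith
      then show ?thesis by simp
    qed
    then show "AE x in lebesgue_on V. norm (h x) \<le> norm (1 + (norm (h x))\<^sup>2)" by simp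
  qed
qed

text \<open>
  Near \<open>z0\<close> the normalized mollification is the same function \<open>G\<close> for all small radii. Tested
  against a continuous function it converges to a multiple of \<open>h\<close> as the radius tends to \<open>0\<close>; so \<open>G\<close>
  itself is that multiple of \<open>h\<close>.
\<close>

lemma weyl_local:
  fixes h :: "complex^'n \<Rightarrow> complex"
  assumes V: "open V" "bounded V" and h: "integrable (lebesgue_on V) h" and wh: "weakly_holo V h"
    and r: "r > 0" "ball z0 (3 * r) \<subseteq> V"
  defines "G \<equiv> \<lambda>z. of_real ((1/r) ^ (2 * CARD('n))) * conv V h bump r z"
  shows "holo (ball z0 r) (\<lambda>z. k * conv V h bump r z)"
    and "negligible {z \<in> ball z0 r. G z \<noteq> (\<integral>y. bump (y :: complex^'n) \<partial>lborel) * h z}"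
proof -
  define W where "W = ball z0 r"
  define c where "c = (\<integral>y. bump (y :: complex^'n) \<partial>lborel)"
  have sub: "ball z (2 * r) \<subseteq> V" if "z \<in> W" for z
  proof -
    have "ball z (2 * r) \<subseteq> ball z0 (3 * r)"
    proof
      fix x assume "x \<in> ball z (2 * r)"
      then show "x \<in> ball z0 (3 * r)"
        using that dist_triangle[of z0 x z] by (simp add: W_def)
    qed
    with r(2) show ?thesis by blast
  qed
  have WV: "W \<subseteq> V" using sub r(1) centre_in_ball[of _ "2 * r"] by force
  have csub: "cball z r \<subseteq> V" if "z \<in> W" for z
    using sub[OF that] r(1) by (auto simp: subset_iff)
  show "holo (ball z0 r) (\<lambda>z. k * conv V h bump r z)"
    unfolding conv_mult[symmetric]
    by (rule conv_holo[OF h wh test_functions_mult[OF bump_test_function C_k_const] r(1)])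
       (use csub in \<open>simp add: W_def\<close>)
  have W: "open W" "bounded W" by (auto simp: W_def)
  have hW: "integrable (lebesgue_on W) h"
    by (rule integrable_lebesgue_on_subset[OF V(1) W(1) WV h])
  have cG: "continuous_on UNIV G"
    unfolding G_def
    by (intro continuous_intros continuous_at_imp_continuous_on ballI has_derivative_continuous[OF conv_has_derivative[OF h bump_test_function r(1)]])
  have bG: "norm (G z) \<le> (1/r) ^ (2 * CARD('n)) * (\<integral>w. norm (h w) \<partial>lebesgue_on V)" for z
  proof -
    have "norm (conv V h bump r z) \<le> (\<integral>w. norm (h w) \<partial>lebesgue_on V)"
      unfolding conv_def
    proof (rule Bochner_Integration.integral_norm_bound_integral)
      show "norm (h w * bump ((1/r) *\<^sub>R (z - w))) \<le> norm (h w)" for w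
        unfolding norm_mult using mult_left_mono[OF norm_bump_le_1 norm_ge_zero[of "h w"]] by simp
    qed (use h conv_integrable_test[OF h bump_test_function] in auto)
    then show ?thesis unfolding G_def norm_mult using r(1)
      by (intro mult_mono) (auto simp: norm_power norm_divide)
  qed
  have Wm: "W \<in> lmeasurable" using W by (simp add: bounded_set_imp_lmeasurable borel_open)
  interpret W: finite_measure "lebesgue_on W" by (rule finite_measure_lebesgue_on[OF Wm])
  have iG: "integrable (lebesgue_on W) G"
    by (rule W.integrable_const_bound[OF AE_I2[OF bG] continuous_measurable_lebesgue_on[OF cG]])
  have "negligible {z \<in> W. G z - c * h z \<noteq> 0}"
  proof (rule AE_eq_0_if_weakly_0[OF W])
    show "integrable (lebesgue_on W) (\<lambda>z. G z - c * h z)" using iG hW by simp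
    fix \<phi> :: "complex^'n \<Rightarrow> real" and S
    assume \<phi>: "continuous_on UNIV \<phi>" "compact S" "S \<subseteq> W" "\<And>x. x \<notin> S \<Longrightarrow> \<phi> x = 0"
    define f where "f x = complex_of_real (\<phi> x)" for x
    have f: "continuous_on UNIV f" "\<And>x. x \<notin> S \<Longrightarrow> f x = 0"
      using \<phi>(1,4) by (auto simp: f_def intro: continuous_intros)
    obtain M where M': "M \<ge> 0" "\<And>x. norm (f x) \<le> M"
      by (rule continuous_compact_support_bounded[OF f(1) \<phi>(2) f(2)]) (assumption, rule that)
    define s where "s n = r / real (Suc n)" for n
    have s: "s n > 0" "s n \<le> r" for n using r(1) by (auto simp: s_def field_simps)
    have "s \<longlonglongrightarrow> 0" 
      unfolding s_def using tendsto_mult_right[OF LIMSEQ_inverse_real_of_nat, of r] by (simp add: divide_inverse mult.commute)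
    from conv_weak_limit[OF V h f(1) M'(2) _ s(1) this]
    have lim: "(\<lambda>n. \<integral>z. of_real ((1 / s n) ^ (2 * CARD('n))) * conv V h bump (s n) z * f z \<partial>lebesgue_on V)
        \<longlonglongrightarrow> c * (\<integral>z. h z * f z \<partial>lebesgue_on V)"
      using f(2) \<phi>(3) WV unfolding c_def by blast
    have const: "of_real ((1 / s n) ^ (2 * CARD('n))) * conv V h bump (s n) z * f z = G z * f z" for n z
    proof (cases "z \<in> W")
      case True
      have "of_real ((1 / s n) ^ (2 * CARD('n))) * conv V h bump (s n) z = G z"
        unfolding G_def by (rule conv_bump_radius_constant[OF h wh sub[OF True]]) (use s[of n] r(1) in auto)
      then show ?thesis by simp
    next
      case False
      then show ?thesis using f(2)[of z] \<phi>(3) by auto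
    qed
    have eq: "(\<integral>z. G z * f z \<partial>lebesgue_on V) = c * (\<integral>z. h z * f z \<partial>lebesgue_on V)"
      using lim unfolding const LIMSEQ_const_iff .
    have z: "f z = 0" if "z \<notin> W" for z using that f(2) \<phi>(3) by blast
    have VW: "(\<integral>z. g z * f z \<partial>lebesgue_on V) = (\<integral>z. g z * f z \<partial>lebesgue_on W)" for g :: "complex^'n \<Rightarrow> complex"
      by (rule integral_lebesgue_on_zero_outside[OF V(1) W(1) WV]) (simp add: z)
    have fm: "f \<in> borel_measurable (lebesgue_on W)" by (rule continuous_measurable_lebesgue_on[OF f(1)])
    have prod: "integrable (lebesgue_on W) (\<lambda>z. g z * f z)" if "integrable (lebesgue_on W) g" for g
      by (rule integrable_mult_bounded[OF that fm M'(2)])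
    have "(\<integral>z. (G z - c * h z) * f z \<partial>lebesgue_on W) = (\<integral>z. G z * f z - c * (h z * f z) \<partial>lebesgue_on W)"
      by (simp add: left_diff_distrib mult.assoc)
    also have "\<dots> = (\<integral>z. G z * f z \<partial>lebesgue_on W) - c * (\<integral>z. h z * f z \<partial>lebesgue_on W)"
      using prod[OF iG] prod[OF hW] by simp
    also have "\<dots> = 0" using eq by (simp add: VW)
    finally show "(\<integral>z. (G z - c * h z) * complex_of_real (\<phi> z) \<partial>lebesgue_on W) = 0" by (simp only: f_def)
  qed
  then show "negligible {z \<in> ball z0 r. G z \<noteq> (\<integral>y. bump (y :: complex^'n) \<partial>lborel) * h z}"
    by (simp add: W_def c_def)
qed

text \<open>
  The local representatives of \<open>weyl_local\<close> fit together if at each \<open>z\<close> the mollification of radius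
  half the distance to the complement is taken: near a given point this is the mollification of a
  fixed radius.
\<close>

lemma weyl_lemma:
  fixes h :: "complex^'n \<Rightarrow> complex"
  assumes V: "open V" "bounded V" and h: "h \<in> L2 V" and wh: "weakly_holo V h"
  obtains H where "holo V H" "negligible {z \<in> V. h z \<noteq> H z}"
proof -
  have ih: "integrable (lebesgue_on V) h" by (rule L2_integrable[OF V h])
  define c where "c = (\<integral>y. bump (y :: complex^'n) \<partial>lborel)"
  have c: "c \<noteq> 0" unfolding c_def by (rule bump_integral_nonzero)
  define N where "N s z = of_real ((1/s) ^ (2 * CARD('n))) * conv V h bump s z" for s z
  define H where "H z = N (infdist z (- V) / 2) z / c" for z
  \<comment> \<open>a third of the distance to the complement leaves room for the radius \<open>infdist z (- V) / 2\<close> at all nearby \<open>z\<close>\<close>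
  have loc: "\<exists>r>0. ball z0 r \<subseteq> V \<and> holo (ball z0 r) (\<lambda>z. N r z / c) \<and> (\<forall>z\<in>ball z0 r. H z = N r z / c) \<and>
      negligible {z \<in> ball z0 r. N r z \<noteq> c * h z}" if z0: "z0 \<in> V" for z0
  proof -
    have ne: "- V \<noteq> {}"
    proof
      assume "- V = {}"
      then have "V = UNIV" by blast
      with V(2) not_bounded_UNIV show False by metis
    qed
    have cl: "closed (- V)" using V(1) by (rule closed_Compl)
    have bd: "ball z (infdist z (- V)) \<subseteq> V" for z
    proof
      fix x assume x: "x \<in> ball z (infdist z (- V))"
      show "x \<in> V"
      proof (rule ccontr)
        assume "x \<notin> V"
        then have "infdist z (- V) \<le> dist z x" by (intro infdist_le) simp
        with x show False by simp
      qed
    qed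
    define r where "r = infdist z0 (- V) / 3"
    have r: "r > 0" unfolding r_def using infdist_pos_not_in_closed[OF cl ne] z0 by simp
    have sub: "ball z0 (3 * r) \<subseteq> V" using bd[of z0] by (simp add: r_def)
    note w = weyl_local[OF V ih wh r sub]
    have "H z = N r z / c" if z: "z \<in> ball z0 r" for z
    proof -
      have "3 * r \<le> infdist z (- V) + dist z0 z"
        using infdist_triangle[of z0 "- V" z] by (simp add: r_def)
      then have d: "2 * r \<le> infdist z (- V)" using z by simp
      have "N (infdist z (- V) / 2) z = N r z"
        unfolding N_def by (rule conv_bump_radius_constant[OF ih wh bd[of z]]) (use d r in auto)
      then show ?thesis by (simp add: H_def)
    qed
    moreover have "holo (ball z0 r) (\<lambda>z. N r z / c)"
      using w(1)[of "of_real ((1/r) ^ (2 * CARD('n))) / c"] by (simp add: N_def)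
    moreover have "negligible {z \<in> ball z0 r. N r z \<noteq> c * h z}"
      using w(2) unfolding N_def c_def .
    moreover have "ball z0 r \<subseteq> V" using sub r by (auto simp: subset_iff)
    ultimately show ?thesis using r by blast
  qed
  show ?thesis
  proof (rule that)
    show "holo V H"
    proof (rule holo_locally)
      fix z0 assume "z0 \<in> V"
      from loc[OF this] obtain r where r: "r > 0" "holo (ball z0 r) (\<lambda>z. N r z / c)" "\<forall>z\<in>ball z0 r. H z = N r z / c" by blast
      show "\<exists>W G. open W \<and> z0 \<in> W \<and> holo W G \<and> (\<forall>z\<in>W. H z = G z)"
        by (rule exI[of _ "ball z0 r"], rule exI[of _ "\<lambda>z. N r z / c"]) (use r in simp)
    qed
    show "negligible {z \<in> V. h z \<noteq> H z}"
    proof (rule locally_negligible_alt[THEN iffD2], rule ballI)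
      fix z0 assume z0: "z0 \<in> {z \<in> V. h z \<noteq> H z}"
      then have "z0 \<in> V" by simp
      from loc[OF this] obtain r where r: "r > 0" "\<forall>z\<in>ball z0 r. H z = N r z / c"
        "negligible {z \<in> ball z0 r. N r z \<noteq> c * h z}" by blast
      have "openin (top_of_set {z \<in> V. h z \<noteq> H z}) ({z \<in> V. h z \<noteq> H z} \<inter> ball z0 r)"
        by (rule openin_open_Int) simp
      moreover have "negligible ({z \<in> V. h z \<noteq> H z} \<inter> ball z0 r)"
        by (rule negligible_subset[OF r(3)]) (use r(2) c in auto)
      ultimately show "\<exists>U. openin (top_of_set {z \<in> V. h z \<noteq> H z}) U \<and> z0 \<in> U \<and> negligible U"
        using z0 r(1) by (intro exI[of _ "{z \<in> V. h z \<noteq> H z} \<inter> ball z0 r"]) simp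
    qed
  qed
qed

section \<open>The identity theorem and the locality of the equation\<close>

lemma bounded_linear_vec_scale_left: "bounded_linear (\<lambda>t. t *s v)" for v :: "complex^'n"
proof -
  have "linear (\<lambda>t. t *s v)" by (rule linearI) (auto simp: vec_eq_iff algebra_simps)
  then show ?thesis by (simp add: linear_conv_bounded_linear)
qed

lemma holo_slice:
  assumes V: "holo V H"
  shows "(\<lambda>t. H (w + t *s v)) holomorphic_on {t. w + t *s v \<in> V}"
proof (rule holomorphic_onI)
  fix t assume "t \<in> {t. w + t *s v \<in> V}"
  then have t: "w + t *s v \<in> V" by simp
  from V obtain H' where "holo_deriv V H H'" unfolding holo_def by blast
  note H' = holo_derivD[OF this]
  have "((\<lambda>t. w + t *s v) has_derivative (\<lambda>s. 0 + s *s v)) (at t)"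
    by (intro has_derivative_add has_derivative_const bounded_linear_imp_has_derivative bounded_linear_vec_scale_left)
  from has_derivative_compose[OF this H'(1)[OF t]]
  have "((\<lambda>t. H (w + t *s v)) has_derivative (\<lambda>s. H' (w + t *s v) (s *s v))) (at t)" by simp
  also have "(\<lambda>s. H' (w + t *s v) (s *s v)) = (\<lambda>s. H' (w + t *s v) v * s)"
    using dbar_part_0_scale[OF has_derivative_linear[OF H'(1)[OF t]] H'(3)[OF t]] by (auto simp: mult.commute)
  finally have "((\<lambda>t. H (w + t *s v)) has_field_derivative H' (w + t *s v) v) (at t)"
    unfolding has_field_derivative_def .
  then show "(\<lambda>t. H (w + t *s v)) field_differentiable at t within {t. w + t *s v \<in> V}"
    unfolding field_differentiable_def by (blast intro: DERIV_subset has_field_derivative_at_within)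
qed

lemma holo_subset: "holo V H \<Longrightarrow> W \<subseteq> V \<Longrightarrow> holo W H"
  unfolding holo_def holo_deriv_def by (meson continuous_on_subset subsetD)

text \<open>
  The interior of the zero set is closed in \<open>V\<close>: a ball around one of its limit points meets it in
  some \<open>w\<close>, and the identity theorem in one variable on the complex line through \<open>w\<close> and any other
  point \<open>p\<close> of the ball shows that \<open>H p = 0\<close>.
\<close>

lemma holo_identity:
  fixes H :: "complex^'n \<Rightarrow> complex"
  assumes V: "open V" "connected V" and H: "holo V H"
    and U: "open U" "U \<noteq> {}" "U \<subseteq> V" and z: "\<And>z. z \<in> U \<Longrightarrow> H z = 0" and p: "p \<in> V"
  shows "H p = 0"
proof -
  define Z where "Z = interior {z \<in> V. H z = 0}"
  have UZ: "U \<subseteq> Z" unfolding Z_def using U z by (intro interior_maximal) auto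
  have ZV: "Z \<subseteq> V" unfolding Z_def using interior_subset by blast
  have Z0: "H z = 0" if "z \<in> Z" for z using that interior_subset unfolding Z_def by blast
  have oZ: "open Z" by (simp add: Z_def)
  have clZ: "z0 \<in> Z" if z0: "z0 \<in> V" "z0 \<in> closure Z" for z0
  proof -
    obtain r where r: "r > 0" "ball z0 r \<subseteq> V" using V(1) z0(1) open_contains_ball by blast
    have "Z \<inter> ball z0 r \<noteq> {}"
      using z0(2) r(1) open_Int_closure_eq_empty[of "ball z0 r" Z] centre_in_ball[of z0 r] by blast
    then obtain w where w: "w \<in> Z" "w \<in> ball z0 r" by blast
    have "H p = 0" if p: "p \<in> ball z0 r" for p
    proof -
      define T where "T = {t. w + t *s (p - w) \<in> ball z0 r}"
      define S where "S = {t. w + t *s (p - w) \<in> Z \<inter> ball z0 r}"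
      have ct: "continuous_on UNIV (\<lambda>t. w + t *s (p - w))"
        by (intro continuous_intros linear_continuous_on bounded_linear_vec_scale_left)
      have oT: "open T" unfolding T_def using open_vimage[OF open_ball ct] by (simp add: vimage_def)
      have oS: "open S" unfolding S_def using open_vimage[OF open_Int[OF oZ open_ball] ct] by (simp add: vimage_def)
      have "convex T"
      proof (rule convexI)
        fix x y u v assume *: "x \<in> T" "y \<in> T" "0 \<le> u" "0 \<le> v" "u + v = (1::real)"
        have "w + (u *\<^sub>R x + v *\<^sub>R y) *s (p - w) = u *\<^sub>R (w + x *s (p - w)) + v *\<^sub>R (w + y *s (p - w))"
        proof -
          have "w = u *\<^sub>R w + v *\<^sub>R w" using *(5) by (simp flip: scaleR_add_left)
          moreover have "(u *\<^sub>R x + v *\<^sub>R y) *s (p - w) = u *\<^sub>R (x *s (p - w)) + v *\<^sub>R (y *s (p - w))"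
            by (auto simp: vec_eq_iff algebra_simps)
          ultimately show ?thesis by (simp add: scaleR_add_right)
        qed
        also have "\<dots> \<in> ball z0 r"
          using * by (intro convexD[OF convex_ball]) (auto simp: T_def)
        finally show "u *\<^sub>R x + v *\<^sub>R y \<in> T" by (simp add: T_def)
      qed
      then have cT: "connected T" by (rule convex_connected)
      have hT: "(\<lambda>t. H (w + t *s (p - w))) holomorphic_on T"
        unfolding T_def by (rule holo_slice[OF holo_subset[OF H r(2)]])
      have "(\<lambda>t. H (w + t *s (p - w))) 1 = (\<lambda>_. 0) (1::complex)"
      proof (rule analytic_continuation_open[OF oS oT _ cT _ hT])
        have "0 \<in> S" using w by (simp add: S_def)
        then show "S \<noteq> {}" by blast
        show "S \<subseteq> T" by (auto simp: S_def T_def)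
        show "H (w + t *s (p - w)) = 0" if "t \<in> S" for t using that by (intro Z0) (simp add: S_def)
        show "1 \<in> T" using p by (simp add: T_def)
      qed auto
      then show ?thesis by simp
    qed
    then have "ball z0 r \<subseteq> Z" unfolding Z_def using r(2) by (intro interior_maximal) auto
    then show ?thesis using r(1) by auto
  qed
  have "V \<subseteq> Z"
  proof (rule ccontr)
    assume n: "\<not> V \<subseteq> Z"
    have "Z \<inter> V = {} \<or> - closure Z \<inter> V = {}"
    proof (rule connectedD[OF V(2) oZ])
      show "open (- closure Z)" by (rule open_Compl[OF closed_closure])
      show "Z \<inter> - closure Z \<inter> V = {}" using closure_subset[of Z] by blast
      show "V \<subseteq> Z \<union> - closure Z" using clZ by blast
    qed
    then show False using n UZ U clZ ZV by blast
  qed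
  then show ?thesis using p Z0 by blast
qed

lemma test_functions_mono: "U \<subseteq> V \<Longrightarrow> \<phi> \<in> test_functions U \<Longrightarrow> \<phi> \<in> test_functions V"
  by (rule test_functionsI[OF test_functions_smooth test_functionsD(2) order_trans[OF test_functions_support] test_functionsD(3)])

text \<open>
  The part of the support outside \<open>V\<close> is a compact subset of \<open>U\<close>; multiply by a cutoff that is \<open>1\<close>
  near it.
\<close>

lemma test_functions_split:
  fixes \<phi> :: "'a::euclidean_space \<Rightarrow> complex"
  assumes U: "open U" and V: "open V" and \<phi>: "\<phi> \<in> test_functions (U \<union> V)"
  obtains \<phi>1 \<phi>2 where "\<phi>1 \<in> test_functions U" "\<phi>2 \<in> test_functions V" "\<And>x. \<phi> x = \<phi>1 x + \<phi>2 x"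
proof -
  define S where "S = closure {x. \<phi> x \<noteq> 0}"
  have S: "compact S" "S \<subseteq> U \<union> V"
    unfolding S_def by (rule test_functionsD(2)[OF \<phi>] test_functions_support[OF \<phi>])+
  have S0: "\<phi> x = 0" if "x \<notin> S" for x using test_functionsD(3)[OF \<phi>] that unfolding S_def .
  have C: "compact (S - V)" "S - V \<subseteq> U" using S V by (auto intro: compact_diff)
  obtain \<eta> :: "'a \<Rightarrow> real" and W where \<eta>: "\<And>k. C_k k \<eta>" "\<And>x. 0 \<le> \<eta> x" "\<And>x. \<eta> x \<le> 1"
    "compact (closure {x. \<eta> x \<noteq> 0})" "closure {x. \<eta> x \<noteq> 0} \<subseteq> U"
    "open W" "S - V \<subseteq> W" "\<And>x. x \<in> W \<Longrightarrow> \<eta> x = 1"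
    by (rule smooth_urysohn[OF C(1) U C(2)]) (rule that)
  have c\<eta>: "C_k k (\<lambda>x. complex_of_real (\<eta> x))" for k
    by (rule C_k_linear_compose[OF bounded_linear_of_real \<eta>(1)])
  have c\<phi>: "C_k k \<phi>" for k by (rule test_functions_smooth[OF \<phi>])
  show ?thesis
  proof (rule that)
    show "(\<lambda>x. complex_of_real (\<eta> x) * \<phi> x) \<in> test_functions U"
    proof (rule test_functionsI[OF _ \<eta>(4,5)])
      show "C_k k (\<lambda>x. complex_of_real (\<eta> x) * \<phi> x)" for k by (intro C_k_mult c\<eta> c\<phi>)
      show "complex_of_real (\<eta> x) * \<phi> x = 0" if "x \<notin> closure {x. \<eta> x \<noteq> 0}" for x
        using that closure_subset[of "{x. \<eta> x \<noteq> 0}"] by auto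
    qed
    show "(\<lambda>x. (1 + (-1) * complex_of_real (\<eta> x)) * \<phi> x) \<in> test_functions V"
    proof (rule test_functionsI)
      show "C_k k (\<lambda>x. (1 + (-1) * complex_of_real (\<eta> x)) * \<phi> x)" for k
        by (intro C_k_mult C_k_add C_k_const c\<eta> c\<phi>)
      show "compact (S - W)" by (rule compact_diff[OF S(1) \<eta>(6)])
      show "S - W \<subseteq> V" using \<eta>(7) by blast
      show "(1 + (-1) * complex_of_real (\<eta> x)) * \<phi> x = 0" if "x \<notin> S - W" for x
        using that S0[of x] \<eta>(8)[of x] by auto
    qed
    show "\<phi> x = complex_of_real (\<eta> x) * \<phi> x + (1 + (-1) * complex_of_real (\<eta> x)) * \<phi> x" for x
      by (simp add: algebra_simps)
  qed
qed

lemma L2_subset: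
  assumes "open V" "open W" "W \<subseteq> V" "f \<in> L2 V"
  shows "f \<in> L2 W"
proof -
  have f: "f \<in> borel_measurable (lebesgue_on V)" "integrable (lebesgue_on V) (\<lambda>x. (norm (f x))\<^sup>2)"
    using assms(4) unfolding L2_def by blast+
  show ?thesis
    unfolding L2_def mem_Collect_eq
    by (intro conjI measurable_restrict_mono[OF f(1) assms(3)] integrable_lebesgue_on_subset[OF assms(1-3) f(2)])
qed

lemma test_pairing_subset:
  assumes "open V" "open W" "W \<subseteq> V" "\<phi> \<in> test_functions W"
  shows "(\<integral>z. g z * \<phi> z \<partial>lebesgue_on V) = (\<integral>z. g z * \<phi> z \<partial>lebesgue_on W)"
  by (rule integral_lebesgue_on_zero_outside[OF assms(1-3)]) (simp add: test_functions_zero[OF assms(4)])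

lemma distr_wirtinger_bar_subset:
  assumes "open V" "open W" "W \<subseteq> V" "\<phi> \<in> test_functions W"
  shows "distr_wirtinger_bar V j g \<phi> = distr_wirtinger_bar W j g \<phi>"
  unfolding distr_wirtinger_bar_def
  by (simp only: test_pairing_subset[OF assms(1-3) test_functions_wirtinger_bar[OF assms(4)]])

lemma dbar_eq_subset:
  assumes "open V" "open W" "W \<subseteq> V" "dbar_eq V g f"
  shows "dbar_eq W g f"
  unfolding dbar_eq_def
proof (intro allI ballI)
  fix j \<phi> assume \<phi>: "\<phi> \<in> test_functions W"
  have "distr_wirtinger_bar V j g \<phi> = (\<integral>z. f z $ j * \<phi> z \<partial>lebesgue_on V)"
    using assms(4) test_functions_mono[OF assms(3) \<phi>] unfolding dbar_eq_def by blast
  then show "distr_wirtinger_bar W j g \<phi> = (\<integral>z. f z $ j * \<phi> z \<partial>lebesgue_on W)"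
    by (simp only: distr_wirtinger_bar_subset[OF assms(1-3) \<phi>] test_pairing_subset[OF assms(1-3) \<phi>])
qed

lemma L2_cocycles_subset:
  assumes "open V" "open W" "W \<subseteq> V" "f \<in> L2_cocycles V"
  shows "f \<in> L2_cocycles W"
proof -
  have "dbar_closed W f"
    unfolding dbar_closed_def
  proof (intro allI ballI)
    fix j k \<phi> assume \<phi>: "\<phi> \<in> test_functions W"
    have "dbar_closed V f" using assms(4) by (simp add: L2_cocycles_def)
    then have "distr_wirtinger_bar V j (\<lambda>z. f z $ k) \<phi> - distr_wirtinger_bar V k (\<lambda>z. f z $ j) \<phi> = 0"
      using test_functions_mono[OF assms(3) \<phi>] unfolding dbar_closed_def by blast
    then show "distr_wirtinger_bar W j (\<lambda>z. f z $ k) \<phi> - distr_wirtinger_bar W k (\<lambda>z. f z $ j) \<phi> = 0"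
      by (simp only: distr_wirtinger_bar_subset[OF assms(1-3) \<phi>])
  qed
  moreover have "f \<in> L2 V" using assms(4) by (simp add: L2_cocycles_def)
  from L2_subset[OF assms(1-3) this] have "f \<in> L2 W" .
  ultimately show ?thesis by (simp add: L2_cocycles_def)
qed

lemma test_pairing_integrable:
  assumes "open V" "g \<in> L2 V" "\<phi> \<in> test_functions V"
  shows "integrable (lebesgue_on V) (\<lambda>z. g z * \<phi> z)"
  by (rule test_function_integrable[OF test_functionsD[OF assms(3)] assms(1,2)])

lemma wirtinger_bar_add:
  assumes "\<phi> \<in> test_functions U" "\<psi> \<in> test_functions V"
  shows "wirtinger_bar j (\<lambda>z. \<phi> z + \<psi> z) z = wirtinger_bar j \<phi> z + wirtinger_bar j \<psi> z"
proof -
  have "fderiv (\<lambda>z. \<phi> z + \<psi> z) z = (\<lambda>v. fderiv \<phi> z v + fderiv \<psi> z v)"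
    by (rule frechet_derivative_at[symmetric])
       (intro has_derivative_add test_functions_has_derivative(1)[OF assms(1)] test_functions_has_derivative(1)[OF assms(2)])
  then show ?thesis by (simp add: wirtinger_bar_def field_simps)
qed

lemma dbar_eq_Un:
  assumes U: "open U" and V: "open V" and g: "g \<in> L2 (U \<union> V)" and f: "f \<in> L2 (U \<union> V)"
    and gU: "dbar_eq U g f" and gV: "dbar_eq V g f"
  shows "dbar_eq (U \<union> V) g f"
  unfolding dbar_eq_def
proof (intro allI ballI)
  fix j \<phi> assume \<phi>: "\<phi> \<in> test_functions (U \<union> V)"
  have UV: "open (U \<union> V)" using U V by blast
  obtain \<phi>1 \<phi>2 where t: "\<phi>1 \<in> test_functions U" "\<phi>2 \<in> test_functions V" and \<phi>_eq: "\<And>x. \<phi> x = \<phi>1 x + \<phi>2 x"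
    by (rule test_functions_split[OF U V \<phi>]) (rule that)
  have t': "\<phi>1 \<in> test_functions (U \<union> V)" "\<phi>2 \<in> test_functions (U \<union> V)"
    using test_functions_mono[OF _ t(1), of "U \<union> V"] test_functions_mono[OF _ t(2), of "U \<union> V"] by simp_all
  have "\<phi> = (\<lambda>x. \<phi>1 x + \<phi>2 x)" using \<phi>_eq by blast
  then have w: "wirtinger_bar j \<phi> z = wirtinger_bar j \<phi>1 z + wirtinger_bar j \<phi>2 z" for z
    using wirtinger_bar_add[OF t] by simp
  have "distr_wirtinger_bar (U \<union> V) j g \<phi> = distr_wirtinger_bar (U \<union> V) j g \<phi>1 + distr_wirtinger_bar (U \<union> V) j g \<phi>2"
    unfolding distr_wirtinger_bar_def w distrib_left
    by (simp add: test_pairing_integrable[OF UV g] test_functions_wirtinger_bar t')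
  also have "\<dots> = distr_wirtinger_bar U j g \<phi>1 + distr_wirtinger_bar V j g \<phi>2"
    by (simp only: distr_wirtinger_bar_subset[OF UV U Un_upper1 t(1)] distr_wirtinger_bar_subset[OF UV V Un_upper2 t(2)])
  also have "\<dots> = (\<integral>z. f z $ j * \<phi>1 z \<partial>lebesgue_on U) + (\<integral>z. f z $ j * \<phi>2 z \<partial>lebesgue_on V)"
    using gU gV t unfolding dbar_eq_def by simp
  also have "\<dots> = (\<integral>z. f z $ j * \<phi>1 z \<partial>lebesgue_on (U \<union> V)) + (\<integral>z. f z $ j * \<phi>2 z \<partial>lebesgue_on (U \<union> V))"
    by (simp only: test_pairing_subset[OF UV U Un_upper1 t(1)] test_pairing_subset[OF UV V Un_upper2 t(2)])
  also have "\<dots> = (\<integral>z. f z $ j * \<phi> z \<partial>lebesgue_on (U \<union> V))"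
    unfolding \<phi>_eq distrib_left
    by (simp add: test_pairing_integrable[OF UV L2_component[OF f]] t')
  finally show "distr_wirtinger_bar (U \<union> V) j g \<phi> = (\<integral>z. f z $ j * \<phi> z \<partial>lebesgue_on (U \<union> V))" .
qed

lemma dbar_eq_finite_union:
  assumes "finite I" and "\<And>i. i \<in> I \<Longrightarrow> open (U i)"
    and "g \<in> L2 (\<Union>i\<in>I. U i)" "f \<in> L2 (\<Union>i\<in>I. U i)" and "\<And>i. i \<in> I \<Longrightarrow> dbar_eq (U i) g f"
  shows "dbar_eq (\<Union>i\<in>I. U i) g f"
  using assms
proof (induction I)
  case empty
  have "(\<integral>z. F z \<partial>lebesgue_on {}) = 0" for F :: "complex^'b \<Rightarrow> complex"
    by (simp add: integral_restrict_space)
  then show ?case by (simp add: dbar_eq_def distr_wirtinger_bar_def)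
next
  case (insert i I)
  have o: "open (\<Union>i\<in>I. U i)" "open (U i)" "open (\<Union>i\<in>insert i I. U i)" using insert.prems(1) by auto
  have "dbar_eq (U i \<union> (\<Union>i\<in>I. U i)) g f"
  proof (rule dbar_eq_Un[OF o(2,1)])
    show "dbar_eq (\<Union>i\<in>I. U i) g f"
    proof (rule insert.IH)
      show "g \<in> L2 (\<Union>i\<in>I. U i)" by (rule L2_subset[OF o(3,1) _ insert.prems(2)]) auto
      show "f \<in> L2 (\<Union>i\<in>I. U i)" by (rule L2_subset[OF o(3,1) _ insert.prems(3)]) auto
    qed (use insert.prems in auto)
  qed (use insert.prems in auto)
  then show ?case by simp
qed

lemma dbar_eq_diff:
  assumes U: "open U" and L: "g \<in> L2 U" "g' \<in> L2 U" "f \<in> L2 U" "f' \<in> L2 U"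
    and eq: "dbar_eq U g f" "dbar_eq U g' f'"
  shows "dbar_eq U (\<lambda>z. g z - g' z) (\<lambda>z. f z - f' z)"
  unfolding dbar_eq_def
proof (intro allI ballI)
  fix j \<phi> assume \<phi>: "\<phi> \<in> test_functions U"
  have "(\<integral>z. (f z - f' z) $ j * \<phi> z \<partial>lebesgue_on U) =
      (\<integral>z. f z $ j * \<phi> z \<partial>lebesgue_on U) - (\<integral>z. f' z $ j * \<phi> z \<partial>lebesgue_on U)"
    unfolding vector_minus_component left_diff_distrib
    by (rule Bochner_Integration.integral_diff) (intro test_pairing_integrable U L2_component L \<phi>)+
  then show "distr_wirtinger_bar U j (\<lambda>z. g z - g' z) \<phi> = (\<integral>z. (f z - f' z) $ j * \<phi> z \<partial>lebesgue_on U)"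
    using distr_wirtinger_bar_diff[OF U L(1,2) \<phi>] eq \<phi> by (simp add: dbar_eq_def)
qed

lemma dbar_eq_cong:
  assumes U: "open U" and L: "g \<in> L2 U" "g' \<in> L2 U" and eq: "negligible {z \<in> U. g z \<noteq> g' z}" and d: "dbar_eq U g f"
  shows "dbar_eq U g' f"
proof -
  have ae: "AE z in lebesgue_on U. g z = g' z" by (simp add: AE_lebesgue_on_iff_negligible[OF U] eq)
  have "distr_wirtinger_bar U j g' \<phi> = distr_wirtinger_bar U j g \<phi>" if \<phi>: "\<phi> \<in> test_functions U" for j \<phi>
    unfolding distr_wirtinger_bar_def neg_equal_iff_equal
  proof (rule integral_cong_AE)
    show "(\<lambda>z. g' z * wirtinger_bar j \<phi> z) \<in> borel_measurable (lebesgue_on U)"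
      "(\<lambda>z. g z * wirtinger_bar j \<phi> z) \<in> borel_measurable (lebesgue_on U)"
      by (rule borel_measurable_integrable[OF test_pairing_integrable[OF U _ test_functions_wirtinger_bar[OF \<phi>]]], rule L)+
    show "AE z in lebesgue_on U. g' z * wirtinger_bar j \<phi> z = g z * wirtinger_bar j \<phi> z"
      using ae by eventually_elim simp
  qed
  then show ?thesis using d unfolding dbar_eq_def by simp
qed

section \<open>The Cauchy transform in one variable\<close>

lemma has_vector_derivative_along_line:
  assumes "(f has_derivative D) (at (x + s *\<^sub>R v))"
  shows "((\<lambda>s. f (x + s *\<^sub>R v)) has_vector_derivative D v) (at s within S)"
proof -
  have "((\<lambda>s. x + s *\<^sub>R v) has_derivative (\<lambda>t. t *\<^sub>R v)) (at s within S)"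
    by (auto intro!: derivative_eq_intros)
  from has_derivative_compose[OF this assms]
  show ?thesis
    unfolding has_vector_derivative_def by (simp add: linear_scale[OF has_derivative_linear[OF assms]])
qed

text \<open>
  The increment of \<open>f\<close> in direction \<open>v\<close> is the integral of its \<open>v\<close>-derivative. Differentiating this
  identity in direction \<open>w\<close> under the integral sign, and then with respect to the upper limit, gives
  the symmetry.
\<close>

lemma second_derivative_symmetric:
  fixes f :: "'a::real_normed_vector \<Rightarrow> 'b::banach"
  assumes f: "C_k 2 f"
  shows "fderiv (\<lambda>x. fderiv f x v) x w =
    fderiv (\<lambda>x. fderiv f x w) x v"
proof -
  have C2: "C_k (Suc (Suc 0)) f" using f by (simp only: numeral_2_eq_2)
  have C1: "C_k (Suc 0) (\<lambda>x. fderiv f x u)" for u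
    using C2 unfolding C_k.simps(2)[of "Suc 0"] by blast
  have D: "(f has_derivative fderiv f y) (at y)" for y
    by (rule C_k_has_derivative[OF C2])
  define g where "g u y = fderiv f y u" for u y
  define h where "h u t y = fderiv (g u) y t" for u t y
  have g: "(g u has_derivative (\<lambda>t. h u t y)) (at y)" for u y
    using C_k_has_derivative[OF C1] unfolding g_def h_def .
  have ch: "continuous_on UNIV (h u t)" for u t
    using C1[of u] unfolding C_k.simps g_def h_def by blast
  have cg: "continuous_on UNIV (g u)" for u
    using g by (blast intro: continuous_at_imp_continuous_on has_derivative_continuous)
  have key: "g w (x + s *\<^sub>R v) - g w x = integral {0..s} (\<lambda>\<tau>. h v w (x + \<tau> *\<^sub>R v))" if s: "s \<ge> 0" for s
  proof -
    \<comment> \<open>the fundamental theorem along \<open>v\<close>, with the base point moved along \<open>w\<close>\<close>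
    have ftc: "integral {0..s} (\<lambda>\<tau>. g v ((x + t *\<^sub>R w) + \<tau> *\<^sub>R v)) = f ((x + t *\<^sub>R w) + s *\<^sub>R v) - f (x + t *\<^sub>R w)" for t
      using fundamental_theorem_of_calculus[OF s, of "\<lambda>\<tau>. f ((x + t *\<^sub>R w) + \<tau> *\<^sub>R v)" "\<lambda>\<tau>. g v ((x + t *\<^sub>R w) + \<tau> *\<^sub>R v)"]
        has_vector_derivative_along_line[OF D] unfolding g_def by (simp add: integral_unique)
    have "((\<lambda>t. integral (cbox 0 s) (\<lambda>\<tau>. g v ((x + \<tau> *\<^sub>R v) + t *\<^sub>R w))) has_vector_derivative
        integral (cbox 0 s) (\<lambda>\<tau>. h v w ((x + \<tau> *\<^sub>R v) + 0 *\<^sub>R w))) (at 0 within UNIV)"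
    proof (rule leibniz_rule_vector_derivative)
      show "((\<lambda>t. g v ((x + \<tau> *\<^sub>R v) + t *\<^sub>R w)) has_vector_derivative h v w ((x + \<tau> *\<^sub>R v) + t *\<^sub>R w)) (at t within UNIV)" for t \<tau>
        by (rule has_vector_derivative_along_line[OF g])
      show "(\<lambda>\<tau>. g v ((x + \<tau> *\<^sub>R v) + t *\<^sub>R w)) integrable_on cbox 0 s" for t
        by (intro integrable_continuous continuous_on_compose2[OF cg] continuous_intros) auto
      show "continuous_on (UNIV \<times> cbox 0 s) (\<lambda>(t, \<tau>). h v w ((x + \<tau> *\<^sub>R v) + t *\<^sub>R w))"
        unfolding case_prod_unfold by (intro continuous_on_compose2[OF ch] continuous_intros) auto
    qed auto
    then have "((\<lambda>t. f ((x + s *\<^sub>R v) + t *\<^sub>R w) - f (x + t *\<^sub>R w)) has_vector_derivative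
        integral {0..s} (\<lambda>\<tau>. h v w (x + \<tau> *\<^sub>R v))) (at 0)"
      using ftc by (simp add: add_ac)
    moreover have "((\<lambda>t. f ((x + s *\<^sub>R v) + t *\<^sub>R w) - f (x + t *\<^sub>R w)) has_vector_derivative
        g w ((x + s *\<^sub>R v) + 0 *\<^sub>R w) - g w (x + 0 *\<^sub>R w)) (at 0)"
      unfolding g_def by (intro has_vector_derivative_diff has_vector_derivative_along_line D)
    ultimately show ?thesis using vector_derivative_unique_at by fastforce
  qed
  have "((\<lambda>s. integral {0..s} (\<lambda>\<tau>. h v w (x + \<tau> *\<^sub>R v))) has_vector_derivative h v w (x + 0 *\<^sub>R v)) (at 0 within {0..1})"
    by (rule integral_has_vector_derivative) (auto intro!: continuous_on_compose2[OF ch] continuous_intros)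
  then have "((\<lambda>s. g w (x + s *\<^sub>R v) - g w x) has_vector_derivative h v w (x + 0 *\<^sub>R v)) (at 0 within {0..1})"
    by (rule has_vector_derivative_transform[rotated 2]) (auto simp: key)
  moreover have "((\<lambda>s. g w (x + s *\<^sub>R v) - g w x) has_vector_derivative h w v (x + 0 *\<^sub>R v) - 0) (at 0 within {0..1})"
    by (intro has_vector_derivative_diff has_vector_derivative_along_line[OF g] has_vector_derivative_const)
  ultimately have "h v w (x + 0 *\<^sub>R v) = h w v (x + 0 *\<^sub>R v) - 0"
    by (rule vector_derivative_unique_within_closed_interval[of 0 1 0, unfolded cbox_interval, rotated 2]) auto
  then show ?thesis by (simp add: h_def g_def[abs_def])
qed

lemma axis_real_linear:
  fixes D :: "complex^'n \<Rightarrow> complex"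
  assumes D: "linear D"
  shows "D (axis m c) = Re c *\<^sub>R D (axis m 1) + Im c *\<^sub>R D (axis m \<i>)"
proof -
  have "axis m c = Re c *\<^sub>R axis m 1 + Im c *\<^sub>R (axis m \<i> :: complex^'n)"
    by (auto simp: vec_eq_iff axis_def complex_eq_iff)
  then show ?thesis by (simp only: linear_add[OF D] linear_scale[OF D])
qed

definition polar :: "'n \<Rightarrow> real \<times> real \<Rightarrow> complex^'n" where
  "polar m t = axis m (of_real (fst t) * cis (snd t))"

text \<open>
  This is \<open>1/\<pi> \<integral> a(z - w e\<^sub>m)/w dA(w)\<close> over the disc of radius \<open>R\<close>: in polar coordinates the Jacobian
  \<open>r\<close> cancels the modulus of the kernel \<open>1/w\<close> and leaves the continuous factor \<open>cis (- \<theta>)\<close>.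
\<close>

definition cauchy_transform :: "'n \<Rightarrow> real \<Rightarrow> (complex^'n \<Rightarrow> complex) \<Rightarrow> complex^'n \<Rightarrow> complex" where
  "cauchy_transform m R a z =
     integral (cbox (0, 0) (R, 2 * pi)) (\<lambda>t. a (z - polar m t) * cis (- snd t)) / of_real pi"

lemma norm_axis: "norm (axis m c :: complex^'n) = norm c"
  by (simp add: norm_eq_sqrt_inner inner_axis_axis)

lemma bounded_linear_axis: "bounded_linear (axis m :: complex \<Rightarrow> complex^'n)"
proof -
  have "linear (axis m :: complex \<Rightarrow> complex^'n)" by (rule linearI) (auto simp: vec_eq_iff axis_def)
  then show ?thesis by (simp add: linear_conv_bounded_linear)
qed

lemma continuous_on_polar: "continuous_on S (polar m)"
  unfolding polar_def[abs_def]
  by (intro bounded_linear.continuous_on[OF bounded_linear_axis] continuous_intros)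

lemma cauchy_transform_has_derivative:
  fixes a :: "complex^'n \<Rightarrow> complex"
  assumes D: "\<And>x. (a has_derivative a' x) (at x)" and C: "\<And>v. continuous_on UNIV (\<lambda>x. a' x v)"
  shows "(cauchy_transform m R a has_derivative (\<lambda>v. cauchy_transform m R (\<lambda>y. a' y v) z)) (at z)"
    and "continuous_on UNIV (\<lambda>z. cauchy_transform m R (\<lambda>y. a' y v) z)"
proof -
  define B where "B = cbox (0, 0) (R, 2 * pi)"
  define fx where "fx z t = Blinfun (\<lambda>v. a' (z - polar m t) v * cis (- snd t))" for z t
  have fx: "blinfun_apply (fx z t) = (\<lambda>v. a' (z - polar m t) v * cis (- snd t))" for z t
    unfolding fx_def
    by (intro bounded_linear_Blinfun_apply bounded_linear_mult_const has_derivative_bounded_linear[OF D])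
  have ca: "continuous_on UNIV a" using D by (blast intro: continuous_at_imp_continuous_on has_derivative_continuous)
  have cpol: "continuous_on S (\<lambda>x. fst x - polar m (snd x))" for S :: "((complex^'n) \<times> real \<times> real) set"
    by (intro continuous_intros continuous_on_compose2[OF continuous_on_polar[of UNIV m]]) auto
  have cfx: "continuous_on (UNIV \<times> B) (\<lambda>(z, t). fx z t)"
    unfolding case_prod_unfold
    by (rule continuous_on_blinfun_componentwise, unfold fx)
       (intro continuous_intros continuous_on_compose2[OF C cpol] subset_UNIV)
  have leibniz: "((\<lambda>z. integral B (\<lambda>t. a (z - polar m t) * cis (- snd t))) has_derivative
      blinfun_apply (integral B (fx z))) (at z within UNIV)"
    unfolding B_def
  proof (rule leibniz_rule)
    show "((\<lambda>z. a (z - polar m t) * cis (- snd t)) has_derivative blinfun_apply (fx z t)) (at z within UNIV)" for z t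
    proof -
      have "((\<lambda>z. z - polar m t) has_derivative (\<lambda>v. v)) (at z)" by (auto intro!: derivative_eq_intros)
      from has_derivative_mult_left[OF has_derivative_compose[OF this D]] show ?thesis unfolding fx by simp
    qed
    show "(\<lambda>t. a (z - polar m t) * cis (- snd t)) integrable_on cbox (0, 0) (R, 2 * pi)" for z
      by (intro integrable_continuous continuous_intros continuous_on_compose2[OF ca] continuous_on_polar) auto
    show "continuous_on (UNIV \<times> cbox (0, 0) (R, 2 * pi)) (\<lambda>(z, t). fx z t)" using cfx unfolding B_def .
  qed auto
  have "blinfun_apply (integral B (fx z)) = (\<lambda>v. integral B (\<lambda>t. a' (z - polar m t) v * cis (- snd t)))"
  proof
    fix v
    have "continuous_on B (\<lambda>t. case (z, t) of (z, t) \<Rightarrow> fx z t)"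
      by (rule continuous_on_compose2[OF cfx]) (auto intro!: continuous_on_Pair continuous_on_const continuous_on_id)
    then have "continuous_on B (fx z)" by simp
    then have "fx z integrable_on B" unfolding B_def by (rule integrable_continuous)
    from blinfun_apply_integral[OF this]
    show "blinfun_apply (integral B (fx z)) v = integral B (\<lambda>t. a' (z - polar m t) v * cis (- snd t))" by (simp add: fx)
  qed
  with leibniz have "((\<lambda>z. integral B (\<lambda>t. a (z - polar m t) * cis (- snd t))) has_derivative
      (\<lambda>v. integral B (\<lambda>t. a' (z - polar m t) v * cis (- snd t)))) (at z)"
    by (simp only:)
  then have "((\<lambda>z. integral B (\<lambda>t. a (z - polar m t) * cis (- snd t)) / of_real pi) has_derivative
      (\<lambda>v. integral B (\<lambda>t. a' (z - polar m t) v * cis (- snd t)) / of_real pi)) (at z)"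
    by (rule bounded_linear.has_derivative[OF bounded_linear_divide])
  then show "(cauchy_transform m R a has_derivative (\<lambda>v. cauchy_transform m R (\<lambda>y. a' y v) z)) (at z)"
    unfolding cauchy_transform_def[abs_def] B_def .
  have "continuous_on UNIV (\<lambda>z. integral (cbox (0, 0) (R, 2 * pi)) (\<lambda>t. a' (z - polar m t) v * cis (- snd t)))"
    by (rule integral_continuous_on_param)
       (unfold case_prod_unfold, intro continuous_intros continuous_on_compose2[OF C cpol] subset_UNIV)
  then show "continuous_on UNIV (\<lambda>z. cauchy_transform m R (\<lambda>y. a' y v) z)"
    unfolding cauchy_transform_def by (intro continuous_intros) auto
qed

text \<open>
  With \<open>b(r, \<theta>) = a(z - r e\<^sup>i\<^sup>\<theta> e\<^sub>m)\<close> the chain rule gives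
  \<open>\<partial>\<^bold>-\<^sub>m a e\<^sup>-\<^sup>i\<^sup>\<theta> = - (\<partial>\<^sub>r b + (i/r) \<partial>\<^sub>\<theta> b)/2\<close>. The second term integrates to zero over a period of
  \<open>\<theta>\<close>, and the first one in \<open>r\<close> to the difference of \<open>0\<close> at \<open>r = R\<close> and \<open>a z\<close> at \<open>r = 0\<close>.
\<close>

lemma pompeiu:
  fixes a :: "complex^'n \<Rightarrow> complex"
  assumes D: "\<And>x. (a has_derivative a' x) (at x)" and C: "\<And>v. continuous_on UNIV (\<lambda>x. a' x v)"
    and T: "T > 0" "\<And>x. norm x \<ge> T \<Longrightarrow> a x = 0" and z: "norm z < T"
  shows "cauchy_transform m (2 * T) (\<lambda>y. dbar_part m (a' y)) z = a z"
proof -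
  define R where "R = 2 * T"
  define y where "y r \<theta> = z - polar m (r, \<theta>)" for r \<theta>
  define d1 where "d1 r \<theta> = a' (y r \<theta>) (axis m 1)" for r \<theta>
  define d2 where "d2 r \<theta> = a' (y r \<theta>) (axis m \<i>)" for r \<theta>
  define br where "br r \<theta> = - (of_real (cos \<theta>) * d1 r \<theta> + of_real (sin \<theta>) * d2 r \<theta>)" for r \<theta>
  define bt where "bt r \<theta> = - of_real r * (of_real (- sin \<theta>) * d1 r \<theta> + of_real (cos \<theta>) * d2 r \<theta>)" for r \<theta>
  define Q where "Q r \<theta> = dbar_part m (a' (y r \<theta>)) * cis (- \<theta>)" for r \<theta>
  have lin: "linear (a' x)" for x by (rule has_derivative_linear[OF D])
  have neg_axis: "a' x (- axis m c) = - (of_real (Re c) * a' x (axis m 1) + of_real (Im c) * a' x (axis m \<i>))" for x c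
    unfolding linear_neg[OF lin] axis_real_linear[OF lin, of x m c] by (simp add: scaleR_conv_of_real)
  have cy: "continuous_on S (\<lambda>p. y (fst p) (snd p))" for S
    unfolding y_def by (auto intro!: continuous_intros continuous_on_polar)
  have cd: "continuous_on S (\<lambda>p. d1 (fst p) (snd p))" "continuous_on S (\<lambda>p. d2 (fst p) (snd p))" for S
    unfolding d1_def d2_def by (intro continuous_on_compose2[OF C cy] subset_UNIV)+
  have cbr: "continuous_on S (\<lambda>(r, \<theta>). br r \<theta>)" for S
    unfolding br_def case_prod_unfold by (intro continuous_intros cd)
  have cQ: "continuous_on S (\<lambda>(r, \<theta>). Q r \<theta>)" for S
    unfolding Q_def case_prod_unfold dbar_part_def d1_def[symmetric] d2_def[symmetric] by (intro continuous_intros cd) auto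
  have Dr: "((\<lambda>r. a (y r \<theta>)) has_vector_derivative br r \<theta>) (at r within S)" for r \<theta> S
  proof -
    have "((\<lambda>r. z - axis m (of_real r * cis \<theta>)) has_derivative (\<lambda>t. - axis m (of_real t * cis \<theta>))) (at r within S)"
      by (auto intro!: derivative_eq_intros bounded_linear.has_derivative[OF bounded_linear_axis])
    from has_derivative_compose[OF this D]
    have "((\<lambda>r. a (y r \<theta>)) has_derivative (\<lambda>t. a' (y r \<theta>) (- axis m (of_real t * cis \<theta>)))) (at r within S)"
      unfolding y_def polar_def by simp
    moreover have "a' (y r \<theta>) (- axis m (of_real t * cis \<theta>)) = t *\<^sub>R br r \<theta>" for t
      unfolding neg_axis br_def d1_def[symmetric] d2_def[symmetric] by (simp add: scaleR_conv_of_real algebra_simps)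
    ultimately show ?thesis unfolding has_vector_derivative_def by simp
  qed
  have Dt: "((\<lambda>\<theta>. a (y r \<theta>)) has_vector_derivative bt r \<theta>) (at \<theta> within S)" for r \<theta> S
  proof -
    have "((\<lambda>\<theta>. cis \<theta>) has_derivative (\<lambda>t. t *\<^sub>R (\<i> * cis \<theta>))) (at \<theta> within S)"
      by (rule has_derivative_cis[OF has_derivative_ident])
    then have "((\<lambda>\<theta>. z - axis m (of_real r * cis \<theta>)) has_derivative (\<lambda>t. - axis m (of_real r * (t *\<^sub>R (\<i> * cis \<theta>))))) (at \<theta> within S)"
      by (auto intro!: derivative_eq_intros bounded_linear.has_derivative[OF bounded_linear_axis])
    from has_derivative_compose[OF this D]
    have "((\<lambda>\<theta>. a (y r \<theta>)) has_derivative (\<lambda>t. a' (y r \<theta>) (- axis m (of_real r * (t *\<^sub>R (\<i> * cis \<theta>)))))) (at \<theta> within S)"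
      unfolding y_def polar_def by simp
    moreover have "a' (y r \<theta>) (- axis m (of_real r * (t *\<^sub>R (\<i> * cis \<theta>)))) = t *\<^sub>R bt r \<theta>" for t
      unfolding neg_axis bt_def d1_def[symmetric] d2_def[symmetric] by (simp add: scaleR_conv_of_real algebra_simps)
    ultimately show ?thesis unfolding has_vector_derivative_def by simp
  qed
  have pol: "of_real r * Q r \<theta> = - (1/2) * (of_real r * br r \<theta> + \<i> * bt r \<theta>)" for r \<theta>
    unfolding Q_def dbar_part_def d1_def[symmetric] d2_def[symmetric] br_def bt_def
    by (simp add: complex_eq_iff cis.simps field_simps)
  have int_theta: "integral {0..2*pi} (Q r) = - (1/2) * integral {0..2*pi} (br r)" if r: "r > 0" for r
  proof -
    have "(bt r has_integral a (y r (2*pi)) - a (y r 0)) {0..2*pi}"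
      by (rule fundamental_theorem_of_calculus) (auto intro: Dt)
    moreover have "y r (2*pi) = y r 0" by (simp add: y_def polar_def cis.code)
    ultimately have bt0: "(bt r has_integral 0) {0..2*pi}" by simp
    have "continuous_on {0..2*pi} (\<lambda>\<theta>. case (r, \<theta>) of (r, \<theta>) \<Rightarrow> br r \<theta>)"
      by (rule continuous_on_compose2[OF cbr[of UNIV]]) (auto intro!: continuous_on_Pair continuous_on_const continuous_on_id)
    then have "continuous_on {0..2*pi} (br r)" by simp
    then have br_i: "(br r has_integral integral {0..2*pi} (br r)) {0..2*pi}"
      by (intro integrable_integral integrable_continuous_interval)
    have sum: "((\<lambda>\<theta>. - (1/2) * (br r \<theta> + (\<i> / of_real r) * bt r \<theta>)) has_integral
        - (1/2) * (integral {0..2*pi} (br r) + (\<i> / of_real r) * 0)) {0..2*pi}"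
      by (intro has_integral_mult_right has_integral_add br_i bt0)
    have "Q r = (\<lambda>\<theta>. - (1/2) * (br r \<theta> + (\<i> / of_real r) * bt r \<theta>))"
    proof
      fix \<theta>
      have "of_real r * Q r \<theta> = of_real r * (- (1/2) * (br r \<theta> + (\<i> / of_real r) * bt r \<theta>))"
        using r by (subst pol) (simp add: algebra_simps)
      then show "Q r \<theta> = - (1/2) * (br r \<theta> + (\<i> / of_real r) * bt r \<theta>)"
        by (subst (asm) mult_left_cancel) (use r in auto)
    qed
    with sum have "(Q r has_integral - (1/2) * (integral {0..2*pi} (br r) + (\<i> / of_real r) * 0)) {0..2*pi}"
      by (simp only:)
    from integral_unique[OF this] show ?thesis by simp
  qed
  have "integral (cbox (0, 0) (R, 2 * pi)) (\<lambda>(r, \<theta>). Q r \<theta>) = integral (cbox 0 R) (\<lambda>r. integral (cbox 0 (2*pi)) (Q r))"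
    using integral_prod_continuous[OF cQ, of 0 0 R "2*pi"] by simp
  \<comment> \<open>the formula for the inner integral divides by \<open>r\<close> and so misses the null set \<open>{0}\<close>\<close>
  also have "\<dots> = integral (cbox 0 R) (\<lambda>r. - (1/2) * integral (cbox 0 (2*pi)) (br r))"
    by (rule integral_spike[of "{0}"]) (auto simp: int_theta)
  also have "\<dots> = - (1/2) * integral (cbox 0 R) (\<lambda>r. integral (cbox 0 (2*pi)) (br r))"
    by (rule integral_mult_right)
  also have "integral (cbox 0 R) (\<lambda>r. integral (cbox 0 (2*pi)) (br r)) =
      integral (cbox 0 (2*pi)) (\<lambda>\<theta>. integral (cbox 0 R) (\<lambda>r. br r \<theta>))"
    by (rule integral_swap_continuous[OF cbr])
  also have "\<dots> = integral (cbox 0 (2*pi)) (\<lambda>\<theta>. - a z)"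
  proof (rule Henstock_Kurzweil_Integration.integral_cong)
    fix \<theta>
    have R0: "0 \<le> R" using T(1) by (simp add: R_def)
    have "((\<lambda>r. br r \<theta>) has_integral a (y R \<theta>) - a (y 0 \<theta>)) {0..R}"
      by (rule fundamental_theorem_of_calculus[OF R0]) (rule Dr)
    moreover have "y 0 \<theta> = z" by (simp add: y_def polar_def axis_def vec_eq_iff)
    moreover have "a (y R \<theta>) = 0"
    proof (rule T(2))
      have "norm (polar m (R, \<theta>)) = R" using R0 by (simp add: polar_def norm_axis norm_mult)
      then have "R - norm z \<le> norm (y R \<theta>)"
        using norm_triangle_ineq2[of "polar m (R, \<theta>)" z] by (simp add: y_def norm_minus_commute)
      then show "T \<le> norm (y R \<theta>)" using z by (simp add: R_def)
    qed
    ultimately show "integral (cbox 0 R) (\<lambda>r. br r \<theta>) = - a z" by (simp add: integral_unique)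
  qed
  also have "\<dots> = - (of_real (2 * pi) * a z)" by (simp add: scaleR_conv_of_real)
  finally have "integral (cbox (0, 0) (R, 2 * pi)) (\<lambda>(r, \<theta>). Q r \<theta>) = of_real pi * a z" by simp
  moreover have "cauchy_transform m R (\<lambda>y. dbar_part m (a' y)) z = integral (cbox (0, 0) (R, 2 * pi)) (\<lambda>(r, \<theta>). Q r \<theta>) / of_real pi"
    unfolding cauchy_transform_def Q_def y_def case_prod_unfold by simp
  ultimately show ?thesis by (simp add: R_def)
qed

section \<open>Hartogs' extension theorem\<close>

lemma holo_diff:
  assumes "holo V F" "holo V G"
  shows "holo V (\<lambda>z. F z - G z)"
proof -
  obtain F' where "holo_deriv V F F'" using assms(1) unfolding holo_def by blast
  note F' = holo_derivD[OF this]
  obtain G' where "holo_deriv V G G'" using assms(2) unfolding holo_def by blast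
  note G' = holo_derivD[OF this]
  have "holo_deriv V (\<lambda>z. F z - G z) (\<lambda>z v. F' z v - G' z v)"
    unfolding holo_deriv_def
  proof (intro conjI ballI allI)
    show "((\<lambda>z. F z - G z) has_derivative (\<lambda>v. F' z v - G' z v)) (at z)" if "z \<in> V" for z
      by (rule has_derivative_diff[OF F'(1)[OF that] G'(1)[OF that]])
    show "continuous_on V (\<lambda>z. F' z v - G' z v)" for v by (intro continuous_on_diff F'(2) G'(2))
    show "dbar_part j (\<lambda>v. F' z v - G' z v) = 0" if "z \<in> V" for z j
    proof -
      have "dbar_part j (\<lambda>v. F' z v - G' z v) = dbar_part j (F' z) - dbar_part j (G' z)"
        by (simp add: dbar_part_def algebra_simps diff_divide_distrib add_divide_distrib)
      then show ?thesis by (simp add: F'(3)[OF that] G'(3)[OF that])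
    qed
  qed
  then show ?thesis unfolding holo_def by blast
qed

lemma wirtinger_bar_commute:
  fixes \<phi> :: "complex^'n \<Rightarrow> complex"
  assumes \<phi>: "\<phi> \<in> test_functions U"
  shows "wirtinger_bar j (wirtinger_bar m \<phi>) z = wirtinger_bar m (wirtinger_bar j \<phi>) z"
proof -
  define d where "d u x = fderiv \<phi> x u" for u x
  define dd where "dd u v = fderiv (d u) z v" for u v
  have D: "(d u has_derivative dd u) (at z)" for u
    using test_functions_has_derivative(1)[OF test_functions_derivative[OF \<phi>]] unfolding d_def dd_def .
  have sym: "dd u v = dd v u" for u v
    unfolding dd_def d_def by (rule second_derivative_symmetric) (rule test_functions_smooth[OF \<phi>])
  have W: "wirtinger_bar j (wirtinger_bar m \<phi>) z =
      ((dd (axis m 1) (axis j 1) + \<i> * dd (axis m \<i>) (axis j 1)) / 2 +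
       \<i> * ((dd (axis m 1) (axis j \<i>) + \<i> * dd (axis m \<i>) (axis j \<i>)) / 2)) / 2" for j m
  proof -
    have "((\<lambda>x. (d (axis m 1) x + \<i> * d (axis m \<i>) x) / 2) has_derivative
        (\<lambda>v. (dd (axis m 1) v + \<i> * dd (axis m \<i>) v) / 2)) (at z)"
      by (intro bounded_linear.has_derivative[OF bounded_linear_divide] has_derivative_add has_derivative_mult_right D)
    then have "fderiv (wirtinger_bar m \<phi>) z = (\<lambda>v. (dd (axis m 1) v + \<i> * dd (axis m \<i>) v) / 2)"
      unfolding wirtinger_bar_def[abs_def] d_def[symmetric] by (rule frechet_derivative_at[symmetric])
    then show ?thesis by (simp add: wirtinger_bar_eq[of j "wirtinger_bar m \<phi>"] dbar_part_def)
  qed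
  show ?thesis
    unfolding W sym[of "axis j 1" "axis m 1"] sym[of "axis j 1" "axis m \<i>"] sym[of "axis j \<i>" "axis m 1"] sym[of "axis j \<i>" "axis m \<i>"]
    by (simp add: field_simps)
qed

lemma wirtinger_bar_locally_const:
  assumes "open W" "x \<in> W" and c: "\<And>y. y \<in> W \<Longrightarrow> \<phi> y = c"
  shows "wirtinger_bar j \<phi> x = 0"
proof -
  have "((\<lambda>_. c) has_derivative (\<lambda>_. 0)) (at x)" by simp
  then have "(\<phi> has_derivative (\<lambda>_. 0)) (at x)"
    by (rule has_derivative_transform_within_open[OF _ assms(1,2)]) (simp add: c)
  then have "fderiv \<phi> x = (\<lambda>_. 0)" by (rule frechet_derivative_at[symmetric])
  then show ?thesis by (simp add: wirtinger_bar_def)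
qed

text \<open>
  Let \<open>\<phi>\<close> be a cutoff that is \<open>1\<close> near \<open>C\<close>. Then \<open>(1 - \<phi>) H\<close> makes sense on all of \<open>V\<close>, and
  \<open>\<partial>\<^bold>- ((1 - \<phi>) H) = - \<alpha>\<close> with the closed form \<open>\<alpha> = H \<partial>\<^bold>-\<phi>\<close>, whose support is compact. The Cauchy
  transform \<open>u\<close> of the coefficient \<open>\<alpha>\<^sub>m\<close> in the \<open>m\<close>-th variable satisfies \<open>\<partial>\<^bold>-u = \<alpha>\<close>, so
  \<open>G = (1 - \<phi>) H + u\<close> is holomorphic. Dimension at least two enters here: if \<open>k \<noteq> m\<close> and the \<open>k\<close>-th
  coordinate of \<open>z\<close> is beyond the support of \<open>\<phi>\<close>, then so is the complex line on which \<open>u z\<close> is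
  computed, whence \<open>u z = 0\<close> and \<open>G z = H z\<close>. The identity theorem does the rest.
\<close>

lemma hartogs_extension:
  fixes H :: "complex^'n \<Rightarrow> complex"
  assumes n: "CARD('n) \<ge> 2" and V: "open V" "bounded V" and C: "compact C" "C \<subseteq> V" "C \<noteq> {}"
    and con: "connected (V - C)" and H: "holo (V - C) H"
  obtains G where "holo V G" "\<And>z. z \<in> V - C \<Longrightarrow> G z = H z"
proof -
  obtain \<eta> :: "complex^'n \<Rightarrow> real" and W where \<eta>: "\<And>k. C_k k \<eta>" "\<And>x. 0 \<le> \<eta> x" "\<And>x. \<eta> x \<le> 1"
    "compact (closure {x. \<eta> x \<noteq> 0})" "closure {x. \<eta> x \<noteq> 0} \<subseteq> V"
    "open W" "C \<subseteq> W" "\<And>x. x \<in> W \<Longrightarrow> \<eta> x = 1"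
    by (rule smooth_urysohn[OF C(1) V(1) C(2)]) (rule that)
  define \<phi> where "\<phi> x = complex_of_real (\<eta> x)" for x
  define S where "S = closure {x. \<eta> x \<noteq> 0}"
  have S: "compact S" "S \<subseteq> V" using \<eta>(4,5) by (simp_all add: S_def)
  have \<phi>0: "\<phi> x = 0" if "x \<notin> S" for x
    using that closure_subset[of "{x. \<eta> x \<noteq> 0}"] by (auto simp: S_def \<phi>_def)
  have \<phi>1: "\<phi> x = 1" if "x \<in> W" for x using \<eta>(8)[OF that] by (simp add: \<phi>_def)
  have \<phi>: "\<phi> \<in> test_functions V"
  proof (rule test_functionsI[OF _ S \<phi>0])
    show "C_k k \<phi>" for k
      unfolding \<phi>_def[abs_def] by (rule C_k_linear_compose[OF bounded_linear_of_real \<eta>(1)])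
  qed
  note \<phi>D = test_functions_has_derivative[OF \<phi>]
  define w where "w j = wirtinger_bar j \<phi>" for j
  have w: "w j \<in> test_functions V" for j unfolding w_def by (rule test_functions_wirtinger_bar[OF \<phi>])
  note wD = test_functions_has_derivative[OF w]
  have w0: "w j x = 0" if "x \<notin> S" for j x
    unfolding w_def
    by (rule wirtinger_bar_locally_const[of "- S"]) (use compact_imp_closed[OF S(1)] that \<phi>0 in auto)
  have w1: "w j x = 0" if "x \<in> W" for j x
    unfolding w_def by (rule wirtinger_bar_locally_const[OF \<eta>(6) that \<phi>1])
  define U where "U = V - C"
  have U: "open U" unfolding U_def using V(1) compact_imp_closed[OF C(1)] by (rule open_Diff)
  have CS: "C \<subseteq> S" using \<phi>0 \<phi>1 \<eta>(7) by force
  obtain H' where "holo_deriv U H H'" using H unfolding holo_def U_def by blast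
  note H' = holo_derivD[OF this]
  have cH: "continuous_on U H" using H holo_continuous_on unfolding U_def by blast
  define w' where "w' j z = fderiv (w j) z" for j z
  define F' where "F' j z v = H z * w' j z v + H' z v * w j z" for j z v
  have F: "((\<lambda>z. H z * w j z) has_derivative F' j z) (at z)" if "z \<in> U" for j z
    unfolding F'_def w'_def by (rule has_derivative_mult[OF H'(1)[OF that] wD(1)])
  have cF: "continuous_on U (\<lambda>z. F' j z v)" for j v
    unfolding F'_def w'_def
    by (intro continuous_intros cH H'(2) continuous_on_subset[OF wD(2)] continuous_on_subset[OF test_functionsD(1)[OF w]]) auto
  have SW: "compact (S - W)" "S - W \<subseteq> U" using S \<eta>(6,7) by (auto simp: U_def intro: compact_diff)
  define a where "a j z = (if z \<in> U then H z * w j z else 0)" for j z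
  define a' where "a' j z = (if z \<in> U then F' j z else (\<lambda>_. 0))" for j z
  have Fz: "H z * w j z = 0" if "z \<in> U" "z \<notin> S - W" for j z
    using that w0[of z j] w1[of z j] by auto
  note ext = C1_extend_zero[OF U compact_imp_closed[OF SW(1)] SW(2) F cF Fz, folded a_def a'_def]
  have aD: "(a j has_derivative a' j z) (at z)" "continuous_on UNIV (\<lambda>z. a' j z v)" for j z v
    by (rule ext(1), assumption+) (rule ext(2), assumption+)
  have a0: "a j z = 0" if "z \<notin> S" for j z using w0[OF that] by (simp add: a_def)
  \<comment> \<open>\<open>\<alpha>\<close> is closed because \<open>H\<close> is holomorphic and the second derivatives of \<open>\<phi>\<close> commute\<close>
  have a_sym: "dbar_part j (a' m z) = dbar_part m (a' j z)" for j m z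
  proof (cases "z \<in> U")
    case True
    have "dbar_part j (F' m z) = H z * dbar_part j (w' m z) + dbar_part j (H' z) * w m z" for j m
      by (simp add: dbar_part_def F'_def field_simps)
    moreover have "dbar_part j (w' m z) = wirtinger_bar j (wirtinger_bar m \<phi>) z" for j m
      unfolding w'_def w_def by (rule wirtinger_bar_eq[symmetric])
    ultimately show ?thesis
      using True H'(3)[OF True] wirtinger_bar_commute[OF \<phi>, of j m z] by (simp add: a'_def)
  qed (simp add: a'_def dbar_part_def)
  obtain T where T: "T > 0" "\<And>x. x \<in> V \<Longrightarrow> norm x < T"
    using V(2) by (metis bounded_pos_less)
  obtain m k :: 'n where mk: "m \<noteq> k"
    using n card_le_Suc0_iff_eq[of "UNIV :: 'n set"] by (auto simp: numeral_2_eq_2 not_less_eq_eq[symmetric])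
  define u where "u = cauchy_transform m (2 * T) (a m)"
  define u' where "u' z v = cauchy_transform m (2 * T) (\<lambda>y. a' m y v) z" for z v
  have uD: "(u has_derivative u' z) (at z)" "continuous_on UNIV (\<lambda>z. u' z v)" for z v
    unfolding u_def u'_def
    by (rule cauchy_transform_has_derivative[where a="a m" and a'="a' m", OF aD])+
  have ub: "dbar_part j (u' z) = a j z" if z: "z \<in> V" for j z
  proof -
    have i: "(\<lambda>t. a' m (z - polar m t) v * cis (- snd t)) integrable_on cbox (0, 0) (2 * T, 2 * pi)" for v
      by (intro integrable_continuous continuous_intros continuous_on_compose2[OF aD(2)] continuous_on_polar) auto
    have "dbar_part j (u' z) = cauchy_transform m (2 * T) (\<lambda>y. dbar_part j (a' m y)) z"
    proof -
      have e: "(\<lambda>t. dbar_part j (a' m (z - polar m t)) * cis (- snd t)) = (\<lambda>t. 1/2 * (a' m (z - polar m t) (axis j 1) * cis (- snd t) +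
          \<i> * (a' m (z - polar m t) (axis j \<i>) * cis (- snd t))))"
        by (simp add: dbar_part_def fun_eq_iff field_simps)
      have "((\<lambda>t. 1/2 * (a' m (z - polar m t) (axis j 1) * cis (- snd t) + \<i> * (a' m (z - polar m t) (axis j \<i>) * cis (- snd t))))
          has_integral 1/2 * (integral (cbox (0, 0) (2 * T, 2 * pi)) (\<lambda>t. a' m (z - polar m t) (axis j 1) * cis (- snd t)) +
            \<i> * integral (cbox (0, 0) (2 * T, 2 * pi)) (\<lambda>t. a' m (z - polar m t) (axis j \<i>) * cis (- snd t))))
          (cbox (0, 0) (2 * T, 2 * pi))"
        by (intro has_integral_mult_right has_integral_add integrable_integral i)
      from integral_unique[OF this] show ?thesis
        unfolding u'_def cauchy_transform_def e by (simp add: dbar_part_def add_divide_distrib mult.commute[of "complex_of_real pi"])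
    qed
    also have "\<dots> = cauchy_transform m (2 * T) (\<lambda>y. dbar_part m (a' j y)) z" by (simp only: a_sym)
    also have "\<dots> = a j z"
    proof (rule pompeiu[OF aD T(1)])
      show "a j x = 0" if "norm x \<ge> T" for x
        using that T(2)[of x] S(2) by (intro a0) force
    qed (rule T(2)[OF z])
    finally show ?thesis .
  qed
  define G where "G z = (if z \<in> U then (1 - \<phi> z) * H z else 0) + u z" for z
  have hG: "holo V G"
  proof (rule holo_locally)
    fix z0 assume z0: "z0 \<in> V"
    show "\<exists>X F. open X \<and> z0 \<in> X \<and> holo X F \<and> (\<forall>z\<in>X. G z = F z)"
    proof (cases "z0 \<in> U")
      case True
      define P' where "P' z v = ((1 - \<phi> z) * H' z v + (0 - fderiv \<phi> z v) * H z) + u' z v" for z v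
      have "holo_deriv U (\<lambda>z. (1 - \<phi> z) * H z + u z) P'"
        unfolding holo_deriv_def
      proof (intro conjI ballI allI)
        show "((\<lambda>z. (1 - \<phi> z) * H z + u z) has_derivative P' z) (at z)" if "z \<in> U" for z
          unfolding P'_def
          by (intro has_derivative_add has_derivative_mult has_derivative_diff has_derivative_const \<phi>D(1) uD(1) H'(1) that)
        show "continuous_on U (\<lambda>z. P' z v)" for v
          unfolding P'_def
          by (intro continuous_intros H'(2) cH continuous_on_subset[OF \<phi>D(2)] continuous_on_subset[OF uD(2)]
              continuous_on_subset[OF test_functionsD(1)[OF \<phi>]]) auto
        show "dbar_part j (P' z) = 0" if z: "z \<in> U" for z j
        proof -
          have "dbar_part j (P' z) = (1 - \<phi> z) * dbar_part j (H' z) - dbar_part j (fderiv \<phi> z) * H z + dbar_part j (u' z)"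
            by (simp add: dbar_part_def P'_def field_simps)
          also have "\<dots> = - w j z * H z + a j z"
            using H'(3)[OF z] ub[of z j] z by (simp add: U_def w_def wirtinger_bar_eq)
          also have "\<dots> = 0" using z by (simp add: a_def)
          finally show ?thesis .
        qed
      qed
      then have "holo U (\<lambda>z. (1 - \<phi> z) * H z + u z)" unfolding holo_def by blast
      then show ?thesis
        by (intro exI[of _ U] exI[of _ "\<lambda>z. (1 - \<phi> z) * H z + u z"]) (simp add: U True G_def)
    next
      case False
      define X where "X = W \<inter> V"
      have "holo_deriv X u u'"
        unfolding holo_deriv_def
      proof (intro conjI ballI allI)
        show "(u has_derivative u' z) (at z)" for z by (rule uD(1))
        show "continuous_on X (\<lambda>z. u' z v)" for v by (rule continuous_on_subset[OF uD(2)]) simp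
        show "dbar_part j (u' z) = 0" if "z \<in> X" for z j
          using that ub[of z j] w1[of z j] by (simp add: X_def a_def)
      qed
      then have "holo X u" unfolding holo_def by blast
      moreover have "open X" "z0 \<in> X"
        using \<eta>(6,7) V(1) False z0 by (auto simp: X_def U_def)
      moreover have "G z = u z" if "z \<in> X" for z using \<phi>1[of z] that by (simp add: G_def X_def)
      ultimately show ?thesis by blast
    qed
  qed
  have Sne: "S \<noteq> {}" using CS C(3) by blast
  have "continuous_on S (\<lambda>x. Re (x $ k))" by (intro continuous_intros)
  from continuous_attains_sup[OF S(1) Sne this]
  obtain q where q: "q \<in> S" "\<And>x. x \<in> S \<Longrightarrow> Re (x $ k) \<le> Re (q $ k)" by blast
  \<comment> \<open>the part of \<open>V\<close> beyond the support of \<open>\<phi>\<close> in the \<open>k\<close>-th coordinate; it is not empty because \<open>V\<close> is a neighbourhood of \<open>q\<close>\<close>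
  define Y where "Y = {z. Re (q $ k) < Re (z $ k)} \<inter> V"
  have Y: "open Y"
    unfolding Y_def by (intro open_Int V(1) open_Collect_less continuous_intros)
  have Yne: "Y \<noteq> {}"
  proof -
    obtain e where e: "e > 0" "cball q e \<subseteq> V" using V(1) q(1) S(2) open_contains_cball by blast
    have "q + axis k (of_real e) \<in> cball q e" using e(1) by (simp add: dist_norm norm_axis)
    then have "q + axis k (of_real e) \<in> Y" using e by (auto simp: Y_def axis_def)
    then show ?thesis by blast
  qed
  have YS: "z \<notin> S" if "z \<in> Y" for z using q(2)[of z] that by (auto simp: Y_def)
  have YU: "Y \<subseteq> U" using YS CS by (auto simp: U_def Y_def)
  have GH: "G z - H z = 0" if z: "z \<in> Y" for z
  proof -
    have "a m (z - polar m t) = 0" for t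
    proof (rule a0)
      have "(z - polar m t) $ k = z $ k" using mk by (simp add: polar_def axis_def)
      then show "z - polar m t \<notin> S" using q(2)[of "z - polar m t"] z by (auto simp: Y_def)
    qed
    then have "u z = 0" by (simp add: u_def cauchy_transform_def)
    then show ?thesis using \<phi>0[OF YS[OF z]] YU z by (auto simp: G_def)
  qed
  have "G z = H z" if z: "z \<in> V - C" for z
    using holo_identity[OF U con[folded U_def] holo_diff[OF holo_subset[OF hG] H[folded U_def]] Y Yne YU GH z[folded U_def]]
    by (auto simp: U_def)
  with hG show ?thesis by (rule that)
qed

section \<open>Gluing of primitives\<close>

lemma L2_add: "f \<in> L2 U \<Longrightarrow> g \<in> L2 U \<Longrightarrow> (\<lambda>x. f x + g x) \<in> L2 U"
  using L2_diff[of f U "\<lambda>x. 0 - g x"] L2_diff[OF L2_zero, of g U] by simp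

lemma L2_sum: "(\<And>i. i \<in> I \<Longrightarrow> f i \<in> L2 U) \<Longrightarrow> (\<lambda>x. \<Sum>i\<in>I. f i x) \<in> L2 U"
  by (induction I rule: infinite_finite_induct) (simp_all add: L2_zero L2_add)

lemma L2_indicator:
  fixes g :: "'a::euclidean_space \<Rightarrow> 'b::euclidean_space"
  assumes V: "open V" and U: "open U" and D: "D \<in> sets lebesgue" "D \<subseteq> U" "D \<subseteq> V" and g: "g \<in> L2 U"
  shows "(\<lambda>x. indicator D x *\<^sub>R g x) \<in> L2 V"
proof -
  have m: "V \<in> sets lebesgue" "U \<in> sets lebesgue" using U V by (auto simp: borel_open)
  have gU: "g \<in> borel_measurable (lebesgue_on U)" "integrable (lebesgue_on U) (\<lambda>x. (norm (g x))\<^sup>2)"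
    using g unfolding L2_def by blast+
  have gm: "(\<lambda>x. indicator U x *\<^sub>R g x) \<in> borel_measurable lebesgue"
    using gU(1) m(2) by (subst (asm) borel_measurable_restrict_space_iff) auto
  have "(\<lambda>x. indicator D x *\<^sub>R (indicator U x *\<^sub>R g x)) \<in> borel_measurable lebesgue"
    by (rule borel_measurable_scaleR[OF borel_measurable_indicator[OF D(1)] gm])
  also have "(\<lambda>x. indicator D x *\<^sub>R (indicator U x *\<^sub>R g x)) = (\<lambda>x. indicator V x *\<^sub>R (indicator D x *\<^sub>R g x))"
    using D by (intro ext) (auto split: split_indicator)
  finally have meas: "(\<lambda>x. indicator D x *\<^sub>R g x) \<in> borel_measurable (lebesgue_on V)"
    using m(1) by (subst borel_measurable_restrict_space_iff) auto
  have "integrable lebesgue (\<lambda>x. indicator U x *\<^sub>R (norm (g x))\<^sup>2)"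
    using gU(2) m(2) by (subst (asm) integrable_restrict_space) auto
  then have "integrable lebesgue (\<lambda>x. indicator D x *\<^sub>R (indicator U x *\<^sub>R (norm (g x))\<^sup>2))"
    by (rule integrable_mult_indicator[OF D(1)])
  also have "(\<lambda>x. indicator D x *\<^sub>R (indicator U x *\<^sub>R (norm (g x))\<^sup>2)) = (\<lambda>x. indicator V x *\<^sub>R (norm (indicator D x *\<^sub>R g x))\<^sup>2)"
    using D by (intro ext) (auto split: split_indicator)
  finally have "integrable (lebesgue_on V) (\<lambda>x. (norm (indicator D x *\<^sub>R g x))\<^sup>2)"
    using m(1) by (subst integrable_restrict_space) auto
  with meas show ?thesis unfolding L2_def by blast
qed

text \<open>
  Outside \<open>C\<close> the function \<open>G\<close> is almost everywhere equal to \<open>h\<close>, and on \<open>C\<close> it is bounded.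
\<close>

lemma L2_removable_compact:
  fixes G :: "complex^'n \<Rightarrow> complex"
  assumes V: "open V" and G: "continuous_on V G" and C: "compact C" "C \<subseteq> V"
    and h: "h \<in> L2 (V - C)" "negligible {z \<in> V - C. h z \<noteq> G z}"
  shows "G \<in> L2 V"
proof -
  have U: "open (V - C)" using V compact_imp_closed[OF C(1)] by (rule open_Diff)
  have m: "V \<in> sets lebesgue" "V - C \<in> sets lebesgue" using V U by (auto simp: borel_open)
  have Gm: "G \<in> borel_measurable (lebesgue_on V)"
    by (rule continuous_imp_measurable_on_sets_lebesgue[OF G m(1)])
  have GU: "G \<in> borel_measurable (lebesgue_on (V - C))"
    by (rule continuous_imp_measurable_on_sets_lebesgue[OF continuous_on_subset[OF G] m(2)]) auto
  have hU: "h \<in> borel_measurable (lebesgue_on (V - C))" "integrable (lebesgue_on (V - C)) (\<lambda>x. (norm (h x))\<^sup>2)"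
    using h(1) unfolding L2_def by blast+
  have "AE z in lebesgue_on (V - C). h z = G z"
    using h(2) by (simp only: AE_lebesgue_on_iff_negligible[OF U])
  then have "AE z in lebesgue_on (V - C). (norm (h z))\<^sup>2 = (norm (G z))\<^sup>2" by eventually_elim simp
  then have "integrable (lebesgue_on (V - C)) (\<lambda>x. (norm (G x))\<^sup>2)"
    using hU GU by (subst integrable_cong_AE[of _ _ "\<lambda>x. (norm (h x))\<^sup>2"]) auto
  then have i1: "integrable lebesgue (\<lambda>x. indicator (V - C) x *\<^sub>R (norm (G x))\<^sup>2)"
    using m(2) by (subst (asm) integrable_restrict_space) auto
  have "continuous_on C (\<lambda>x. (norm (G x))\<^sup>2)" by (intro continuous_intros continuous_on_subset[OF G C(2)])
  then have "integrable lborel (\<lambda>x. indicator C x *\<^sub>R (norm (G x))\<^sup>2)"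
    using borel_integrable_compact[OF C(1)] by blast
  then have i2: "integrable lebesgue (\<lambda>x. indicator C x *\<^sub>R (norm (G x))\<^sup>2)"
    by (subst integrable_completion) (auto dest: borel_measurable_integrable)
  have "(\<lambda>x. indicator V x *\<^sub>R (norm (G x))\<^sup>2) =
      (\<lambda>x. indicator (V - C) x *\<^sub>R (norm (G x))\<^sup>2 + indicator C x *\<^sub>R (norm (G x))\<^sup>2)"
    using C(2) by (intro ext) (auto split: split_indicator)
  then have "integrable lebesgue (\<lambda>x. indicator V x *\<^sub>R (norm (G x))\<^sup>2)"
    using Bochner_Integration.integrable_add[OF i1 i2] by simp
  then have "integrable (lebesgue_on V) (\<lambda>x. (norm (G x))\<^sup>2)"
    using m(1) by (subst integrable_restrict_space) auto
  with Gm show ?thesis unfolding L2_def by blast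
qed

lemma L2_hartogs:
  fixes h :: "complex^'n \<Rightarrow> complex"
  assumes n: "CARD('n) \<ge> 2" and V: "open V" "bounded V" and C: "compact C" "C \<subseteq> V" "C \<noteq> {}"
    and con: "connected (V - C)" and h: "h \<in> L2 (V - C)" "weakly_holo (V - C) h"
  obtains G where "holo V G" "G \<in> L2 V" "negligible {z \<in> V - C. h z \<noteq> G z}"
proof -
  have U: "open (V - C)" using V(1) compact_imp_closed[OF C(1)] by (rule open_Diff)
  have b: "bounded (V - C)" by (rule bounded_subset[OF V(2)]) auto
  obtain H where H: "holo (V - C) H" "negligible {z \<in> V - C. h z \<noteq> H z}"
    by (rule weyl_lemma[OF U b h]) (rule that)
  obtain G where G: "holo V G" "\<And>z. z \<in> V - C \<Longrightarrow> G z = H z"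
    using hartogs_extension[OF n V C con H(1)] by blast
  have neg: "negligible {z \<in> V - C. h z \<noteq> G z}"
    by (rule negligible_subset[OF H(2)]) (use G(2) in auto)
  show ?thesis
    by (rule that[OF G(1) L2_removable_compact[OF V(1) holo_continuous_on[OF G(1)] C(1,2) h(1) neg] neg])
qed

text \<open>
  The holomorphic representative vanishes almost everywhere on \<open>A\<close>, hence everywhere on \<open>A\<close> by
  continuity.
\<close>

lemma weakly_holo_identity:
  fixes h :: "complex^'n \<Rightarrow> complex"
  assumes V: "open V" "bounded V" "connected V" and h: "h \<in> L2 V" "weakly_holo V h"
    and A: "open A" "A \<noteq> {}" "A \<subseteq> V" "negligible {z \<in> A. h z \<noteq> 0}"
  shows "negligible {z \<in> V. h z \<noteq> 0}"
proof -
  obtain Q where Q: "holo V Q" "negligible {z \<in> V. h z \<noteq> Q z}"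
    by (rule weyl_lemma[OF V(1,2) h]) (rule that)
  define B where "B = {z \<in> A. Q z \<noteq> 0}"
  have cQ: "continuous_on A Q" by (rule continuous_on_subset[OF holo_continuous_on[OF Q(1)] A(3)])
  have "open B"
  proof -
    have "open (A \<inter> Q -` (- {0}))" by (rule continuous_open_preimage[OF cQ A(1)]) auto
    moreover have "B = A \<inter> Q -` (- {0})" by (auto simp: B_def)
    ultimately show ?thesis by simp
  qed
  moreover have "negligible B"
    by (rule negligible_subset[OF negligible_Un[OF A(4) Q(2)]]) (use A(3) in \<open>auto simp: B_def\<close>)
  ultimately have "B = {}" using open_not_negligible by blast
  then have "Q z = 0" if "z \<in> A" for z using that by (auto simp: B_def)
  then have "Q z = 0" if "z \<in> V" for z using holo_identity[OF V(1,3) Q(1) A(1-3) _ that] by blast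
  then show ?thesis by (intro negligible_subset[OF Q(2)]) auto
qed

lemma topspace_cocycles: "topspace (subtopology (L2_topology U) (L2_cocycles U)) = L2_cocycles U"
  by (auto simp: topspace_L2_topology L2_cocycles_def)

lemma zero_cocycle: "(\<lambda>_. 0) \<in> L2_cocycles U"
  by (simp add: L2_cocycles_def L2_zero dbar_closed_def distr_wirtinger_bar_def)

lemma H01_L2_trivial_iff:
  assumes U: "open U"
  shows "H01_L2 U = {H01_L2_zero U} \<longleftrightarrow> L2_cocycles U \<subseteq> L2_coboundaries U"
proof -
  have eq: "equiv (L2_cocycles U) (cohomologous U)"
    using equiv_cohomologous[OF U] by (simp only: topspace_cocycles)
  have rel: "(f, \<lambda>_. 0) \<in> cohomologous U \<longleftrightarrow> f \<in> L2_cocycles U \<and> f \<in> L2_coboundaries U" for f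
    by (simp add: cohomologous_def zero_cocycle)
  show ?thesis
  proof
    assume H: "H01_L2 U = {H01_L2_zero U}"
    show "L2_cocycles U \<subseteq> L2_coboundaries U"
    proof
      fix f assume f: "f \<in> L2_cocycles U"
      then have "cohomologous U `` {f} \<in> H01_L2 U" unfolding H01_L2_def by (rule quotientI)
      then have "cohomologous U `` {f} = cohomologous U `` {\<lambda>_. 0}" unfolding H H01_L2_zero_def by simp
      then have "(f, \<lambda>_. 0) \<in> cohomologous U" using eq_equiv_class[OF _ eq zero_cocycle] by blast
      then show "f \<in> L2_coboundaries U" by (simp add: rel)
    qed
  next
    assume sub: "L2_cocycles U \<subseteq> L2_coboundaries U"
    have c: "cohomologous U `` {f} = H01_L2_zero U" if "f \<in> L2_cocycles U" for f
      unfolding H01_L2_zero_def by (rule equiv_class_eq[OF eq]) (use that sub rel in blast)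
    then show "H01_L2 U = {H01_L2_zero U}"
      unfolding H01_L2_def quotient_def using zero_cocycle by blast
  qed
qed

theorem corollary1p3:
  fixes \<Omega>' \<Omega> K :: "(complex^'n) set"
    and Kj :: "nat \<Rightarrow> (complex^'n) set"
    and N :: nat
  assumes "CARD('n) \<ge> 2"
    and "open \<Omega>'" and "connected \<Omega>'" and "bounded \<Omega>'"
    and "K \<noteq> {}" and "compact K" and "K \<subseteq> \<Omega>'"
    and "\<Omega> = \<Omega>' - K" and "connected \<Omega>"
    and "Hausdorff_space (H01_L2_topology \<Omega>')"
    and "K = (\<Inter>j\<in>{1..N}. Kj j)"
    and "\<And>j. j \<in> {1..N} \<Longrightarrow> compact (Kj j) \<and> Kj j \<subseteq> \<Omega>' \<and> connected (\<Omega>' - Kj j) \<and>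
           Hausdorff_space (H01_L2_topology (\<Omega>' - Kj j))"
    and "\<And>i j. i \<in> {1..N} \<Longrightarrow> j \<in> {1..N} \<Longrightarrow> connected (\<Omega>' - (Kj i \<union> Kj j))"
    and "\<And>j. j \<in> {1..N} \<Longrightarrow> H01_L2 (\<Omega>' - Kj j) = {H01_L2_zero (\<Omega>' - Kj j)}"
  shows "H01_L2 \<Omega> = {H01_L2_zero \<Omega>}"
proof -
  note oV = assms(2) and bV = assms(4)
  define I where "I = {1..N}"
  define U where "U j = \<Omega>' - Kj j" for j
  have C: "compact (Kj j)" "Kj j \<subseteq> \<Omega>'" if "j \<in> I" for j using assms(12) that by (auto simp: I_def)
  have Cne: "Kj j \<noteq> {}" if "j \<in> I" for j using assms(5,11) that by (auto simp: I_def)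
  have oU: "open (U j)" if "j \<in> I" for j
    unfolding U_def using oV compact_imp_closed[OF C(1)[OF that]] by (rule open_Diff)
  \<comment> \<open>an empty intersection would be the whole space, which is not compact\<close>
  have "I \<noteq> {}"
  proof
    assume "I = {}"
    then have "K = UNIV" using assms(11) by (simp add: I_def)
    then show False using compact_imp_bounded[OF assms(6)] not_bounded_UNIV by metis
  qed
  then have 1: "1 \<in> I" by (auto simp: I_def)
  have \<Omega>U: "\<Omega> = (\<Union>j\<in>I. U j)" using assms(8,11) 1 by (auto simp: U_def I_def)
  have o\<Omega>: "open \<Omega>" unfolding \<Omega>U using oU by blast
  have U\<Omega>: "U j \<subseteq> \<Omega>" if "j \<in> I" for j using that \<Omega>U by blast
  have UU: "U i \<inter> U j = \<Omega>' - (Kj i \<union> Kj j)" for i j by (auto simp: U_def)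
  have con: "connected (U i \<inter> U j)" if "i \<in> I" "j \<in> I" for i j
    using assms(13) that by (simp add: UU I_def)
  have "L2_cocycles \<Omega> \<subseteq> L2_coboundaries \<Omega>"
  proof
    fix f assume f: "f \<in> L2_cocycles \<Omega>"
    have fL: "f \<in> L2 \<Omega>" using f by (simp add: L2_cocycles_def)
    have fLW: "f \<in> L2 W" if "open W" "W \<subseteq> \<Omega>" for W by (rule L2_subset[OF o\<Omega> that fL])
    have "\<exists>g. g \<in> L2 (U j) \<and> dbar_eq (U j) g f" if j: "j \<in> I" for j
    proof -
      have "f \<in> L2_cocycles (U j)" by (rule L2_cocycles_subset[OF o\<Omega> oU[OF j] U\<Omega>[OF j] f])
      then have "f \<in> L2_coboundaries (U j)"
        using assms(14)[of j] H01_L2_trivial_iff[OF oU[OF j]] j by (auto simp: U_def I_def)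
      then show ?thesis by (auto simp: L2_coboundaries_def)
    qed
    then obtain g where g: "\<And>j. j \<in> I \<Longrightarrow> g j \<in> L2 (U j)" "\<And>j. j \<in> I \<Longrightarrow> dbar_eq (U j) (g j) f" by metis
    \<comment> \<open>two primitives of \<open>f\<close> differ by a weakly holomorphic function\<close>
    have diff: "(\<lambda>z. a z - b z) \<in> L2 (U i \<inter> U j) \<and> weakly_holo (U i \<inter> U j) (\<lambda>z. a z - b z)"
      if i: "i \<in> I" and j: "j \<in> I" and a: "a \<in> L2 (U i)" "dbar_eq (U i) a f" and b: "b \<in> L2 (U j)" "dbar_eq (U j) b f"
      for i j a b
    proof -
      have o: "open (U i \<inter> U j)" using oU[OF i] oU[OF j] by blast
      have a': "a \<in> L2 (U i \<inter> U j)" "dbar_eq (U i \<inter> U j) a f"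
        by (rule L2_subset[OF oU[OF i] o Int_lower1 a(1)], rule dbar_eq_subset[OF oU[OF i] o Int_lower1 a(2)])
      have b': "b \<in> L2 (U i \<inter> U j)" "dbar_eq (U i \<inter> U j) b f"
        by (rule L2_subset[OF oU[OF j] o Int_lower2 b(1)], rule dbar_eq_subset[OF oU[OF j] o Int_lower2 b(2)])
      have f': "f \<in> L2 (U i \<inter> U j)" by (rule fLW[OF o]) (use U\<Omega>[OF i] in blast)
      have "dbar_eq (U i \<inter> U j) (\<lambda>z. a z - b z) (\<lambda>z. f z - f z)"
        by (rule dbar_eq_diff[OF o a'(1) b'(1) f' f' a'(2) b'(2)])
      then show ?thesis using L2_diff[OF a'(1) b'(1)] by (simp add: weakly_holo_iff_dbar_eq)
    qed
    have "\<exists>E. holo \<Omega>' E \<and> E \<in> L2 \<Omega>' \<and> negligible {z \<in> U j \<inter> U 1. g j z - g 1 z \<noteq> E z}" if j: "j \<in> I" for j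
    proof -
      have d: "(\<lambda>z. g j z - g 1 z) \<in> L2 (\<Omega>' - (Kj j \<union> Kj 1))" "weakly_holo (\<Omega>' - (Kj j \<union> Kj 1)) (\<lambda>z. g j z - g 1 z)"
        using diff[OF j 1 g(1)[OF j] g(2)[OF j] g(1)[OF 1] g(2)[OF 1]] by (simp_all add: UU)
      obtain E where "holo \<Omega>' E" "E \<in> L2 \<Omega>'" "negligible {z \<in> \<Omega>' - (Kj j \<union> Kj 1). g j z - g 1 z \<noteq> E z}"
        by (rule L2_hartogs[OF assms(1) oV bV compact_Un[OF C(1)[OF j] C(1)[OF 1]] _ _ con[OF j 1, unfolded UU] d])
           (use C(2)[OF j] C(2)[OF 1] Cne[OF j] that in auto)
      then show ?thesis by (auto simp: UU)
    qed
    then have "\<forall>j\<in>I. \<exists>E. holo \<Omega>' E \<and> E \<in> L2 \<Omega>' \<and> negligible {z \<in> U j \<inter> U 1. g j z - g 1 z \<noteq> E z}"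
      by (rule ballI)
    from bchoice[OF this] obtain E where
      "\<forall>j\<in>I. holo \<Omega>' (E j) \<and> E j \<in> L2 \<Omega>' \<and> negligible {z \<in> U j \<inter> U 1. g j z - g 1 z \<noteq> E j z}" ..
    then have E: "holo \<Omega>' (E j)" "E j \<in> L2 \<Omega>'" "negligible {z \<in> U j \<inter> U 1. g j z - g 1 z \<noteq> E j z}"
      if "j \<in> I" for j using that by simp_all
    define g' where "g' j z = g j z - E j z" for j z
    have g': "g' j \<in> L2 (U j)" "dbar_eq (U j) (g' j) f" if j: "j \<in> I" for j
    proof -
      have sub: "U j \<subseteq> \<Omega>'" by (auto simp: U_def)
      have EL: "E j \<in> L2 (U j)" by (rule L2_subset[OF oV oU[OF j] sub E(2)[OF j]])
      have "dbar_eq \<Omega>' (E j) (\<lambda>_. 0)"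
        using holo_weakly_holo[OF oV E(1)[OF j]] by (simp add: weakly_holo_iff_dbar_eq)
      then have "dbar_eq (U j) (E j) (\<lambda>_. 0)" by (rule dbar_eq_subset[OF oV oU[OF j] sub])
      from dbar_eq_diff[OF oU[OF j] g(1)[OF j] EL fLW[OF oU[OF j] U\<Omega>[OF j]] L2_zero g(2)[OF j] this]
      show "dbar_eq (U j) (g' j) f" by (simp add: g'_def[abs_def])
      show "g' j \<in> L2 (U j)" unfolding g'_def[abs_def] by (rule L2_diff[OF g(1)[OF j] EL])
    qed
    have agree: "negligible {z \<in> U i \<inter> U j. g' i z \<noteq> g' j z}" if i: "i \<in> I" and j: "j \<in> I" for i j
    proof -
      define A where "A = U i \<inter> U j \<inter> U 1"
      have o: "open (U i \<inter> U j)" "open A" using oU[OF i] oU[OF j] oU[OF 1] by (auto simp: A_def)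
      have b: "bounded (U i \<inter> U j)" by (rule bounded_subset[OF bV]) (auto simp: U_def)
      have "A \<noteq> {}"
      proof
        assume "A = {}"
        then have "\<Omega>' = Kj i \<union> Kj j \<union> Kj 1" using C(2)[OF i] C(2)[OF j] C(2)[OF 1] by (auto simp: A_def U_def)
        then have "closed \<Omega>'" using C(1)[OF i] C(1)[OF j] C(1)[OF 1] by (auto intro: compact_imp_closed)
        then have "\<Omega>' = UNIV" using oV assms(5,7) clopen[of \<Omega>'] by blast
        then show False using bV not_bounded_UNIV by metis
      qed
      have "negligible {z \<in> A. g' i z - g' j z \<noteq> 0}"
      proof (rule negligible_subset[OF negligible_Un[OF E(3)[OF i] E(3)[OF j]]], rule subsetI, rule ccontr)
        fix z
        assume z: "z \<in> {z \<in> A. g' i z - g' j z \<noteq> 0}"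
          and n: "z \<notin> {z \<in> U i \<inter> U 1. g i z - g 1 z \<noteq> E i z} \<union> {z \<in> U j \<inter> U 1. g j z - g 1 z \<noteq> E j z}"
        have e: "g i z - g 1 z = E i z" "g j z - g 1 z = E j z" using n z unfolding A_def by blast+
        from z show False by (simp add: g'_def e[symmetric])
      qed
      then have "negligible {z \<in> U i \<inter> U j. g' i z - g' j z \<noteq> 0}"
        using diff[OF i j g'[OF i] g'[OF j]] \<open>A \<noteq> {}\<close>
        by (intro weakly_holo_identity[OF o(1) b con[OF i j] _ _ o(2)]) (auto simp: A_def)
      then show ?thesis by simp
    qed
    \<comment> \<open>a measurable partition of \<open>\<Omega>\<close>, needed because the \<open>g' j\<close> agree only almost everywhere\<close>
    define D where "D j = U j - (\<Union>i\<in>{1..<j}. U i)" for j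
    define G where "G z = (\<Sum>j\<in>I. indicator (D j) z *\<^sub>R g' j z)" for z
    have GL: "G \<in> L2 \<Omega>"
      unfolding G_def[abs_def]
    proof (rule L2_sum, rule L2_indicator[OF o\<Omega> oU])
      fix j assume j: "j \<in> I"
      have "open (\<Union>i\<in>{1..<j}. U i)" using oU j by (intro open_UN) (auto simp: I_def)
      then show "D j \<in> sets lebesgue" unfolding D_def using oU[OF j] by (auto simp: borel_open)
      show "D j \<subseteq> U j" "D j \<subseteq> \<Omega>" using U\<Omega>[OF j] by (auto simp: D_def)
    qed (use g' in auto)
    have GU: "negligible {z \<in> U j. g' j z \<noteq> G z}" if j: "j \<in> I" for j
    proof (rule negligible_subset[of "\<Union>i\<in>I. {z \<in> U i \<inter> U j. g' i z \<noteq> g' j z}"])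
      show "negligible (\<Union>i\<in>I. {z \<in> U i \<inter> U j. g' i z \<noteq> g' j z})"
        using agree[OF _ j] by (intro negligible_Union) (auto simp: I_def)
      show "{z \<in> U j. g' j z \<noteq> G z} \<subseteq> (\<Union>i\<in>I. {z \<in> U i \<inter> U j. g' i z \<noteq> g' j z})"
      proof
        fix z assume z: "z \<in> {z \<in> U j. g' j z \<noteq> G z}"
        define i where "i = (LEAST i. i \<in> I \<and> z \<in> U i)"
        have i: "i \<in> I" "z \<in> U i" using LeastI[of "\<lambda>i. i \<in> I \<and> z \<in> U i" j] j z by (auto simp: i_def)
        have least: "i \<le> k" if "k \<in> I" "z \<in> U k" for k unfolding i_def by (rule Least_le) (use that in simp)
        have "z \<in> D k \<longleftrightarrow> k = i" if k: "k \<in> I" for k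
        proof
          assume "z \<in> D k"
          then have "z \<in> U k" "\<not> i < k" using i by (auto simp: D_def I_def)
          then show "k = i" using least[OF k] by simp
        next
          assume "k = i"
          moreover have "z \<notin> U l" if "l \<in> {1..<i}" for l using least[of l] that i(1) by (auto simp: I_def)
          ultimately show "z \<in> D k" using i(2) by (auto simp: D_def)
        qed
        then have "G z = (\<Sum>k\<in>I. if k = i then g' k z else 0)"
          unfolding G_def by (intro sum.cong) auto
        also have "\<dots> = g' i z" using i(1) by (simp add: I_def)
        finally show "z \<in> (\<Union>i\<in>I. {z \<in> U i \<inter> U j. g' i z \<noteq> g' j z})" using z i by auto
      qed
    qed
    have "dbar_eq (\<Union>j\<in>I. U j) G f"
    proof (rule dbar_eq_finite_union)
      show "dbar_eq (U j) G f" if j: "j \<in> I" for j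
        by (rule dbar_eq_cong[OF oU[OF j] g'(1)[OF j] L2_subset[OF o\<Omega> oU[OF j] U\<Omega>[OF j] GL] GU[OF j] g'(2)[OF j]])
      show "G \<in> L2 (\<Union>j\<in>I. U j)" "f \<in> L2 (\<Union>j\<in>I. U j)" using GL fL unfolding \<Omega>U .
    qed (use oU in \<open>simp_all add: I_def\<close>)
    then show "f \<in> L2_coboundaries \<Omega>"
      using fL GL unfolding L2_coboundaries_def \<Omega>U[symmetric] by blast
  qed
  then show ?thesis using H01_L2_trivial_iff[OF o\<Omega>] by blast
qed

end
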